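(* Let $\mathcal X$ be an infinite dimensional complex Banach space and let $A\in B(\mathcal X)$. Let $L_A\in B(B(\mathcal X))$ be the operator $L_A(T)=AT$. Then the following statements are equivalent: (i) $A$ satisfies generalized Weyl's theorem. (ii) $L_A$ satisfies generalized Weyl's theorem and $A$ satisfies Browder's theorem.
   Context: For a complex Banach space $\mathcal Z$, $B(\mathcal Z)$ is the Banach algebra of bounded linear operators on $\mathcal Z$. For $T\in B(\mathcal Z)$, $N(T)$, $R(T)$ and $\sigma(T)$ are the null space, range and spectrum; $T-\lambda$ means $T-\lambda I$; $\alpha(T)=\dim N(T)$, $\beta(T)=\dim \mathcal Z/R(T)$. $T$ is Fredholm if $\alpha(T),\beta(T)<\infty$, with index $\mathrm{ind}(T)=\alpha(T)-\beta(T)$; $T$ is Weyl if it is Fredholm of index $0$; $\sigma_w(T)=\{\lambda\in\mathbb C: T-\lambda \text{ is not Weyl}\}$. The ascent $\mathrm{asc}(T)$ (resp. descent $\mathrm{dsc}(T)$) is the smallest non-negative integer $n$ with $N(T^n)=N(T^{n+1})$ (resp. $R(T^n)=R(T^{n+1})$), or $\infty$ if none exists. $\Pi(T)=\{\lambda\in\mathbb C: \mathrm{asc}(T-\lambda)=\mathrm{dsc}(T-\lambda)<\infty\}$ and $\Pi_0(T)=\{\lambda\in\Pi(T):\alpha(T-\lambda)<\infty\}$. Browder's theorem holds for (is satisfied by) $T$ if $\sigma_w(T)=\sigma(T)\setminus\Pi_0(T)$. $T$ is B-Fredholm if for some $n\in\mathbb N$ the range $R(T^n)$ is closed and the induced operator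 $T_n=T|_{R(T^n)}\in B(R(T^n))$ is Fredholm; its index is $\mathrm{ind}(T)=\mathrm{ind}(T_n)$ (independent of such $n$). $T$ is B-Weyl if it is B-Fredholm of index $0$; $\sigma_{BW}(T)=\{\lambda\in\mathbb C: T-\lambda\text{ is not B-Weyl}\}$. For $K\subseteq \mathbb C$, $\mathrm{iso}\,K$ is the set of isolated points of $K$. $E(T)=\{\lambda\in\mathrm{iso}\,\sigma(T): 0<\alpha(T-\lambda)\}$. $T$ satisfies generalized Weyl's theorem if $\sigma_{BW}(T)=\sigma(T)\setminus E(T)$. *)

theory Defs
  imports "HOL-Analysis.Analysis" "HOL-Library.Extended_Nat"
begin

section \<open>Complex Banach spaces\<close>

class complex_normed_vector = real_normed_vector +
  fixes scaleC :: "complex \<Rightarrow> 'a \<Rightarrow> 'a"  (infixr \<open>*\<^sub>C\<close> 75)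
  assumes scaleC_add_right: "a *\<^sub>C (x + y) = a *\<^sub>C x + a *\<^sub>C y"
    and scaleC_add_left: "(a + b) *\<^sub>C x = a *\<^sub>C x + b *\<^sub>C x"
    and scaleC_scaleC: "a *\<^sub>C (b *\<^sub>C x) = (a * b) *\<^sub>C x"
    and scaleC_one: "1 *\<^sub>C x = x"
    and scaleR_scaleC: "r *\<^sub>R x = complex_of_real r *\<^sub>C x"
    and norm_scaleC: "norm (a *\<^sub>C x) = cmod a * norm x"

class complex_banach = complex_normed_vector + banach

global_interpretation complex_vector:
  vector_space "scaleC :: complex \<Rightarrow> 'a \<Rightarrow> 'a::complex_normed_vector"
  defines cspan = complex_vector.span
    and cdim = complex_vector.dim
  by unfold_locales (rule scaleC_add_right scaleC_add_left scaleC_scaleC scaleC_one)+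

definition finite_cdim :: "'a::complex_normed_vector set \<Rightarrow> bool" where
  "finite_cdim S \<longleftrightarrow> (\<exists>B. finite B \<and> S \<subseteq> cspan B)"


section \<open>The Banach space of bounded complex-linear operators\<close>

definition bounded_clinear :: "('a::complex_normed_vector \<Rightarrow> 'b::complex_normed_vector) \<Rightarrow> bool" where
  "bounded_clinear f \<longleftrightarrow> bounded_linear f \<and> (\<forall>c x. f (c *\<^sub>C x) = c *\<^sub>C f x)"

lemma bounded_linear_scaleC_right:
  "bounded_linear (\<lambda>x. c *\<^sub>C (x :: 'a::complex_normed_vector))"
  by (rule bounded_linear_intro[where K = "cmod c"])
    (simp_all add: scaleC_add_right scaleR_scaleC scaleC_scaleC norm_scaleC mult.commute)

lemma bounded_clinear_scaleC_right:
  "bounded_clinear (\<lambda>x. c *\<^sub>C (x :: 'a::complex_normed_vector))"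
  by (simp add: bounded_clinear_def bounded_linear_scaleC_right scaleC_scaleC mult.commute)

lemma bounded_clinear_compose:
  "bounded_clinear f \<Longrightarrow> bounded_clinear g \<Longrightarrow> bounded_clinear (\<lambda>x. f (g x))"
  by (auto simp: bounded_clinear_def intro: bounded_linear_compose)

typedef (overloaded) ('a, 'b) cblinfun (\<open>(_ \<Rightarrow>\<^sub>C\<^sub>L /_)\<close> [22, 21] 21) =
  "{f :: 'a::complex_normed_vector \<Rightarrow> 'b::complex_normed_vector. bounded_clinear f}"
  morphisms cblinfun_apply CBlinfun
  by (rule exI[where x = "\<lambda>x. 0"])
    (simp add: bounded_clinear_def complex_vector.scale_zero_right)

setup_lifting type_definition_cblinfun

lemma cblinfun_eqI: "(\<And>x. cblinfun_apply f x = cblinfun_apply g x) \<Longrightarrow> f = g"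
  by transfer auto

lemma cblinfun_apply_bounded_clinear: "bounded_clinear (cblinfun_apply f)"
  using cblinfun_apply by auto

lemma cblinfun_apply_bounded_linear: "bounded_linear (cblinfun_apply f)"
  using cblinfun_apply_bounded_clinear by (auto simp: bounded_clinear_def)

lemma cblinfun_apply_scaleC: "cblinfun_apply f (c *\<^sub>C x) = c *\<^sub>C cblinfun_apply f x"
  using cblinfun_apply_bounded_clinear by (auto simp: bounded_clinear_def)

lemma onorm_scaleC_le:
  fixes f :: "'a::complex_normed_vector \<Rightarrow> 'b::complex_normed_vector"
  assumes "bounded_linear f"
  shows "onorm (\<lambda>x. c *\<^sub>C f x) \<le> cmod c * onorm f"
  by (rule onorm_bound)
    (auto simp: norm_scaleC mult.assoc intro!: mult_left_mono mult_nonneg_nonneg onorm[OF assms] onorm_pos_le[OF assms])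

lemma onorm_scaleC:
  fixes f :: "'a::complex_normed_vector \<Rightarrow> 'b::complex_normed_vector"
  assumes f: "bounded_linear f"
  shows "onorm (\<lambda>x. c *\<^sub>C f x) = cmod c * onorm f"
proof (cases "c = 0")
  case True
  then show ?thesis by (simp add: complex_vector.scale_zero_left onorm_zero)
next
  case False
  have g: "bounded_linear (\<lambda>x. c *\<^sub>C f x)"
    using bounded_linear_compose[OF bounded_linear_scaleC_right f] .
  have "onorm f = onorm (\<lambda>x. inverse c *\<^sub>C (c *\<^sub>C f x))"
    using False by (simp add: scaleC_scaleC scaleC_one)
  also have "\<dots> \<le> cmod (inverse c) * onorm (\<lambda>x. c *\<^sub>C f x)"
    by (rule onorm_scaleC_le[OF g])
  finally have "cmod c * onorm f \<le> cmod c * (cmod (inverse c) * onorm (\<lambda>x. c *\<^sub>C f x))"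
    by (rule mult_left_mono) simp
  also have "\<dots> = onorm (\<lambda>x. c *\<^sub>C f x)"
    using False by (simp add: norm_inverse)
  finally show ?thesis using onorm_scaleC_le[OF f, of c] by simp
qed

instantiation cblinfun :: (complex_normed_vector, complex_normed_vector) complex_normed_vector
begin

lift_definition norm_cblinfun :: "'a \<Rightarrow>\<^sub>C\<^sub>L 'b \<Rightarrow> real" is onorm .

lift_definition minus_cblinfun :: "'a \<Rightarrow>\<^sub>C\<^sub>L 'b \<Rightarrow> 'a \<Rightarrow>\<^sub>C\<^sub>L 'b \<Rightarrow> 'a \<Rightarrow>\<^sub>C\<^sub>L 'b"
  is "\<lambda>f g x. f x - g x"
  by (auto simp: bounded_clinear_def complex_vector.scale_right_diff_distrib intro: bounded_linear_sub)

definition dist_cblinfun :: "'a \<Rightarrow>\<^sub>C\<^sub>L 'b \<Rightarrow> 'a \<Rightarrow>\<^sub>C\<^sub>L 'b \<Rightarrow> real"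
  where "dist_cblinfun a b = norm (a - b)"

definition uniformity_cblinfun :: "(('a \<Rightarrow>\<^sub>C\<^sub>L 'b) \<times> ('a \<Rightarrow>\<^sub>C\<^sub>L 'b)) filter"
  where [code del]:
    "uniformity_cblinfun = (INF e\<in>{0 <..}. principal {(x, y). dist x y < e})"

definition open_cblinfun :: "('a \<Rightarrow>\<^sub>C\<^sub>L 'b) set \<Rightarrow> bool"
  where [code del]:
    "open_cblinfun S = (\<forall>x\<in>S. \<forall>\<^sub>F (x', y) in uniformity. x' = x \<longrightarrow> y \<in> S)"

lift_definition uminus_cblinfun :: "'a \<Rightarrow>\<^sub>C\<^sub>L 'b \<Rightarrow> 'a \<Rightarrow>\<^sub>C\<^sub>L 'b" is "\<lambda>f x. - f x"
  by (auto simp: bounded_clinear_def complex_vector.scale_minus_right intro: bounded_linear_minus)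

lift_definition zero_cblinfun :: "'a \<Rightarrow>\<^sub>C\<^sub>L 'b" is "\<lambda>x. 0"
  by (auto simp: bounded_clinear_def complex_vector.scale_zero_right)

lift_definition plus_cblinfun :: "'a \<Rightarrow>\<^sub>C\<^sub>L 'b \<Rightarrow> 'a \<Rightarrow>\<^sub>C\<^sub>L 'b \<Rightarrow> 'a \<Rightarrow>\<^sub>C\<^sub>L 'b"
  is "\<lambda>f g x. f x + g x"
  by (auto simp: bounded_clinear_def scaleC_add_right intro: bounded_linear_add)

lift_definition scaleC_cblinfun :: "complex \<Rightarrow> 'a \<Rightarrow>\<^sub>C\<^sub>L 'b \<Rightarrow> 'a \<Rightarrow>\<^sub>C\<^sub>L 'b"
  is "\<lambda>c f x. c *\<^sub>C f x"
  by (rule bounded_clinear_compose[OF bounded_clinear_scaleC_right])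

lift_definition scaleR_cblinfun :: "real \<Rightarrow> 'a \<Rightarrow>\<^sub>C\<^sub>L 'b \<Rightarrow> 'a \<Rightarrow>\<^sub>C\<^sub>L 'b"
  is "\<lambda>r f x. r *\<^sub>R f x"
  unfolding scaleR_scaleC by (rule bounded_clinear_compose[OF bounded_clinear_scaleC_right])

definition sgn_cblinfun :: "'a \<Rightarrow>\<^sub>C\<^sub>L 'b \<Rightarrow> 'a \<Rightarrow>\<^sub>C\<^sub>L 'b"
  where "sgn_cblinfun x = scaleR (inverse (norm x)) x"

instance
  apply standard
  unfolding dist_cblinfun_def open_cblinfun_def sgn_cblinfun_def uniformity_cblinfun_def
  by (rule refl | (transfer, force simp: bounded_clinear_def onorm_triangle onorm_scaleR onorm_scaleC
        onorm_eq_0 algebra_simps scaleC_add_right scaleC_add_left scaleC_scaleC scaleC_one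
        scaleR_scaleC[symmetric]) | (transfer, simp add: fun_eq_iff scaleR_scaleC))+

end

instance cblinfun :: (complex_normed_vector, complex_banach) complex_banach
proof
  fix X :: "nat \<Rightarrow> 'a \<Rightarrow>\<^sub>C\<^sub>L 'b"
  assume X: "Cauchy X"
  define Y where "Y n = Blinfun (cblinfun_apply (X n))" for n
  have Y_apply: "blinfun_apply (Y n) = cblinfun_apply (X n)" for n
    unfolding Y_def by (rule bounded_linear_Blinfun_apply[OF cblinfun_apply_bounded_linear])
  have "norm (Y m - Y n) = norm (X m - X n)" for m n
    by (simp add: norm_blinfun.rep_eq norm_cblinfun.rep_eq minus_blinfun.rep_eq
        minus_cblinfun.rep_eq Y_apply)
  then have "Cauchy Y"
    using X by (simp add: Cauchy_iff)
  then obtain L where L: "Y \<longlonglongrightarrow> L"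
    using Cauchy_convergent convergent_def by blast
  have lim: "(\<lambda>n. cblinfun_apply (X n) x) \<longlonglongrightarrow> blinfun_apply L x" for x
    using blinfun.tendsto[OF L tendsto_const[of x]] by (simp add: Y_apply)
  have "blinfun_apply L (c *\<^sub>C x) = c *\<^sub>C blinfun_apply L x" for c x
  proof (rule LIMSEQ_unique)
    show "(\<lambda>n. cblinfun_apply (X n) (c *\<^sub>C x)) \<longlonglongrightarrow> blinfun_apply L (c *\<^sub>C x)"
      by (rule lim)
    show "(\<lambda>n. cblinfun_apply (X n) (c *\<^sub>C x)) \<longlonglongrightarrow> c *\<^sub>C blinfun_apply L x"
      unfolding cblinfun_apply_scaleC
      by (rule bounded_linear.tendsto[OF bounded_linear_scaleC_right lim])
  qed
  then have "bounded_clinear (blinfun_apply L)"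
    by (simp add: bounded_clinear_def blinfun.bounded_linear_right)
  then have L': "cblinfun_apply (CBlinfun (blinfun_apply L)) = blinfun_apply L"
    by (simp add: CBlinfun_inverse)
  have "norm (X n - CBlinfun (blinfun_apply L)) = norm (Y n - L)" for n
    by (simp add: norm_blinfun.rep_eq norm_cblinfun.rep_eq minus_blinfun.rep_eq
        minus_cblinfun.rep_eq Y_apply L')
  then have "X \<longlonglongrightarrow> CBlinfun (blinfun_apply L)"
    using L by (simp add: LIMSEQ_iff)
  then show "convergent X"
    by (auto simp: convergent_def)
qed

lift_definition id_cblinfun :: "'a::complex_normed_vector \<Rightarrow>\<^sub>C\<^sub>L 'a" is "\<lambda>x. x"
  by (simp add: bounded_clinear_def)

lift_definition cblinfun_compose ::
  "'b::complex_normed_vector \<Rightarrow>\<^sub>C\<^sub>L 'c::complex_normed_vector \<Rightarrow>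
    'a::complex_normed_vector \<Rightarrow>\<^sub>C\<^sub>L 'b \<Rightarrow> 'a \<Rightarrow>\<^sub>C\<^sub>L 'c"  (infixl \<open>o\<^sub>C\<^sub>L\<close> 67)
  is "\<lambda>f g x. f (g x)"
  by (rule bounded_clinear_compose)

lemma norm_cblinfun_compose_le: "norm (f o\<^sub>C\<^sub>L g) \<le> norm f * norm g"
  by transfer (use onorm_compose in \<open>auto simp: bounded_clinear_def comp_def\<close>)

lift_definition left_mult ::
  "'a::complex_normed_vector \<Rightarrow>\<^sub>C\<^sub>L 'a \<Rightarrow> ('a \<Rightarrow>\<^sub>C\<^sub>L 'a) \<Rightarrow>\<^sub>C\<^sub>L ('a \<Rightarrow>\<^sub>C\<^sub>L 'a)"
  is "\<lambda>A T. A o\<^sub>C\<^sub>L T"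
proof -
  fix A :: "'a \<Rightarrow>\<^sub>C\<^sub>L 'a"
  have "bounded_linear (\<lambda>T :: 'a \<Rightarrow>\<^sub>C\<^sub>L 'a. A o\<^sub>C\<^sub>L T)"
    by (rule bounded_linear_intro[where K = "norm A"])
      (transfer, simp add: bounded_clinear_def bounded_linear.linear linear_add linear_scale,
        transfer, simp add: bounded_clinear_def bounded_linear.linear linear_scale,
        metis norm_cblinfun_compose_le mult.commute)
  moreover have "A o\<^sub>C\<^sub>L (c *\<^sub>C T) = c *\<^sub>C (A o\<^sub>C\<^sub>L T)" for c and T :: "'a \<Rightarrow>\<^sub>C\<^sub>L 'a"
    by transfer (simp add: bounded_clinear_def)
  ultimately show "bounded_clinear (\<lambda>T :: 'a \<Rightarrow>\<^sub>C\<^sub>L 'a. A o\<^sub>C\<^sub>L T)"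
    by (simp add: bounded_clinear_def)
qed


section \<open>Spectrum, ascent and descent\<close>

definition shift :: "'a::complex_normed_vector \<Rightarrow>\<^sub>C\<^sub>L 'a \<Rightarrow> complex \<Rightarrow> 'a \<Rightarrow>\<^sub>C\<^sub>L 'a" where
  "shift T \<mu> = T - \<mu> *\<^sub>C id_cblinfun"

definition op_spectrum :: "'a::complex_normed_vector \<Rightarrow>\<^sub>C\<^sub>L 'a \<Rightarrow> complex set" where
  "op_spectrum T = {\<mu>. \<not> (\<exists>S. S o\<^sub>C\<^sub>L shift T \<mu> = id_cblinfun \<and> shift T \<mu> o\<^sub>C\<^sub>L S = id_cblinfun)}"

definition null_pow :: "'a::complex_normed_vector \<Rightarrow>\<^sub>C\<^sub>L 'a \<Rightarrow> nat \<Rightarrow> 'a set" where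
  "null_pow T n = {x. (cblinfun_apply T ^^ n) x = 0}"

definition range_pow :: "'a::complex_normed_vector \<Rightarrow>\<^sub>C\<^sub>L 'a \<Rightarrow> nat \<Rightarrow> 'a set" where
  "range_pow T n = range (cblinfun_apply T ^^ n)"

text \<open>The infimum of the empty set in \<^typ>\<open>enat\<close> is \<open>\<infinity>\<close>.\<close>

definition asc :: "'a::complex_normed_vector \<Rightarrow>\<^sub>C\<^sub>L 'a \<Rightarrow> enat" where
  "asc T = (INF n\<in>{n. null_pow T n = null_pow T (Suc n)}. enat n)"

definition dsc :: "'a::complex_normed_vector \<Rightarrow>\<^sub>C\<^sub>L 'a \<Rightarrow> enat" where
  "dsc T = (INF n\<in>{n. range_pow T n = range_pow T (Suc n)}. enat n)"


section \<open>Fredholm, Weyl, B-Fredholm and B-Weyl operators\<close>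

definition ecdim :: "'a::complex_normed_vector set \<Rightarrow> enat" where
  "ecdim S = (if finite_cdim S then enat (cdim S) else \<infinity>)"

text \<open>For subspaces \<open>W \<subseteq> V\<close>, the predicate says that the cosets \<open>b + W\<close> with \<open>b \<in> B\<close> are pairwise
  distinct and form a (finite) basis of the quotient space \<open>V / W\<close>.\<close>

definition quotient_basis ::
  "'a::complex_normed_vector set \<Rightarrow> 'a set \<Rightarrow> 'a set \<Rightarrow> bool" where
  "quotient_basis V W B \<longleftrightarrow> finite B \<and> B \<subseteq> V \<and>
     (\<forall>u. (\<Sum>b\<in>B. u b *\<^sub>C b) \<in> W \<longrightarrow> (\<forall>b\<in>B. u b = 0)) \<and>
     (\<forall>v\<in>V. \<exists>u. v - (\<Sum>b\<in>B. u b *\<^sub>C b) \<in> W)"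

definition quotient_dim :: "'a::complex_normed_vector set \<Rightarrow> 'a set \<Rightarrow> enat" where
  "quotient_dim V W =
     (if \<exists>B. quotient_basis V W B then enat (card (SOME B. quotient_basis V W B)) else \<infinity>)"

text \<open>The notions with suffix \<open>_on\<close> are those of the operator \<open>V \<rightarrow> V\<close> induced by \<open>T\<close> on a
  \<open>T\<close>-invariant subspace \<open>V\<close>; \<open>V = UNIV\<close> gives the notions for \<open>T\<close> itself.\<close>

definition alpha_on :: "'a::complex_normed_vector set \<Rightarrow> 'a \<Rightarrow>\<^sub>C\<^sub>L 'a \<Rightarrow> enat" where
  "alpha_on V T = ecdim {x \<in> V. cblinfun_apply T x = 0}"

definition beta_on :: "'a::complex_normed_vector set \<Rightarrow> 'a \<Rightarrow>\<^sub>C\<^sub>L 'a \<Rightarrow> enat" where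
  "beta_on V T = quotient_dim V (cblinfun_apply T ` V)"

definition fredholm_on :: "'a::complex_normed_vector set \<Rightarrow> 'a \<Rightarrow>\<^sub>C\<^sub>L 'a \<Rightarrow> bool" where
  "fredholm_on V T \<longleftrightarrow> alpha_on V T < \<infinity> \<and> beta_on V T < \<infinity>"

text \<open>Only meaningful for Fredholm operators.\<close>

definition index_on :: "'a::complex_normed_vector set \<Rightarrow> 'a \<Rightarrow>\<^sub>C\<^sub>L 'a \<Rightarrow> int" where
  "index_on V T = int (the_enat (alpha_on V T)) - int (the_enat (beta_on V T))"

abbreviation alpha :: "'a::complex_normed_vector \<Rightarrow>\<^sub>C\<^sub>L 'a \<Rightarrow> enat" where
  "alpha T \<equiv> alpha_on UNIV T"

definition weyl :: "'a::complex_normed_vector \<Rightarrow>\<^sub>C\<^sub>L 'a \<Rightarrow> bool" where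
  "weyl T \<longleftrightarrow> fredholm_on UNIV T \<and> index_on UNIV T = 0"

definition b_fredholm_at :: "'a::complex_normed_vector \<Rightarrow>\<^sub>C\<^sub>L 'a \<Rightarrow> nat \<Rightarrow> bool" where
  "b_fredholm_at T n \<longleftrightarrow> closed (range_pow T n) \<and> fredholm_on (range_pow T n) T"

definition b_fredholm :: "'a::complex_normed_vector \<Rightarrow>\<^sub>C\<^sub>L 'a \<Rightarrow> bool" where
  "b_fredholm T \<longleftrightarrow> (\<exists>n. b_fredholm_at T n)"

text \<open>The index does not depend on the choice of \<open>n\<close>; the least one is taken.\<close>

definition b_index :: "'a::complex_normed_vector \<Rightarrow>\<^sub>C\<^sub>L 'a \<Rightarrow> int" where
  "b_index T = index_on (range_pow T (LEAST n. b_fredholm_at T n)) T"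

definition b_weyl :: "'a::complex_normed_vector \<Rightarrow>\<^sub>C\<^sub>L 'a \<Rightarrow> bool" where
  "b_weyl T \<longleftrightarrow> b_fredholm T \<and> b_index T = 0"


section \<open>Weyl type theorems\<close>

definition weyl_spectrum :: "'a::complex_normed_vector \<Rightarrow>\<^sub>C\<^sub>L 'a \<Rightarrow> complex set" where
  "weyl_spectrum T = {\<mu>. \<not> weyl (shift T \<mu>)}"

definition b_weyl_spectrum :: "'a::complex_normed_vector \<Rightarrow>\<^sub>C\<^sub>L 'a \<Rightarrow> complex set" where
  "b_weyl_spectrum T = {\<mu>. \<not> b_weyl (shift T \<mu>)}"

text \<open>\<open>poles T\<close> is the set \<open>\<Pi>(T)\<close>; it also contains all points of the resolvent set.\<close>

definition poles :: "'a::complex_normed_vector \<Rightarrow>\<^sub>C\<^sub>L 'a \<Rightarrow> complex set" where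
  "poles T = {\<mu>. asc (shift T \<mu>) = dsc (shift T \<mu>) \<and> dsc (shift T \<mu>) < \<infinity>}"

definition poles_finite_rank :: "'a::complex_normed_vector \<Rightarrow>\<^sub>C\<^sub>L 'a \<Rightarrow> complex set" where
  "poles_finite_rank T = {\<mu> \<in> poles T. alpha (shift T \<mu>) < \<infinity>}"

definition iso :: "complex set \<Rightarrow> complex set" where
  "iso K = {\<mu>. \<mu> isolated_in K}"

definition isolated_eigenvalues :: "'a::complex_normed_vector \<Rightarrow>\<^sub>C\<^sub>L 'a \<Rightarrow> complex set" where
  "isolated_eigenvalues T = {\<mu> \<in> iso (op_spectrum T). 0 < alpha (shift T \<mu>)}"

definition browder_theorem :: "'a::complex_normed_vector \<Rightarrow>\<^sub>C\<^sub>L 'a \<Rightarrow> bool" where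
  "browder_theorem T \<longleftrightarrow> weyl_spectrum T = op_spectrum T - poles_finite_rank T"

definition generalized_weyl_theorem :: "'a::complex_normed_vector \<Rightarrow>\<^sub>C\<^sub>L 'a \<Rightarrow> bool" where
  "generalized_weyl_theorem T \<longleftrightarrow> b_weyl_spectrum T = op_spectrum T - isolated_eigenvalues T"

end

theory Submission
  imports Defs
begin

text \<open>
  Fix a complex number \<open>\<nu>\<close> and write \<open>S = A - \<nu>\<close>, so that \<open>L\<^sub>A - \<nu> = L\<^sub>S\<close>. The theorem combines a
  fact about left multiplications with two facts about B-Weyl points.

  Left multiplication makes Fredholm theory trivial in infinite dimension. If a nonzero vector \<open>y\<close>
  lies in \<open>N(S) \<inter> R(S\<^sup>n)\<close>, or if \<open>y\<close> lies in \<open>R(S\<^sup>n)\<close> but not in \<open>R(S\<^sup>n\<^sup>+\<^sup>1)\<close>, then the rank-one operators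
  \<open>\<phi> \<otimes> y\<close>, with \<open>\<phi>\<close> running through the infinite-dimensional dual space, show that the operator
  induced by \<open>L\<^sub>S\<close> on \<open>R(L\<^sub>S\<^sup>n)\<close> has infinite nullity or infinite defect. So \<open>L\<^sub>S\<close> is B-Fredholm only
  if \<open>S\<close> is bijective on some \<open>R(S\<^sup>n)\<close>, that is, \<open>\<nu> \<in> \<Pi>(A)\<close>; and in that case \<open>L\<^sub>S\<close> is B-Weyl
  (\<open>b_weyl_left_mult_iff\<close>). Since \<open>A\<close> and \<open>L\<^sub>A\<close> have the same spectrum and the same isolated
  eigenvalues, generalized Weyl's theorem for \<open>L\<^sub>A\<close> says exactly that \<open>\<Pi>(A) \<inter> \<sigma>(A) = E(A)\<close>
  (\<open>generalized_weyl_left_mult_iff\<close>).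

  Let now \<open>S\<close> be B-Weyl. Then \<open>S - \<mu>\<close> is Weyl for all small \<open>\<mu> \<noteq> 0\<close> (\<open>b_weyl_imp_weyl_nearby\<close>), and
  either \<open>\<nu>\<close> is in \<open>\<Pi>(A)\<close> or a whole disc around \<open>\<nu>\<close> consists of eigenvalues
  (\<open>b_weyl_pole_or_disc_in_spectrum\<close>). For the latter, the spaces \<open>N(S) \<inter> R(S\<^sup>m)\<close> eventually are
  constant. If they vanish, index zero forces \<open>S\<close> to be bijective on \<open>R(S\<^sup>m)\<close>. Otherwise they contain
  a nonzero \<open>e\<close> which lies in all \<open>R(S\<^sup>m)\<close>; on the intersection of these spaces \<open>S\<close> has a bounded
  right inverse, with which \<open>e\<close> is perturbed to an eigenvector for each small \<open>\<mu>\<close>.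

  If \<open>A\<close> satisfies generalized Weyl's theorem, the points of \<open>E(A)\<close> are B-Weyl and isolated in the
  spectrum, so no disc is possible and \<open>E(A) \<subseteq> \<Pi>(A)\<close>. Conversely points of \<open>\<Pi>(A)\<close> are B-Weyl,
  whence \<open>\<Pi>(A) \<inter> \<sigma>(A) \<subseteq> E(A)\<close>. A Weyl point is B-Weyl, hence in \<open>\<Pi>(A)\<close> with finite nullity;
  as points of \<open>\<Pi>\<^sub>0(A)\<close> are Weyl, Browder's theorem follows.

  If, on the other hand, \<open>\<Pi>(A) \<inter> \<sigma>(A) = E(A)\<close> and Browder's theorem holds, a B-Weyl point outside
  \<open>\<Pi>(A)\<close> would be the centre of a disc in the spectrum containing Weyl points; by Browder's theorem
  these are in \<open>\<Pi>(A) \<inter> \<sigma>(A) = E(A)\<close>, hence isolated in the spectrum, which is absurd. So the B-Weyl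
  points are those of \<open>\<Pi>(A)\<close>, and generalized Weyl's theorem follows.

  The analysis rests on the Hahn-Banach theorem, which supplies the functionals \<open>\<phi>\<close>, and on the open
  mapping theorem; index computations are done with quotient dimensions in \<^typ>\<open>enat\<close>.
\<close>

section \<open>Dimensions of quotient spaces\<close>

abbreviation csubspace :: "'a::complex_normed_vector set \<Rightarrow> bool" where
  "csubspace \<equiv> complex_vector.subspace"

definition indep_mod :: "'a::complex_normed_vector set \<Rightarrow> 'a set \<Rightarrow> bool" where
  "indep_mod W B \<longleftrightarrow> finite B \<and> (\<forall>u. (\<Sum>b\<in>B. u b *\<^sub>C b) \<in> W \<longrightarrow> (\<forall>b\<in>B. u b = 0))"

lemma indep_modD: "indep_mod W B \<Longrightarrow> (\<Sum>b\<in>B. u b *\<^sub>C b) \<in> W \<Longrightarrow> b \<in> B \<Longrightarrow> u b = 0"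
  unfolding indep_mod_def by blast

lemma quotient_basis_indep_mod: "quotient_basis V W B \<Longrightarrow> indep_mod W B"
  unfolding quotient_basis_def indep_mod_def by blast

lemma sum_scaleC_indicator:
  assumes "finite B" "b \<in> B"
  shows "(\<Sum>x\<in>B. (if x = b then c else 0) *\<^sub>C x) = c *\<^sub>C (b :: 'a::complex_normed_vector)"
proof -
  have "(\<Sum>x\<in>B. (if x = b then c else 0) *\<^sub>C x) = (\<Sum>x\<in>B. if x = b then c *\<^sub>C x else 0)"
    by (intro sum.cong) (auto simp: complex_vector.scale_zero_left)
  then show ?thesis using assms by simp
qed

lemma indep_mod_subset:
  assumes "indep_mod W B" "C \<subseteq> B"
  shows "indep_mod W C"
proof -
  have fB: "finite B" using assms by (auto simp: indep_mod_def)
  have "\<forall>b\<in>C. u b = 0" if "(\<Sum>b\<in>C. u b *\<^sub>C b) \<in> W" for u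
  proof -
    have "(\<Sum>b\<in>B. (if b \<in> C then u b else 0) *\<^sub>C b) = (\<Sum>b\<in>C. u b *\<^sub>C b)"
      using fB assms(2)
      by (intro sum.mono_neutral_cong_right) (auto simp: complex_vector.scale_zero_left)
    then show ?thesis
      using that indep_modD[OF assms(1), of "\<lambda>b. if b \<in> C then u b else 0"] assms(2)
      by (smt (verit, best) subsetD)
  qed
  then show ?thesis
    using finite_subset[OF assms(2) fB] unfolding indep_mod_def by blast
qed

text \<open>
  Every comparison of quotient dimensions below goes through this transfer principle: a map that
  reflects linear relations carries independent sets to independent sets of the same cardinality.
  It need not be linear, so it may be built from arbitrary choices of preimages or components.
\<close>

lemma indep_mod_image:
  assumes ind: "indep_mod W B" and W: "0 \<in> W'"
    and refl: "\<And>u. (\<Sum>b\<in>B. u b *\<^sub>C g b) \<in> W' \<Longrightarrow> (\<Sum>b\<in>B. u b *\<^sub>C b) \<in> W"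
  shows "indep_mod W' (g ` B)" "card (g ` B) = card B"
proof -
  have fB: "finite B" using ind by (simp add: indep_mod_def)
  have inj: "inj_on g B"
  proof (rule inj_onI, rule ccontr)
    fix x y assume xy: "x \<in> B" "y \<in> B" "g x = g y" "x \<noteq> y"
    let ?u = "\<lambda>b. if b = x then 1 else if b = y then -1 else (0::complex)"
    have "(\<Sum>b\<in>B. ?u b *\<^sub>C g b) = (\<Sum>b\<in>{x,y}. ?u b *\<^sub>C g b)"
      using fB xy by (intro sum.mono_neutral_right) (auto simp: complex_vector.scale_zero_left)
    also have "\<dots> = 0" using xy by (auto simp: scaleC_one complex_vector.scale_minus_left)
    finally have "?u x = 0" using refl[of ?u] indep_modD[OF ind, of ?u x] xy W by auto
    then show False by simp
  qed
  then show "card (g ` B) = card B" by (rule card_image)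
  have "\<forall>b\<in>g ` B. u b = 0" if "(\<Sum>b\<in>g ` B. u b *\<^sub>C b) \<in> W'" for u
  proof -
    have "(\<Sum>b\<in>g ` B. u b *\<^sub>C b) = (\<Sum>b\<in>B. u (g b) *\<^sub>C g b)"
      by (simp add: sum.reindex[OF inj])
    then have "(\<Sum>b\<in>B. u (g b) *\<^sub>C b) \<in> W" using that refl[of "\<lambda>b. u (g b)"] by simp
    then show ?thesis using indep_modD[OF ind, of "\<lambda>b. u (g b)"] by auto
  qed
  then show "indep_mod W' (g ` B)" using fB unfolding indep_mod_def by blast
qed

text \<open>
  Modulo \<open>W\<close> every element of \<open>C\<close> may be replaced by a combination of \<open>B\<close>; this keeps independence
  and reduces the claim to the exchange lemma for the span of \<open>B\<close>.
\<close>

lemma indep_mod_card_le: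
  assumes W: "csubspace W" and ind: "indep_mod W C" and "finite B"
    and span: "\<And>v. v \<in> C \<Longrightarrow> \<exists>u. v - (\<Sum>b\<in>B. u b *\<^sub>C b) \<in> W"
  shows "card C \<le> card B"
proof -
  from span obtain u where u: "\<And>v. v \<in> C \<Longrightarrow> v - (\<Sum>b\<in>B. u v b *\<^sub>C b) \<in> W" by metis
  define g where "g v = (\<Sum>b\<in>B. u v b *\<^sub>C b)" for v
  have fC: "finite C" using ind by (simp add: indep_mod_def)
  have refl: "(\<Sum>v\<in>C. c v *\<^sub>C v) \<in> W" if "(\<Sum>v\<in>C. c v *\<^sub>C g v) \<in> {0}" for c
  proof -
    have "(\<Sum>v\<in>C. c v *\<^sub>C (v - g v)) \<in> W"
      using u by (intro complex_vector.subspace_sum[OF W] complex_vector.subspace_scale[OF W])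
        (auto simp: g_def)
    then show ?thesis
      using that by (simp add: complex_vector.scale_right_diff_distrib sum_subtractf)
  qed
  have ind': "indep_mod {0} (g ` C)" and card: "card (g ` C) = card C"
    using indep_mod_image[OF ind _ refl] by auto
  have "complex_vector.independent (g ` C)"
    using ind' by (intro complex_vector.independent_if_scalars_zero) (auto simp: indep_mod_def)
  moreover have "g ` C \<subseteq> cspan B"
    unfolding g_def image_subset_iff
    by (intro ballI complex_vector.span_sum complex_vector.span_scale complex_vector.span_base)
  ultimately show ?thesis
    using complex_vector.independent_span_bound[OF \<open>finite B\<close>] card by metis
qed

lemma quotient_dim_eq_card:
  assumes W: "csubspace W" and "quotient_basis V W B"
  shows "quotient_dim V W = enat (card B)"
proof -
  have "card C = card B" if "quotient_basis V W C" for C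
  proof (rule antisym)
    show "card C \<le> card B"
      using that assms(2)
      by (intro indep_mod_card_le[OF W quotient_basis_indep_mod[OF that]])
        (auto simp: quotient_basis_def)
    show "card B \<le> card C"
      using that assms(2)
      by (intro indep_mod_card_le[OF W quotient_basis_indep_mod[OF assms(2)]])
        (auto simp: quotient_basis_def)
  qed
  then have "card (SOME B. quotient_basis V W B) = card B"
    using someI[of "quotient_basis V W", OF assms(2)] by blast
  moreover have "\<exists>B. quotient_basis V W B" using assms(2) by blast
  ultimately show ?thesis by (simp only: quotient_dim_def if_True)
qed

text \<open>
  An independent set of maximal size spans.
\<close>

lemma quotient_basis_exists:
  assumes W: "csubspace W"
    and bound: "\<And>B. B \<subseteq> V \<Longrightarrow> indep_mod W B \<Longrightarrow> card B \<le> n"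
  shows "\<exists>B. quotient_basis V W B"
proof -
  let ?P = "\<lambda>B. B \<subseteq> V \<and> indep_mod W B"
  have "?P {}" by (simp add: indep_mod_def)
  moreover have "\<forall>B. ?P B \<longrightarrow> card B < Suc n" using bound by (simp add: less_Suc_eq_le)
  ultimately have "\<exists>B. ?P B \<and> (\<forall>C. ?P C \<longrightarrow> card C \<le> card B)"
    by (rule ex_has_greatest_nat[where P = ?P and f = card])
  then obtain B where B: "?P B" and max: "\<And>C. ?P C \<Longrightarrow> card C \<le> card B"
    by auto
  then have fB: "finite B" by (simp add: indep_mod_def)
  have "\<exists>u. v - (\<Sum>b\<in>B. u b *\<^sub>C b) \<in> W" if v: "v \<in> V" for v
  proof (cases "v \<in> B")
    case True
    then have "v - (\<Sum>b\<in>B. (if b = v then 1 else 0) *\<^sub>C b) \<in> W"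
      using sum_scaleC_indicator[OF fB True, of 1] complex_vector.subspace_0[OF W]
      by (simp add: scaleC_one)
    then show ?thesis by (rule exI[where x = "\<lambda>b. if b = v then 1 else 0"])
  next
    case False
    have "\<not> ?P (insert v B)"
      using max[of "insert v B"] False fB by auto
    then obtain u where u: "(\<Sum>b\<in>insert v B. u b *\<^sub>C b) \<in> W" "\<exists>b\<in>insert v B. u b \<noteq> 0"
      using v B fB by (auto simp: indep_mod_def)
    have eq: "(\<Sum>b\<in>insert v B. u b *\<^sub>C b) = u v *\<^sub>C v + (\<Sum>b\<in>B. u b *\<^sub>C b)"
      using False fB by simp
    have uv: "u v \<noteq> 0"
    proof
      assume "u v = 0"
      then have "(\<Sum>b\<in>B. u b *\<^sub>C b) \<in> W" using u(1) eq by (simp add: complex_vector.scale_zero_left)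
      then show False using B u(2) \<open>u v = 0\<close> by (auto simp: indep_mod_def)
    qed
    have "inverse (u v) *\<^sub>C (u v *\<^sub>C v + (\<Sum>b\<in>B. u b *\<^sub>C b)) \<in> W"
      using u(1) eq complex_vector.subspace_scale[OF W] by simp
    also have "inverse (u v) *\<^sub>C (u v *\<^sub>C v + (\<Sum>b\<in>B. u b *\<^sub>C b))
        = v - (\<Sum>b\<in>B. (- (inverse (u v) * u b)) *\<^sub>C b)"
      using uv by (simp add: scaleC_add_right scaleC_scaleC scaleC_one complex_vector.scale_sum_right
          complex_vector.scale_minus_left sum_negf)
    finally show ?thesis by (rule exI[where x = "\<lambda>b. - (inverse (u v) * u b)"])
  qed
  then show ?thesis
    using B unfolding quotient_basis_def indep_mod_def by blast
qed

text \<open>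
  The quotient dimension is the supremum of the sizes of independent sets, in finite and infinite
  dimension alike; this spares a separate treatment of infinite quotients from here on.
\<close>

lemma enat_le_quotient_dim_iff:
  assumes W: "csubspace W"
  shows "enat n \<le> quotient_dim V W \<longleftrightarrow> (\<exists>B\<subseteq>V. indep_mod W B \<and> card B = n)"
proof (cases "\<exists>B. quotient_basis V W B")
  case True
  then obtain B where B: "quotient_basis V W B" by blast
  then have d: "quotient_dim V W = enat (card B)" by (rule quotient_dim_eq_card[OF W])
  show ?thesis
  proof
    assume "enat n \<le> quotient_dim V W"
    then obtain C where "C \<subseteq> B" "card C = n"
      using d obtain_subset_with_card_n by (metis enat_ord_simps(1))
    then show "\<exists>B\<subseteq>V. indep_mod W B \<and> card B = n"
      using B indep_mod_subset[OF quotient_basis_indep_mod[OF B]]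
      by (auto simp: quotient_basis_def)
  next
    assume "\<exists>B\<subseteq>V. indep_mod W B \<and> card B = n"
    then obtain C where "C \<subseteq> V" "indep_mod W C" "card C = n" by blast
    then show "enat n \<le> quotient_dim V W"
      using indep_mod_card_le[OF W, of C B] B d
      by (simp add: quotient_basis_def) (metis subsetD)
  qed
next
  case False
  then have "\<exists>C\<subseteq>V. indep_mod W C \<and> card C > n"
    using quotient_basis_exists[OF W, of V n] by (metis not_le)
  then obtain C where C: "C \<subseteq> V" "indep_mod W C" "card C > n" by blast
  then obtain D where "D \<subseteq> C" "card D = n" using obtain_subset_with_card_n[of n C] by auto
  then have "\<exists>B\<subseteq>V. indep_mod W B \<and> card B = n"
    using C indep_mod_subset by blast
  then show ?thesis using False by (simp add: quotient_dim_def)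
qed

lemma enat_le_by_approx: 
  assumes approx: "\<And>n. enat n \<le> x \<Longrightarrow> enat n \<le> y" 
  shows "x \<le> y"
proof (cases y)
  case (enat m)
  show ?thesis
  proof (rule ccontr)
    assume "\<not> x \<le> y"
    then have "y < x" by (simp only: not_le)
    then have "enat (Suc m) \<le> x" unfolding enat by (simp only: Suc_ile_eq)
    then have "enat (Suc m) \<le> y" by (rule approx)
    then show False unfolding enat by simp
  qed
next
  case infinity
  then show ?thesis by simp
qed

lemma quotient_dim_le:
  assumes W: "csubspace W" and W': "csubspace W'" and g: "g \<in> V \<rightarrow> V'"
    and refl: "\<And>B u. B \<subseteq> V \<Longrightarrow> finite B \<Longrightarrow> (\<Sum>b\<in>B. u b *\<^sub>C g b) \<in> W' \<Longrightarrow> (\<Sum>b\<in>B. u b *\<^sub>C b) \<in> W"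
  shows "quotient_dim V W \<le> quotient_dim V' W'"
proof (rule enat_le_by_approx)
  fix n assume "enat n \<le> quotient_dim V W"
  then obtain B where B: "B \<subseteq> V" "indep_mod W B" "card B = n"
    unfolding enat_le_quotient_dim_iff[OF W] by blast
  then have fB: "finite B" by (simp add: indep_mod_def)
  have "indep_mod W' (g ` B)" "card (g ` B) = n" "g ` B \<subseteq> V'"
    using indep_mod_image[OF B(2) complex_vector.subspace_0[OF W'] refl[OF B(1) fB]] B(1,3) g
    by auto
  then show "enat n \<le> quotient_dim V' W'"
    using enat_le_quotient_dim_iff[OF W'] by blast
qed

lemma quotient_dim_mono:
  assumes "csubspace W" "V \<subseteq> V'"
  shows "quotient_dim V W \<le> quotient_dim V' W"
proof (rule quotient_dim_le[OF assms(1,1), where g = "\<lambda>x. x"])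
  show "(\<lambda>x. x) \<in> V \<rightarrow> V'" using assms(2) by blast
qed

lemma quotient_dim_antimono:
  assumes "csubspace W" "csubspace W'" "W \<subseteq> W'"
  shows "quotient_dim V W' \<le> quotient_dim V W"
proof (rule quotient_dim_le[OF assms(2,1), where g = "\<lambda>x. x"])
  show "(\<lambda>x. x) \<in> V \<rightarrow> V" by blast
  show "(\<Sum>b\<in>B. u b *\<^sub>C b) \<in> W'" if "(\<Sum>b\<in>B. u b *\<^sub>C b) \<in> W" for B u
    using that assms(3) by (rule rev_subsetD)
qed

lemma quotient_dim_finite_iff:
  "quotient_dim V W < \<infinity> \<longleftrightarrow> (\<exists>B. quotient_basis V W B)"
  by (cases "\<exists>B. quotient_basis V W B") (simp_all add: quotient_dim_def)

text \<open>
  Additivity along chains, together with the second isomorphism theorem and the invariance under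
  images below, carries all index computations. These equations hold for infinite values as well,
  so finiteness has to be argued only where a summand is cancelled.
\<close>

lemma quotient_dim_chain:
  assumes A: "csubspace A" and B: "csubspace B" and C: "csubspace C" and "C \<subseteq> B" "B \<subseteq> A"
  shows "quotient_dim A C = quotient_dim A B + quotient_dim B C"
proof (cases "quotient_dim A B < \<infinity> \<and> quotient_dim B C < \<infinity>")
  case True
  then obtain P Q where P: "quotient_basis A B P" and Q: "quotient_basis B C Q"
    unfolding quotient_dim_finite_iff by blast
  then have f: "finite P" "finite Q" and sub: "P \<subseteq> A" "Q \<subseteq> B"
    by (auto simp: quotient_basis_def)
  have disj: "P \<inter> Q = {}"
  proof (rule ccontr)
    assume "P \<inter> Q \<noteq> {}"
    then obtain p where p: "p \<in> P" "p \<in> B" using sub by blast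
    then have "(\<Sum>b\<in>P. (if b = p then 1 else 0) *\<^sub>C b) \<in> B"
      using sum_scaleC_indicator[OF f(1) p(1), of 1] by (simp add: scaleC_one)
    then have "(if p = p then 1 else 0) = (0 :: complex)"
      by (rule indep_modD[OF quotient_basis_indep_mod[OF P]]) (rule p(1))
    then show False by simp
  qed
  have "quotient_basis A C (P \<union> Q)"
    unfolding quotient_basis_def
  proof (intro conjI allI impI ballI)
    show "finite (P \<union> Q)" using f by simp
    show "P \<union> Q \<subseteq> A" using sub assms by blast
  next
    fix u b assume u: "(\<Sum>b\<in>P \<union> Q. u b *\<^sub>C b) \<in> C" and b: "b \<in> P \<union> Q"
    have s: "(\<Sum>b\<in>P \<union> Q. u b *\<^sub>C b) = (\<Sum>b\<in>P. u b *\<^sub>C b) + (\<Sum>b\<in>Q. u b *\<^sub>C b)"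
      using f disj by (simp add: sum.union_disjoint)
    have QB: "(\<Sum>b\<in>Q. u b *\<^sub>C b) \<in> B"
      using sub by (intro complex_vector.subspace_sum[OF B] complex_vector.subspace_scale[OF B]) auto
    have "(\<Sum>b\<in>P. u b *\<^sub>C b) \<in> B"
      using complex_vector.subspace_diff[OF B _ QB, of "(\<Sum>b\<in>P \<union> Q. u b *\<^sub>C b)"] u s \<open>C \<subseteq> B\<close> by auto
    then have uP: "\<forall>b\<in>P. u b = 0" using indep_modD[OF quotient_basis_indep_mod[OF P]] by blast
    then have "(\<Sum>b\<in>P. u b *\<^sub>C b) = 0" by (simp add: complex_vector.scale_zero_left)
    then have "(\<Sum>b\<in>Q. u b *\<^sub>C b) \<in> C" using u s by simp
    then have "\<forall>b\<in>Q. u b = 0" using indep_modD[OF quotient_basis_indep_mod[OF Q]] by blast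
    then show "u b = 0" using uP b by blast
  next
    fix v assume "v \<in> A"
    then obtain u where u: "v - (\<Sum>b\<in>P. u b *\<^sub>C b) \<in> B" using P by (auto simp: quotient_basis_def)
    then obtain w where w: "v - (\<Sum>b\<in>P. u b *\<^sub>C b) - (\<Sum>b\<in>Q. w b *\<^sub>C b) \<in> C"
      using Q by (auto simp: quotient_basis_def)
    have "(\<Sum>b\<in>P \<union> Q. (if b \<in> P then u b else w b) *\<^sub>C b)
      = (\<Sum>b\<in>P. (if b \<in> P then u b else w b) *\<^sub>C b) + (\<Sum>b\<in>Q. (if b \<in> P then u b else w b) *\<^sub>C b)"
      using f disj by (simp add: sum.union_disjoint)
    also have "\<dots> = (\<Sum>b\<in>P. u b *\<^sub>C b) + (\<Sum>b\<in>Q. w b *\<^sub>C b)"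
      using disj by (intro arg_cong2[where f = "(+)"] sum.cong) auto
    finally show "\<exists>u. v - (\<Sum>b\<in>P \<union> Q. u b *\<^sub>C b) \<in> C"
      using w by (intro exI[of _ "\<lambda>b. if b \<in> P then u b else w b"]) (simp add: diff_diff_eq)
  qed
  then show ?thesis
    using quotient_dim_eq_card[OF B P] quotient_dim_eq_card[OF C Q] quotient_dim_eq_card[OF C]
      card_Un_disjoint[OF f disj] by simp
next
  case False
  then have "quotient_dim A B + quotient_dim B C = \<infinity>" by auto
  moreover have "quotient_dim A B \<le> quotient_dim A C" "quotient_dim B C \<le> quotient_dim A C"
    using assms by (auto intro: quotient_dim_antimono quotient_dim_mono)
  ultimately show ?thesis using False by (metis enat_ord_simps(5) enat_ord_simps(4) order_le_less_trans not_le)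
qed

lemma quotient_dim_self: "csubspace W \<Longrightarrow> quotient_dim W W = 0"
  using quotient_dim_eq_card[of W W "{}"] by (simp add: quotient_basis_def zero_enat_def)

lemma quotient_dim_eq_0_iff:
  assumes "csubspace V" "csubspace W" "W \<subseteq> V"
  shows "quotient_dim V W = 0 \<longleftrightarrow> V = W"
proof
  assume 0: "quotient_dim V W = 0"
  then obtain B where B: "quotient_basis V W B"
    using quotient_dim_finite_iff[of V W] by auto
  then have "B = {}"
    using 0 quotient_dim_eq_card[OF assms(2) B] by (auto simp: zero_enat_def quotient_basis_def)
  then show "V = W" using B assms(3) by (auto simp: quotient_basis_def)
qed (use assms quotient_dim_self in auto)

lemma quotient_dim_second_iso:
  assumes A: "csubspace A" and B: "csubspace B" and V: "V = {a + b |a b. a \<in> A \<and> b \<in> B}"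
  shows "quotient_dim V B = quotient_dim A (A \<inter> B)"
proof (rule antisym)
  have "\<forall>v\<in>V. \<exists>a\<in>A. v - a \<in> B" using V by force
  then obtain g where g: "\<And>v. v \<in> V \<Longrightarrow> g v \<in> A \<and> v - g v \<in> B" by metis
  have AB: "csubspace (A \<inter> B)" using A B by (simp add: complex_vector.subspace_inter)
  show "quotient_dim V B \<le> quotient_dim A (A \<inter> B)"
  proof (rule quotient_dim_le[OF B AB, where g = g])
    fix C and u :: "'a \<Rightarrow> complex"
    assume C: "C \<subseteq> V" "(\<Sum>b\<in>C. u b *\<^sub>C g b) \<in> A \<inter> B"
    have "(\<Sum>b\<in>C. u b *\<^sub>C (b - g b)) \<in> B"
      using C(1) g by (intro complex_vector.subspace_sum[OF B] complex_vector.subspace_scale[OF B]) auto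
    then have "(\<Sum>b\<in>C. u b *\<^sub>C (b - g b)) + (\<Sum>b\<in>C. u b *\<^sub>C g b) \<in> B"
      using C(2) complex_vector.subspace_add[OF B] by auto
    then show "(\<Sum>b\<in>C. u b *\<^sub>C b) \<in> B"
      by (simp add: complex_vector.scale_right_diff_distrib sum_subtractf)
  qed (use g in auto)
  have AV: "A \<subseteq> V"
    using V complex_vector.subspace_0[OF B] by (force intro: exI[of _ 0])
  show "quotient_dim A (A \<inter> B) \<le> quotient_dim V B"
  proof (rule quotient_dim_le[OF AB B, where g = "\<lambda>x. x"])
    fix C and u :: "'a \<Rightarrow> complex"
    assume C: "C \<subseteq> A" "(\<Sum>b\<in>C. u b *\<^sub>C b) \<in> B"
    have "(\<Sum>b\<in>C. u b *\<^sub>C b) \<in> A"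
      using C(1) by (intro complex_vector.subspace_sum[OF A] complex_vector.subspace_scale[OF A]) auto
    then show "(\<Sum>b\<in>C. u b *\<^sub>C b) \<in> A \<inter> B" using C by auto
  qed (use AV in auto)
qed

lemma cblinfun_add: "cblinfun_apply f (x + y) = cblinfun_apply f x + cblinfun_apply f y"
  using cblinfun_apply_bounded_linear[of f] by (simp add: bounded_linear.linear linear_add)

lemma cblinfun_zero [simp]: "cblinfun_apply f 0 = 0"
  using cblinfun_apply_bounded_linear[of f] by (simp add: bounded_linear.linear linear_0)

lemma cblinfun_diff: "cblinfun_apply f (x - y) = cblinfun_apply f x - cblinfun_apply f y"
  using cblinfun_apply_bounded_linear[of f] by (simp add: bounded_linear.linear linear_diff)

lemma cblinfun_sum: "cblinfun_apply f (\<Sum>i\<in>I. g i) = (\<Sum>i\<in>I. cblinfun_apply f (g i))"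
  using cblinfun_apply_bounded_linear[of f] by (simp add: bounded_linear.linear linear_sum)

lemma csubspace_image: "csubspace V \<Longrightarrow> csubspace (cblinfun_apply f ` V)"
  unfolding complex_vector.subspace_def
  by (auto simp: cblinfun_add[symmetric] cblinfun_apply_scaleC[symmetric] intro: rev_image_eqI)

lemma csubspace_vimage: "csubspace V \<Longrightarrow> csubspace {x. cblinfun_apply f x \<in> V}"
  unfolding complex_vector.subspace_def by (auto simp: cblinfun_add cblinfun_apply_scaleC)

lemma csubspace_kernel: "csubspace {x. cblinfun_apply f x = 0}"
  using csubspace_vimage[of "{0}" f] complex_vector.subspace_single_0 by auto

lemma csubspace_kernel_on: "csubspace V \<Longrightarrow> csubspace {x \<in> V. cblinfun_apply f x = 0}"
  using complex_vector.subspace_inter[OF _ csubspace_kernel[of f], of V]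
  by (simp add: Collect_conj_eq)

lemma csubspace_0: "csubspace {0}"
  by (rule complex_vector.subspace_single_0)

lemma quotient_dim_image:
  assumes A: "csubspace A" and B: "csubspace B" and "B \<subseteq> A"
    and ker: "\<And>x. x \<in> A \<Longrightarrow> cblinfun_apply f x = 0 \<Longrightarrow> x \<in> B"
  shows "quotient_dim (cblinfun_apply f ` A) (cblinfun_apply f ` B) = quotient_dim A B"
proof (rule antisym)
  let ?f = "cblinfun_apply f"
  note fB = csubspace_image[OF B, of f]
  obtain g where g: "\<And>y. y \<in> ?f ` A \<Longrightarrow> g y \<in> A \<and> ?f (g y) = y"
    using that[of "inv_into A ?f"] by (auto simp: inv_into_into f_inv_into_f)
  show "quotient_dim (?f ` A) (?f ` B) \<le> quotient_dim A B"
  proof (rule quotient_dim_le[OF fB B, where g = g])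
    fix C u assume C: "C \<subseteq> ?f ` A" "(\<Sum>b\<in>C. u b *\<^sub>C g b) \<in> B"
    have "?f (\<Sum>b\<in>C. u b *\<^sub>C g b) = (\<Sum>b\<in>C. u b *\<^sub>C b)"
      using C(1) g by (auto simp: cblinfun_sum cblinfun_apply_scaleC intro!: sum.cong)
    then show "(\<Sum>b\<in>C. u b *\<^sub>C b) \<in> ?f ` B" using C(2) by force
  qed (use g in auto)
  show "quotient_dim A B \<le> quotient_dim (?f ` A) (?f ` B)"
  proof (rule quotient_dim_le[OF B fB, where g = ?f])
    fix C u assume C: "C \<subseteq> A" "(\<Sum>b\<in>C. u b *\<^sub>C ?f b) \<in> ?f ` B"
    then obtain b0 where b0: "b0 \<in> B" "?f (\<Sum>b\<in>C. u b *\<^sub>C b) = ?f b0"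
      by (auto simp: cblinfun_sum cblinfun_apply_scaleC)
    have "(\<Sum>b\<in>C. u b *\<^sub>C b) \<in> A"
      using C(1) by (intro complex_vector.subspace_sum[OF A] complex_vector.subspace_scale[OF A]) auto
    then have "(\<Sum>b\<in>C. u b *\<^sub>C b) - b0 \<in> B"
      using b0 \<open>B \<subseteq> A\<close> complex_vector.subspace_diff[OF A] by (intro ker) (auto simp: cblinfun_diff)
    then show "(\<Sum>b\<in>C. u b *\<^sub>C b) \<in> B"
      using complex_vector.subspace_add[OF B _ b0(1)] by fastforce
  qed auto
qed

text \<open>
  The nullity thus becomes a quotient dimension, as the defect is by definition.
\<close>

lemma ecdim_eq_quotient_dim:
  assumes S: "csubspace S"
  shows "ecdim S = quotient_dim S {0}"
proof (cases "\<exists>B. quotient_basis S {0} B")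
  case True
  then obtain B where B: "quotient_basis S {0} B" by blast
  then have "B \<subseteq> S" "finite B" by (auto simp: quotient_basis_def)
  have "S \<subseteq> cspan B"
  proof
    fix v assume "v \<in> S"
    then obtain u where "v = (\<Sum>b\<in>B. u b *\<^sub>C b)" using B by (auto simp: quotient_basis_def)
    moreover have "(\<Sum>b\<in>B. u b *\<^sub>C b) \<in> cspan B"
      by (intro complex_vector.span_sum complex_vector.span_scale complex_vector.span_base)
    ultimately show "v \<in> cspan B" by simp
  qed
  moreover have "complex_vector.independent B"
    using B by (intro complex_vector.independent_if_scalars_zero) (auto simp: quotient_basis_def)
  ultimately have "cdim S = card B" "finite_cdim S"
    using complex_vector.dim_unique[OF \<open>B \<subseteq> S\<close> _ _ refl] \<open>finite B\<close>
    unfolding finite_cdim_def by blast+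
  then show ?thesis using quotient_dim_eq_card[OF csubspace_0 B] by (simp add: ecdim_def)
next
  case False
  have "\<not> finite_cdim S"
  proof
    assume "finite_cdim S"
    then obtain B where B: "finite B" "S \<subseteq> cspan B" by (auto simp: finite_cdim_def)
    have "card C \<le> card B" if C: "C \<subseteq> S" "indep_mod {0} C" for C
    proof (rule indep_mod_card_le[OF csubspace_0 C(2) B(1)])
      fix v assume "v \<in> C"
      then have "v \<in> cspan B" using C B by blast
      then show "\<exists>u. v - (\<Sum>b\<in>B. u b *\<^sub>C b) \<in> {0}"
        using complex_vector.span_finite[OF B(1)] by auto
    qed
    then show False using quotient_basis_exists[OF csubspace_0] False by blast
  qed
  then show ?thesis using False by (simp add: ecdim_def quotient_dim_def)
qed

lemma finite_cdim_UNIV_iff: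
  "finite_cdim (UNIV :: 'a::complex_normed_vector set) \<longleftrightarrow> quotient_dim (UNIV :: 'a set) {0} < \<infinity>"
  unfolding ecdim_eq_quotient_dim[OF complex_vector.subspace_UNIV, symmetric]
  by (simp add: ecdim_def)

lemma alpha_on_eq:
  "csubspace V \<Longrightarrow> alpha_on V T = quotient_dim {x \<in> V. cblinfun_apply T x = 0} {0}"
  by (simp add: alpha_on_def ecdim_eq_quotient_dim csubspace_kernel_on)

lemma alpha_on_eq_0_iff:
  assumes "csubspace V"
  shows "alpha_on V T = 0 \<longleftrightarrow> {x \<in> V. cblinfun_apply T x = 0} = {0}"
  using quotient_dim_eq_0_iff[OF csubspace_kernel_on[OF assms, of T] csubspace_0]
    complex_vector.subspace_0[OF assms] alpha_on_eq[OF assms, of T]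
  by auto

lemma beta_on_eq_0_iff:
  assumes "csubspace V" "cblinfun_apply T ` V \<subseteq> V"
  shows "beta_on V T = 0 \<longleftrightarrow> cblinfun_apply T ` V = V"
  using quotient_dim_eq_0_iff[OF assms(1) csubspace_image[OF assms(1)] assms(2)]
  by (auto simp: beta_on_def)

lemma alpha_on_mono:
  "csubspace V \<Longrightarrow> csubspace V' \<Longrightarrow> V \<subseteq> V' \<Longrightarrow> alpha_on V T \<le> alpha_on V' T"
  by (auto simp: alpha_on_eq intro!: quotient_dim_mono csubspace_0)

text \<open>
  \<open>T\<close> maps \<open>V / (T V + N(T))\<close> isomorphically onto \<open>T V / T (T V)\<close>. Hence passing from \<open>V\<close> to \<open>T V\<close>
  lowers the defect by the dimension of \<open>(T V + N(T)) / T V\<close>, and it lowers the nullity by the same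
  amount. If all terms are finite, \<open>T\<close> has the same index on \<open>V\<close> and on \<open>T V\<close>.
\<close>

lemma beta_on_range_step:
  assumes V: "csubspace V" and inv: "cblinfun_apply T ` V \<subseteq> V"
  shows "beta_on V T + alpha_on (cblinfun_apply T ` V) T = beta_on (cblinfun_apply T ` V) T + alpha_on V T"
proof -
  let ?T = "cblinfun_apply T"
  let ?N = "{x \<in> V. ?T x = 0}"
  let ?P = "{a + b |a b. a \<in> ?N \<and> b \<in> ?T ` V}"
  have N: "csubspace ?N" and TV: "csubspace (?T ` V)"
    using V csubspace_kernel_on csubspace_image by blast+
  have P: "csubspace ?P" by (rule complex_vector.subspace_sums[OF N TV])
  have PV: "?P \<subseteq> V" using complex_vector.subspace_add[OF V] inv by auto
  have NP: "?N \<subseteq> ?P"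
    using complex_vector.subspace_0[OF TV] by (force intro: exI[of _ 0])
  have TP: "?T ` V \<subseteq> ?P"
    using complex_vector.subspace_0[OF N] by (force intro: exI[of _ 0])
  have NT: "?N \<inter> ?T ` V = {x \<in> ?T ` V. ?T x = 0}" using inv by auto
  have TPeq: "?T ` ?P = ?T ` ?T ` V"
  proof -
    have "?T y \<in> ?T ` ?T ` V" if "y \<in> ?P" for y
      using that by (auto simp: cblinfun_add)
    then show ?thesis by (intro antisym image_subsetI image_mono TP)
  qed
  have "quotient_dim (?T ` V) (?T ` ?P) = quotient_dim V ?P"
  proof (rule quotient_dim_image[OF V P PV])
    show "x \<in> ?P" if "x \<in> V" "?T x = 0" for x
      by (rule subsetD[OF NP]) (use that in simp)
  qed
  then have 1: "beta_on (?T ` V) T = quotient_dim V ?P"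
    unfolding TPeq beta_on_def .
  have 2: "beta_on V T = quotient_dim V ?P + quotient_dim ?P (?T ` V)"
    unfolding beta_on_def by (rule quotient_dim_chain[OF V P TV TP PV])
  have 3: "quotient_dim ?P (?T ` V) = quotient_dim ?N (?N \<inter> ?T ` V)"
    by (rule quotient_dim_second_iso[OF N TV refl])
  have 4: "quotient_dim ?N {0} = quotient_dim ?N (?N \<inter> ?T ` V) + quotient_dim (?N \<inter> ?T ` V) {0}"
    using complex_vector.subspace_0[OF N] complex_vector.subspace_0[OF TV]
    by (intro quotient_dim_chain N csubspace_0 complex_vector.subspace_inter TV) auto
  show ?thesis
    using 1 2 3 4 unfolding alpha_on_eq[OF V] alpha_on_eq[OF TV] NT by (simp add: ac_simps)
qed

section \<open>Functionals\<close>

text \<open>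
  With the scalars as a complex normed space, bounded functionals are elements of a space of bounded
  operators and inherit its linear structure.
\<close>

instantiation complex :: complex_normed_vector
begin
definition scaleC_complex :: "complex \<Rightarrow> complex \<Rightarrow> complex" where "scaleC_complex = (*)"
instance
  by standard (auto simp: scaleC_complex_def algebra_simps norm_mult scaleR_conv_of_real)
end

text \<open>
  This is the Hahn-Banach theorem, by Zorn's lemma applied to graphs: a subspace \<open>G\<close> of \<open>X \<times> \<real>\<close> with
  \<open>a \<le> \<parallel>x\<parallel>\<close> for all \<open>(x, a) \<in> G\<close> is the graph of a partial functional of norm at most one. It is
  automatically single-valued, because \<open>(0, a) \<in> G\<close> and \<open>(0, -a) \<in> G\<close> force \<open>a = 0\<close>.
\<close>

lemma real_norming_functional:
  fixes x0 :: "'a::real_normed_vector"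
  assumes "x0 \<noteq> 0"
  shows "\<exists>f. bounded_linear f \<and> (f x0 :: real) = norm x0"
proof -
  define \<G> where "\<G> = {G :: ('a \<times> real) set. subspace G \<and> (\<forall>(x, a) \<in> G. a \<le> norm x) \<and> (x0, norm x0) \<in> G}"
  have line: "span {(x0, norm x0)} \<in> \<G>"
  proof -
    have "a \<le> norm x" if "(x, a) \<in> span {(x0, norm x0)}" for x a
    proof -
      from that obtain k where k: "(x, a) = k *\<^sub>R (x0, norm x0)" by (auto simp: span_singleton)
      then have "a = k * norm x0" "norm x = \<bar>k\<bar> * norm x0" by auto
      then show ?thesis by (simp add: mult_right_mono)
    qed
    then show ?thesis unfolding \<G>_def by (auto intro: span_base)
  qed
  have union: "\<Union>\<C> \<in> \<G>" if ne: "\<C> \<noteq> {}" and ch: "subset.chain \<G> \<C>" for \<C>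
  proof -
    have sub: "\<And>G. G \<in> \<C> \<Longrightarrow> G \<in> \<G>" using ch by (auto simp: subset.chain_def)
    have lin: "\<And>G H. G \<in> \<C> \<Longrightarrow> H \<in> \<C> \<Longrightarrow> G \<subseteq> H \<or> H \<subseteq> G"
      using ch by (meson subset_chain_def)
    have add: "p + q \<in> \<Union>\<C>" if pq: "p \<in> \<Union>\<C>" "q \<in> \<Union>\<C>" for p q
    proof -
      from pq obtain G H where GH: "G \<in> \<C>" "p \<in> G" "H \<in> \<C>" "q \<in> H" by blast
      then obtain K where "K \<in> \<C>" "p \<in> K" "q \<in> K" using lin[of G H] by blast
      moreover have "subspace K" using sub[OF \<open>K \<in> \<C>\<close>] by (simp add: \<G>_def)
      ultimately show ?thesis using subspace_add by blast
    qed
    have "subspace (\<Union>\<C>)"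
      unfolding subspace_def
    proof (intro conjI ballI allI)
      from ne obtain G where "G \<in> \<C>" by blast
      then show "0 \<in> \<Union>\<C>" using sub[of G] subspace_0[of G] by (auto simp: \<G>_def)
    next
      fix c p assume "p \<in> \<Union>\<C>"
      then obtain G where "G \<in> \<C>" "p \<in> G" by blast
      then show "c *\<^sub>R p \<in> \<Union>\<C>" using sub[of G] subspace_scale[of G p c] by (auto simp: \<G>_def)
    qed (rule add)
    moreover have "a \<le> norm x" if "(x, a) \<in> \<Union>\<C>" for x a
      using that sub by (force simp: \<G>_def)
    moreover have "(x0, norm x0) \<in> \<Union>\<C>" using ne sub by (force simp: \<G>_def)
    ultimately show ?thesis by (simp add: \<G>_def split_beta)
  qed
  obtain G where G: "G \<in> \<G>" and max: "\<And>H. H \<in> \<G> \<Longrightarrow> G \<subseteq> H \<Longrightarrow> H = G"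
    using subset_Zorn_nonempty[of \<G>] line union by blast
  have sG: "subspace G" and le: "\<And>x a. (x, a) \<in> G \<Longrightarrow> a \<le> norm x" and x0: "(x0, norm x0) \<in> G"
    using G by (auto simp: \<G>_def)
  have total: "\<exists>a. (x, a) \<in> G" for x
  proof -
    let ?L = "{a - norm (y - x) |y a. (y, a) \<in> G}"
    have sep: "a - norm (y - x) \<le> norm (y' + x) - a'" if "(y, a) \<in> G" "(y', a') \<in> G" for y a y' a'
    proof -
      have "(y + y', a + a') \<in> G" using subspace_add[OF sG that] by simp
      then have "a + a' \<le> norm ((y - x) + (y' + x))" using le by fastforce
      also have "\<dots> \<le> norm (y - x) + norm (y' + x)" by (rule norm_triangle_ineq)
      finally show ?thesis by simp
    qed
    \<comment> \<open>every value between the left and right sides of this estimate is admissible at \<open>x\<close>\<close>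
    have z: "(0, 0) \<in> G" using subspace_0[OF sG] by (simp add: zero_prod_def)
    have ne: "?L \<noteq> {}" using z by blast
    have bdd: "bdd_above ?L"
      using sep[OF _ z] by (intro bdd_aboveI[of _ "norm (0 + x) - 0"]) auto
    define r where "r = Sup ?L"
    have lower: "a - norm (y - x) \<le> r" if "(y, a) \<in> G" for y a
      unfolding r_def by (rule cSup_upper[OF _ bdd]) (use that in blast)
    have upper: "r \<le> norm (y + x) - a" if "(y, a) \<in> G" for y a
      unfolding r_def by (rule cSup_least[OF ne]) (use sep[OF _ that] in auto)
    define H where "H = {p + q |p q. p \<in> G \<and> q \<in> span {(x, r)}}"
    have sH: "subspace H" unfolding H_def by (rule subspace_sums[OF sG subspace_span])
    have GH: "G \<subseteq> H"
    proof
      fix p assume "p \<in> G"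
      moreover have "p = p + 0" "0 \<in> span {(x, r)}" by (simp_all add: span_zero)
      ultimately show "p \<in> H" unfolding H_def by blast
    qed
    have xH: "(x, r) \<in> H"
    proof -
      have "(x, r) = 0 + (x, r)" "(x, r) \<in> span {(x, r)}" by (simp_all add: span_base)
      then show ?thesis unfolding H_def using subspace_0[OF sG] by blast
    qed
    have leH: "b \<le> norm w" if w: "(w, b) \<in> H" for w b
    proof -
      from w obtain y a t where ya: "(y, a) \<in> G" and wb: "w = y + t *\<^sub>R x" "b = a + t * r"
        unfolding H_def by (auto simp: span_singleton)
      show ?thesis
      proof (cases t "0::real" rule: linorder_cases)
        case equal
        then show ?thesis using wb le[OF ya] by simp
      next
        case greater
        have "(inverse t *\<^sub>R y, inverse t * a) \<in> G"
          using subspace_scale[OF sG ya, of "inverse t"] by simp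
        from mult_left_mono[OF upper[OF this], of t]
        have "t * r \<le> t * norm (inverse t *\<^sub>R y + x) - a"
          using greater by (simp add: right_diff_distrib mult.assoc[symmetric])
        also have "t * norm (inverse t *\<^sub>R y + x) = norm (t *\<^sub>R (inverse t *\<^sub>R y + x))"
          using greater by simp
        also have "t *\<^sub>R (inverse t *\<^sub>R y + x) = w" using greater wb by (simp add: scaleR_add_right)
        finally show ?thesis using wb by simp
      next
        case less
        define s where "s = - t"
        have s: "s > 0" using less by (simp add: s_def)
        have "(inverse s *\<^sub>R y, inverse s * a) \<in> G"
          using subspace_scale[OF sG ya, of "inverse s"] by simp
        from mult_left_mono[OF lower[OF this], of s]
        have "a - s * norm (inverse s *\<^sub>R y - x) \<le> s * r"
          using s by (simp add: right_diff_distrib mult.assoc[symmetric])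
        moreover have "s * norm (inverse s *\<^sub>R y - x) = norm (s *\<^sub>R (inverse s *\<^sub>R y - x))"
          using s by simp
        moreover have "s *\<^sub>R (inverse s *\<^sub>R y - x) = w"
          using s wb by (simp add: scaleR_diff_right s_def)
        ultimately have "a - norm w \<le> s * r" by simp
        then show ?thesis using wb by (simp add: s_def)
      qed
    qed
    have "H \<in> \<G>" using sH leH x0 GH by (auto simp: \<G>_def)
    then have "H = G" using max GH by blast
    then show ?thesis using xH by blast
  qed
  have unique: "a = b" if "(x, a) \<in> G" "(x, b) \<in> G" for x a b
    using le[of 0 "a - b"] le[of 0 "b - a"] subspace_diff[OF sG that] subspace_diff[OF sG that(2,1)]
    by simp
  obtain f where f: "\<And>x. (x, f x) \<in> G" using total by metis
  have "bounded_linear f"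
  proof (rule bounded_linear_intro[where K = 1])
    fix x y and c :: real
    show "f (x + y) = f x + f y"
      using subspace_add[OF sG f[of x] f[of y]] f[of "x + y"] by (intro unique[of "x + y"]) auto
    show "f (c *\<^sub>R x) = c *\<^sub>R f x"
      using subspace_scale[OF sG f[of x], of c] f[of "c *\<^sub>R x"] by (intro unique[of "c *\<^sub>R x"]) auto
    have "- f x \<le> norm x"
      using le[of "- x" "- f x"] subspace_scale[OF sG f[of x], of "-1"] by simp
    then show "norm (f x) \<le> norm x * 1" using le[OF f[of x]] by simp
  qed
  then show ?thesis using unique[OF f x0] by blast
qed

text \<open>
  A real functional \<open>u\<close> becomes a complex one as \<open>x \<mapsto> u x - \<i> u (\<i> x)\<close>.
\<close>

lemma functionals_separate_points:
  fixes x0 :: "'a::complex_normed_vector"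
  assumes "x0 \<noteq> 0"
  shows "\<exists>\<phi> :: 'a \<Rightarrow>\<^sub>C\<^sub>L complex. cblinfun_apply \<phi> x0 = 1"
proof -
  obtain u :: "'a \<Rightarrow> real" where u: "bounded_linear u" and ux0: "u x0 = norm x0"
    using real_norming_functional[OF assms] by blast
  interpret u: bounded_linear u by (rule u)
  define f where "f x = complex_of_real (u x) - \<i> * complex_of_real (u (\<i> *\<^sub>C x))" for x
  have bl: "bounded_linear f"
    unfolding f_def
    by (intro bounded_linear_sub bounded_linear_compose[OF bounded_linear_of_real u]
        bounded_linear_compose[OF bounded_linear_mult_right]
        bounded_linear_compose[OF bounded_linear_of_real]
        bounded_linear_compose[OF u bounded_linear_scaleC_right])
  interpret f: bounded_linear f by (rule bl)
  have fi: "f (\<i> *\<^sub>C x) = \<i> * f x" for x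
    by (simp add: f_def scaleC_scaleC complex_vector.scale_minus_left scaleC_one u.neg algebra_simps)
  have fC: "f (c *\<^sub>C x) = c * f x" for c x
  proof -
    have "c *\<^sub>C x = (complex_of_real (Re c) + \<i> * complex_of_real (Im c)) *\<^sub>C x"
      by (simp only: complex_eq[symmetric])
    also have "\<dots> = Re c *\<^sub>R x + Im c *\<^sub>R (\<i> *\<^sub>C x)"
      by (simp only: scaleC_add_left scaleR_scaleC scaleC_scaleC mult.commute)
    finally have "f (c *\<^sub>C x) = Re c *\<^sub>R f x + Im c *\<^sub>R f (\<i> *\<^sub>C x)"
      by (simp only: f.add f.scaleR)
    also have "\<dots> = complex_of_real (Re c) * f x + complex_of_real (Im c) * (\<i> * f x)"
      by (simp only: fi scaleR_conv_of_real)
    also have "\<dots> = (complex_of_real (Re c) + \<i> * complex_of_real (Im c)) * f x"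
      by (simp add: algebra_simps)
    also have "\<dots> = c * f x" by (simp only: complex_eq[symmetric])
    finally show ?thesis .
  qed
  define g where "g = CBlinfun f"
  have g: "cblinfun_apply g = f"
    unfolding g_def by (rule CBlinfun_inverse) (simp add: bounded_clinear_def bl fC scaleC_complex_def)
  have "f x0 \<noteq> 0" using ux0 assms by (simp add: f_def complex_eq_iff)
  then have "cblinfun_apply (inverse (f x0) *\<^sub>C g) x0 = 1"
    by (simp add: scaleC_cblinfun.rep_eq g scaleC_complex_def)
  then show ?thesis by blast
qed

text \<open>
  Induction on the set: the component \<open>z\<close> of the new vector that is not captured by the old
  functionals is nonzero by independence, so some functional does not vanish at \<open>z\<close>.
\<close>

lemma biorthogonal_functionals:
  fixes E :: "'a::complex_normed_vector set"
  assumes "indep_mod {0} E"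
  shows "\<exists>\<phi> :: 'a \<Rightarrow> 'a \<Rightarrow>\<^sub>C\<^sub>L complex. \<forall>e\<in>E. \<forall>e'\<in>E. cblinfun_apply (\<phi> e) e' = (if e = e' then 1 else 0)"
proof -
  have "finite E" using assms by (simp add: indep_mod_def)
  then show ?thesis using assms
  proof (induction E)
    case empty
    then show ?case by simp
  next
    case (insert x E)
    then obtain \<phi> :: "'a \<Rightarrow> 'a \<Rightarrow>\<^sub>C\<^sub>L complex"
      where \<phi>: "\<And>e e'. e \<in> E \<Longrightarrow> e' \<in> E \<Longrightarrow> cblinfun_apply (\<phi> e) e' = (if e = e' then 1 else 0)"
      using indep_mod_subset[OF insert.prems, of E] by blast
    define z where "z = x - (\<Sum>e\<in>E. cblinfun_apply (\<phi> e) x *\<^sub>C e)"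
    have "z \<noteq> 0"
    proof
      assume "z = 0"
      let ?u = "\<lambda>b. if b = x then 1 else - cblinfun_apply (\<phi> b) x"
      have "(\<Sum>b\<in>E. ?u b *\<^sub>C b) = (\<Sum>b\<in>E. - (cblinfun_apply (\<phi> b) x *\<^sub>C b))"
        using insert.hyps by (intro sum.cong) (auto simp: complex_vector.scale_minus_left)
      then have "(\<Sum>b\<in>insert x E. ?u b *\<^sub>C b) = z"
        using insert.hyps by (simp add: z_def scaleC_one sum_negf)
      then have "(\<Sum>b\<in>insert x E. ?u b *\<^sub>C b) \<in> {0}" using \<open>z = 0\<close> by simp
      then have "?u x = 0" by (rule indep_modD[OF insert.prems]) simp
      then show False by simp
    qed
    then obtain g :: "'a \<Rightarrow>\<^sub>C\<^sub>L complex" where g: "cblinfun_apply g z = 1"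
      using functionals_separate_points by blast
    \<comment> \<open>the functional dual to the new vector: \<open>g\<close> corrected to vanish on the old ones\<close>
    define g' where "g' = g - (\<Sum>e\<in>E. cblinfun_apply g e *\<^sub>C \<phi> e)"
    have apply_sum: "cblinfun_apply (\<Sum>e\<in>E. c e *\<^sub>C \<phi> e) y = (\<Sum>e\<in>E. c e * cblinfun_apply (\<phi> e) y)" for c y
      using insert.hyps(1)
      by (induction E) (simp_all add: zero_cblinfun.rep_eq plus_cblinfun.rep_eq scaleC_cblinfun.rep_eq scaleC_complex_def)
    have pick: "(\<Sum>e\<in>E. c e * (if e = e' then 1 else 0)) = c e'" if "e' \<in> E" for c :: "'a \<Rightarrow> complex" and e'
      using that insert.hyps(1) by (simp add: if_distrib[where f = "\<lambda>t. _ * t"] cong: if_cong)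
    have g'E: "cblinfun_apply g' e' = 0" if "e' \<in> E" for e'
    proof -
      have "(\<Sum>e\<in>E. cblinfun_apply g e * cblinfun_apply (\<phi> e) e') = cblinfun_apply g e'"
        using \<phi> that pick[OF that, of "cblinfun_apply g"] by simp
      then show ?thesis by (simp add: g'_def minus_cblinfun.rep_eq apply_sum)
    qed
    have \<phi>z: "cblinfun_apply (\<phi> e) z = 0" if "e \<in> E" for e
    proof -
      have "cblinfun_apply (\<phi> e) (\<Sum>e'\<in>E. cblinfun_apply (\<phi> e') x *\<^sub>C e')
          = (\<Sum>e'\<in>E. cblinfun_apply (\<phi> e') x * (if e' = e then 1 else 0))"
        using \<phi> that by (auto simp: cblinfun_sum cblinfun_apply_scaleC scaleC_complex_def intro!: sum.cong)
      also have "\<dots> = cblinfun_apply (\<phi> e) x" by (rule pick[OF that])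
      finally show ?thesis by (simp add: z_def cblinfun_diff)
    qed
    have "cblinfun_apply g' z = 1"
      using \<phi>z by (simp add: g'_def minus_cblinfun.rep_eq apply_sum g)
    moreover have "cblinfun_apply g' (\<Sum>e\<in>E. cblinfun_apply (\<phi> e) x *\<^sub>C e) = 0"
      using g'E by (simp add: cblinfun_sum cblinfun_apply_scaleC scaleC_complex_def)
    ultimately have g'x: "cblinfun_apply g' x = 1"
      by (simp add: z_def cblinfun_diff)
    define \<psi> where "\<psi> e = (if e = x then g' else \<phi> e - cblinfun_apply (\<phi> e) x *\<^sub>C g')" for e
    have "cblinfun_apply (\<psi> e) e' = (if e = e' then 1 else 0)"
      if "e \<in> insert x E" "e' \<in> insert x E" for e e'
      using that insert.hyps(2) g'E g'x \<phi>
      by (auto simp: \<psi>_def minus_cblinfun.rep_eq scaleC_cblinfun.rep_eq scaleC_complex_def)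
    then show ?case by blast
  qed
qed

section \<open>The open mapping theorem\<close>

text \<open>
  By Baire's theorem the image of some ball is dense in some ball of the range, so each \<open>z\<close> has an
  approximate preimage of norm at most \<open>K \<parallel>z\<parallel>\<close> which halves the error. Summing the corrections gives
  an exact preimage. The theorem is stated for closed subspaces because it is applied to
  restrictions to null spaces and ranges of powers.
\<close>

lemma open_mapping_closed_subspaces:
  fixes T :: "'a::banach \<Rightarrow> 'b::banach"
  assumes T: "bounded_linear T" and Y: "subspace Y" "closed Y" and Z: "closed (T ` Y)"
  shows "\<exists>C>0. \<forall>z\<in>T ` Y. \<exists>y\<in>Y. T y = z \<and> norm y \<le> C * norm z"
proof -
  interpret T: bounded_linear T by (rule T)
  define Z where "Z = T ` Y"
  have sZ: "subspace Z"
    unfolding Z_def by (rule linear_subspace_image[OF T.linear Y(1)])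
  define A where "A n = Z \<inter> closure (T ` (Y \<inter> cball 0 (real n)))" for n
  let ?X = "top_of_set Z"
  have cover: "\<Union>(range A) = Z"
  proof -
    have "\<exists>n. z \<in> A n" if z: "z \<in> Z" for z
    proof -
      obtain y where y: "y \<in> Y" "z = T y" using z Z_def by blast
      obtain n where "norm y \<le> real n" using real_arch_simple by blast
      then have "z \<in> T ` (Y \<inter> cball 0 (real n))" using y by auto
      then have "z \<in> closure (T ` (Y \<inter> cball 0 (real n)))" by (rule subsetD[OF closure_subset])
      then have "z \<in> A n" using z by (simp add: A_def)
      then show ?thesis ..
    qed
    moreover have "A n \<subseteq> Z" for n by (simp add: A_def)
    ultimately show ?thesis by blast
  qed
  have "\<exists>n. ?X interior_of (A n) \<noteq> {}"
  proof (rule ccontr)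
    assume "\<not> ?thesis"
    then have *: "\<And>n. ?X interior_of (A n) = {}" by blast
    have "?X interior_of \<Union>(range A) = {}"
    proof (rule Baire_category_alt)
      show "completely_metrizable_space ?X \<or> locally_compact_space ?X \<and> regular_space ?X"
        using completely_metrizable_space_closedin[OF completely_metrizable_space_euclidean, of Z] Z
        by (simp add: Z_def)
      show "closedin ?X B \<and> ?X interior_of B = {}" if "B \<in> range A" for B
        using that * by (auto simp: A_def intro: closedin_closed_Int)
    qed simp
    then have "Z = {}" using cover interior_of_topspace[of ?X] by simp
    then show False using subspace_0[OF sZ] by blast
  qed
  then obtain n z0 U where U: "openin ?X U" "z0 \<in> U" "U \<subseteq> A n"
    unfolding interior_of_def by blast
  then obtain V where V: "open V" "U = Z \<inter> V" by (auto simp: openin_open)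
  then obtain r where r: "r > 0" "ball z0 r \<subseteq> V" using U openE by blast
  have z0: "z0 \<in> Z" using U V by blast
  have near: "\<exists>y\<in>Y. norm y \<le> n \<and> norm (T y - w) < r / 8" if w: "w \<in> Z" "dist z0 w < r" for w
  proof -
    have "w \<in> closure (T ` (Y \<inter> cball 0 (real n)))" using w r V U by (auto simp: A_def)
    moreover have "r / 8 > 0" using r by simp
    ultimately obtain v where "v \<in> T ` (Y \<inter> cball 0 (real n))" "dist v w < r / 8"
      unfolding closure_approachable by blast
    then show ?thesis by (auto simp: dist_norm)
  qed
  define K where "K = 4 * real n / r + 1"
  have K: "K > 0" using r by (simp add: K_def add_nonneg_pos)
  have approx: "\<exists>y\<in>Y. norm y \<le> K * norm z \<and> norm (z - T y) \<le> norm z / 2" if z: "z \<in> Z" for z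
  proof (cases "z = 0")
    case True
    then show ?thesis using subspace_0[OF Y(1)] by (intro bexI[of _ 0]) (auto simp: T.zero)
  next
    case False
    \<comment> \<open>\<open>t z\<close> has norm \<open>r / 2\<close>; the images of \<open>y1\<close> and \<open>y2\<close> approximate \<open>z0 + t z\<close> and \<open>z0\<close> up to \<open>r / 8\<close>,
      so that of \<open>y1 - y2\<close> approximates \<open>t z\<close> up to \<open>r / 4\<close>, half its norm\<close>
    define t where "t = r / (2 * norm z)"
    have t: "t > 0" using r False by (simp add: t_def)
    have tz: "norm (t *\<^sub>R z) = r / 2" using r False by (simp add: t_def)
    have "z0 + t *\<^sub>R z \<in> Z" using z0 z sZ by (simp add: subspace_add subspace_scale)
    then obtain y1 where y1: "y1 \<in> Y" "norm y1 \<le> n" "norm (T y1 - (z0 + t *\<^sub>R z)) < r / 8"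
      using near[of "z0 + t *\<^sub>R z"] tz r by (force simp: dist_norm)
    obtain y2 where y2: "y2 \<in> Y" "norm y2 \<le> n" "norm (T y2 - z0) < r / 8"
      using near[OF z0] r(1) unfolding dist_self by blast
    have it: "inverse t = 2 * norm z / r" unfolding t_def by (rule inverse_divide)
    have "norm (y1 - y2) \<le> 2 * real n"
      using norm_triangle_ineq4[of y1 y2] y1(2) y2(2) by linarith
    then have "inverse t * norm (y1 - y2) \<le> inverse t * (2 * real n)"
      using t by (intro mult_left_mono) auto
    also have "\<dots> = (4 * real n / r) * norm z" by (simp add: it)
    also have "\<dots> \<le> K * norm z" by (simp add: K_def algebra_simps)
    finally have 1: "norm (inverse t *\<^sub>R (y1 - y2)) \<le> K * norm z" using t by simp
    have eq: "t *\<^sub>R z - T (y1 - y2) = (T y2 - z0) - (T y1 - (z0 + t *\<^sub>R z))"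
      by (simp add: T.diff)
    have "norm (t *\<^sub>R z - T (y1 - y2)) \<le> r / 4"
      unfolding eq using norm_triangle_ineq4[of "T y2 - z0" "T y1 - (z0 + t *\<^sub>R z)"] y1(3) y2(3) by linarith
    then have "inverse t * norm (t *\<^sub>R z - T (y1 - y2)) \<le> inverse t * (r / 4)"
      using t by (intro mult_left_mono) auto
    also have "\<dots> = norm z / 2" using r by (simp add: it)
    finally have "norm (inverse t *\<^sub>R (t *\<^sub>R z - T (y1 - y2))) \<le> norm z / 2" using t by simp
    moreover have "inverse t *\<^sub>R (t *\<^sub>R z - T (y1 - y2)) = z - T (inverse t *\<^sub>R (y1 - y2))"
      using t by (simp add: scaleR_diff_right T.scaleR T.diff)
    ultimately have 2: "norm (z - T (inverse t *\<^sub>R (y1 - y2))) \<le> norm z / 2" by simp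
    have "inverse t *\<^sub>R (y1 - y2) \<in> Y"
      using Y(1) y1(1) y2(1) by (simp add: subspace_diff subspace_scale)
    then show ?thesis using 1 2 by blast
  qed
  then obtain h where h: "\<And>z. z \<in> Z \<Longrightarrow> h z \<in> Y \<and> norm (h z) \<le> K * norm z \<and> norm (z - T (h z)) \<le> norm z / 2"
    by metis
  have "\<exists>y\<in>Y. T y = z \<and> norm y \<le> 2 * K * norm z" if z: "z \<in> Z" for z
  proof -
    define zs where "zs = rec_nat z (\<lambda>_ w. w - T (h w))"
    have zs0: "zs 0 = z" and zsS: "\<And>k. zs (Suc k) = zs k - T (h (zs k))" by (simp_all add: zs_def)
    have zsZ: "zs k \<in> Z" for k
    proof (induction k)
      case (Suc k)
      have "T (h (zs k)) \<in> Z" using h[OF Suc] by (simp add: Z_def)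
      then show ?case using Suc sZ by (simp add: zsS subspace_diff)
    qed (simp add: zs0 z)
    have zsn: "norm (zs k) \<le> norm z * (1/2) ^ k" for k
    proof (induction k)
      case (Suc k)
      have "norm (zs (Suc k)) \<le> norm (zs k) / 2" using h[OF zsZ[of k]] by (simp add: zsS)
      also have "\<dots> \<le> norm z * (1/2) ^ Suc k" using Suc by simp
      finally show ?case .
    qed (simp add: zs0)
    have yn: "norm (h (zs k)) \<le> K * norm z * (1/2) ^ k" for k
    proof -
      have "norm (h (zs k)) \<le> K * norm (zs k)" using h[OF zsZ] by blast
      also have "\<dots> \<le> K * (norm z * (1/2) ^ k)" using zsn K by (intro mult_left_mono) auto
      finally show ?thesis by (simp add: mult.assoc)
    qed
    have geo: "(\<lambda>k. K * norm z * (1/2) ^ k) sums (K * norm z * 2)"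
      using sums_mult[OF geometric_sums[of "1/2::real"], of "K * norm z"] by simp
    have sumn: "summable (\<lambda>k. norm (h (zs k)))"
      by (rule summable_comparison_test'[OF sums_summable[OF geo], of 0]) (use yn in auto)
    then have sum: "summable (\<lambda>k. h (zs k))" by (rule summable_norm_cancel)
    define y where "y = (\<Sum>k. h (zs k))"
    have lim: "(\<lambda>n. \<Sum>k<n. h (zs k)) \<longlonglongrightarrow> y"
      unfolding y_def by (rule summable_LIMSEQ[OF sum])
    have "y \<in> Y"
      using Y(2) _ lim
    proof (rule closed_sequentially)
      fix n show "(\<Sum>k<n. h (zs k)) \<in> Y" using h zsZ by (intro subspace_sum[OF Y(1)]) blast
    qed
    moreover have "T y = z"
    proof (rule LIMSEQ_unique)
      show "(\<lambda>n. T (\<Sum>k<n. h (zs k))) \<longlonglongrightarrow> T y" by (rule T.tendsto[OF lim])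
      have "T (\<Sum>k<n. h (zs k)) = z - zs n" for n
        by (induction n) (simp_all add: T.zero T.add zs0 zsS)
      moreover have "zs \<longlonglongrightarrow> 0"
      proof (rule Lim_null_comparison)
        show "\<forall>\<^sub>F k in sequentially. norm (zs k) \<le> norm z * (1/2) ^ k" using zsn by simp
        show "(\<lambda>k. norm z * (1/2) ^ k) \<longlonglongrightarrow> 0"
          using tendsto_mult_right_zero[OF LIMSEQ_realpow_zero[of "1/2"]] by simp
      qed
      ultimately show "(\<lambda>n. T (\<Sum>k<n. h (zs k))) \<longlonglongrightarrow> z"
        using tendsto_diff[OF tendsto_const[of z], of zs 0 sequentially] by simp
    qed
    moreover have "norm y \<le> 2 * K * norm z"
    proof -
      have "norm y \<le> (\<Sum>k. norm (h (zs k)))" unfolding y_def by (rule summable_norm[OF sumn])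
      also have "\<dots> \<le> (\<Sum>k. K * norm z * (1/2) ^ k)"
        by (rule suminf_le[OF yn sumn sums_summable[OF geo]])
      also have "\<dots> = K * norm z * 2" using sums_unique[OF geo] by simp
      finally show ?thesis by (simp add: mult_ac)
    qed
    ultimately show ?thesis by blast
  qed
  then show ?thesis using K unfolding Z_def by (intro exI[of _ "2 * K"]) auto
qed

lemma csubspace_imp_subspace: "csubspace V \<Longrightarrow> subspace V"
  unfolding complex_vector.subspace_def subspace_def by (simp add: scaleR_scaleC)

lemma inj_on_iff_trivial_kernel:
  assumes "csubspace V"
  shows "inj_on (cblinfun_apply T) V \<longleftrightarrow> (\<forall>x\<in>V. cblinfun_apply T x = 0 \<longrightarrow> x = 0)"
proof
  assume "inj_on (cblinfun_apply T) V"
  then show "\<forall>x\<in>V. cblinfun_apply T x = 0 \<longrightarrow> x = 0"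
    using complex_vector.subspace_0[OF assms] by (metis cblinfun_zero inj_onD)
next
  assume ker: "\<forall>x\<in>V. cblinfun_apply T x = 0 \<longrightarrow> x = 0"
  show "inj_on (cblinfun_apply T) V"
  proof (rule inj_onI)
    fix x y assume "x \<in> V" "y \<in> V" "cblinfun_apply T x = cblinfun_apply T y"
    then have "x - y \<in> V" "cblinfun_apply T (x - y) = 0"
      using complex_vector.subspace_diff[OF assms] by (simp_all add: cblinfun_diff)
    then have "x - y = 0" using ker by blast
    then show "x = y" by simp
  qed
qed

text \<open>
  The factor is bounded by the open mapping theorem; for \<open>Y = UNIV\<close> and \<open>U\<close> the identity this is
  the bounded inverse theorem.
\<close>

lemma factor_through_injective:
  fixes T :: "'a::complex_banach \<Rightarrow>\<^sub>C\<^sub>L 'b::complex_banach"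
    and U :: "'c::complex_normed_vector \<Rightarrow>\<^sub>C\<^sub>L 'b"
  assumes Y: "csubspace Y" "closed Y" and inj: "inj_on (cblinfun_apply T) Y"
    and cl: "closed (cblinfun_apply T ` Y)" and U: "\<And>x. cblinfun_apply U x \<in> cblinfun_apply T ` Y"
  shows "\<exists>D :: 'c \<Rightarrow>\<^sub>C\<^sub>L 'a. \<forall>x. cblinfun_apply D x \<in> Y \<and> cblinfun_apply T (cblinfun_apply D x) = cblinfun_apply U x"
proof -
  obtain C where C: "C > 0"
    "\<And>z. z \<in> cblinfun_apply T ` Y \<Longrightarrow> \<exists>y\<in>Y. cblinfun_apply T y = z \<and> norm y \<le> C * norm z"
    using open_mapping_closed_subspaces[OF cblinfun_apply_bounded_linear csubspace_imp_subspace[OF Y(1)] Y(2) cl]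
    by blast
  have "\<forall>x. \<exists>y\<in>Y. cblinfun_apply T y = cblinfun_apply U x \<and> norm y \<le> C * norm (cblinfun_apply U x)"
    using C(2)[OF U] by blast
  then obtain d where d: "\<And>x. d x \<in> Y" "\<And>x. cblinfun_apply T (d x) = cblinfun_apply U x"
    "\<And>x. norm (d x) \<le> C * norm (cblinfun_apply U x)" by metis
  have unique: "y = d x" if "y \<in> Y" "cblinfun_apply T y = cblinfun_apply U x" for x y
    using inj that d by (metis inj_onD)
  have dC: "d (c *\<^sub>C x) = c *\<^sub>C d x" for c x
    by (rule unique[symmetric]) (simp_all add: complex_vector.subspace_scale[OF Y(1)] d(1,2) cblinfun_apply_scaleC)
  have "bounded_linear d"
  proof (rule bounded_linear_intro[where K = "C * onorm (cblinfun_apply U)"])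
    show "d (x + y) = d x + d y" for x y
      by (rule unique[symmetric]) (simp_all add: complex_vector.subspace_add[OF Y(1)] d(1,2) cblinfun_add)
    show "d (r *\<^sub>R x) = r *\<^sub>R d x" for r x by (simp add: scaleR_scaleC dC)
    show "norm (d x) \<le> norm x * (C * onorm (cblinfun_apply U))" for x
    proof -
      have "norm (d x) \<le> C * norm (cblinfun_apply U x)" by (rule d(3))
      also have "\<dots> \<le> C * (onorm (cblinfun_apply U) * norm x)"
        using C(1) onorm[OF cblinfun_apply_bounded_linear, of U x] by (intro mult_left_mono) auto
      finally show ?thesis by (simp add: mult_ac)
    qed
  qed
  then have "cblinfun_apply (CBlinfun d) = d"
    by (intro CBlinfun_inverse) (simp add: bounded_clinear_def dC)
  then show ?thesis using d(1,2) by (intro exI[of _ "CBlinfun d"]) simp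
qed

lemma bounded_below_on:
  fixes T :: "'a::complex_banach \<Rightarrow>\<^sub>C\<^sub>L 'b::complex_banach"
  assumes Y: "csubspace Y" "closed Y" and inj: "inj_on (cblinfun_apply T) Y"
    and cl: "closed (cblinfun_apply T ` Y)"
  shows "\<exists>c>0. \<forall>y\<in>Y. c * norm y \<le> norm (cblinfun_apply T y)"
proof -
  obtain C where C: "C > 0"
    "\<And>z. z \<in> cblinfun_apply T ` Y \<Longrightarrow> \<exists>y\<in>Y. cblinfun_apply T y = z \<and> norm y \<le> C * norm z"
    using open_mapping_closed_subspaces[OF cblinfun_apply_bounded_linear csubspace_imp_subspace[OF Y(1)] Y(2) cl]
    by blast
  have "inverse C * norm y \<le> norm (cblinfun_apply T y)" if y: "y \<in> Y" for y
  proof -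
    obtain y' where "y' \<in> Y" "cblinfun_apply T y' = cblinfun_apply T y"
      and le: "norm y' \<le> C * norm (cblinfun_apply T y)" using C(2)[OF imageI[OF y]] by blast
    then have "y' = y" using inj y by (metis inj_onD)
    then show ?thesis using C(1) le by (simp add: divide_simps mult.commute flip: divide_inverse_commute)
  qed
  then show ?thesis using C(1) by (intro exI[of _ "inverse C"]) simp
qed

lemma not_in_op_spectrum_iff_bij:
  fixes T :: "'a::complex_banach \<Rightarrow>\<^sub>C\<^sub>L 'a"
  shows "\<mu> \<notin> op_spectrum T \<longleftrightarrow> bij (cblinfun_apply (shift T \<mu>))"
proof
  assume "\<mu> \<notin> op_spectrum T"
  then obtain S where "S o\<^sub>C\<^sub>L shift T \<mu> = id_cblinfun" "shift T \<mu> o\<^sub>C\<^sub>L S = id_cblinfun"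
    by (auto simp: op_spectrum_def)
  then have "cblinfun_apply S (cblinfun_apply (shift T \<mu>) x) = x"
    "cblinfun_apply (shift T \<mu>) (cblinfun_apply S x) = x" for x
    by (metis cblinfun_compose.rep_eq id_cblinfun.rep_eq)+
  then show "bij (cblinfun_apply (shift T \<mu>))"
    by (intro o_bij[of "cblinfun_apply S"]) auto
next
  assume bij: "bij (cblinfun_apply (shift T \<mu>))"
  then have "\<exists>D. \<forall>x. cblinfun_apply D x \<in> UNIV \<and>
      cblinfun_apply (shift T \<mu>) (cblinfun_apply D x) = cblinfun_apply id_cblinfun x"
    by (intro factor_through_injective) (auto simp: bij_def)
  then obtain D where D: "\<And>x. cblinfun_apply (shift T \<mu>) (cblinfun_apply D x) = x"
    by (auto simp: id_cblinfun.rep_eq)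
  then have "cblinfun_apply D (cblinfun_apply (shift T \<mu>) x) = x" for x
    using bij by (metis bij_pointE)
  then have "D o\<^sub>C\<^sub>L shift T \<mu> = id_cblinfun" "shift T \<mu> o\<^sub>C\<^sub>L D = id_cblinfun"
    using D by (auto intro!: cblinfun_eqI simp: cblinfun_compose.rep_eq id_cblinfun.rep_eq)
  then show "\<mu> \<notin> op_spectrum T" by (auto simp: op_spectrum_def)
qed

section \<open>Powers, ascent and descent\<close>

primrec cblinfun_power :: "'a::complex_normed_vector \<Rightarrow>\<^sub>C\<^sub>L 'a \<Rightarrow> nat \<Rightarrow> 'a \<Rightarrow>\<^sub>C\<^sub>L 'a" where
  "cblinfun_power S 0 = id_cblinfun"
| "cblinfun_power S (Suc n) = S o\<^sub>C\<^sub>L cblinfun_power S n"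

lemma cblinfun_apply_power: "cblinfun_apply (cblinfun_power S n) = cblinfun_apply S ^^ n"
  by (induction n) (auto simp: id_cblinfun.rep_eq cblinfun_compose.rep_eq)

lemma cblinfun_funpow_diff:
  fixes S :: "'a::complex_normed_vector \<Rightarrow>\<^sub>C\<^sub>L 'a"
  shows
  "(cblinfun_apply S ^^ n) (x - y) = (cblinfun_apply S ^^ n) x - (cblinfun_apply S ^^ n) y"
  using cblinfun_diff[of "cblinfun_power S n" x y] by (simp add: cblinfun_apply_power)

lemma range_pow_eq_image: "range_pow S n = range (cblinfun_apply (cblinfun_power S n))"
  by (simp add: range_pow_def cblinfun_apply_power)

lemma null_pow_eq_kernel: "null_pow S n = {x. cblinfun_apply (cblinfun_power S n) x = 0}"
  by (simp add: null_pow_def cblinfun_apply_power)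

lemma csubspace_range_pow: "csubspace (range_pow S n)"
  unfolding range_pow_eq_image by (rule csubspace_image[OF complex_vector.subspace_UNIV])

lemma csubspace_null_pow: "csubspace (null_pow S n)"
  unfolding null_pow_eq_kernel by (rule csubspace_kernel)

lemma range_pow_0: "range_pow S 0 = UNIV"
  by (simp add: range_pow_def)

lemma range_pow_Suc: "range_pow S (Suc n) = cblinfun_apply S ` range_pow S n"
  by (simp add: range_pow_def image_comp o_def)

lemma range_pow_add: "(cblinfun_apply S ^^ m) ` range_pow S n = range_pow S (m + n)"
  by (simp add: range_pow_def image_image funpow_add)

lemma range_pow_antimono: "m \<le> n \<Longrightarrow> range_pow S n \<subseteq> range_pow S m"
proof -
  assume "m \<le> n"
  then have "range_pow S n = (cblinfun_apply S ^^ m) ` range_pow S (n - m)"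
    by (simp add: range_pow_add)
  then show ?thesis by (auto simp: range_pow_def)
qed

lemma range_pow_invariant: "cblinfun_apply S ` range_pow S n \<subseteq> range_pow S n"
  using range_pow_antimono[of n "Suc n" S] by (simp add: range_pow_Suc)

lemma null_pow_mono: "m \<le> n \<Longrightarrow> null_pow S m \<subseteq> null_pow S n"
proof -
  have "(cblinfun_apply S ^^ k) 0 = 0" for k by (induction k) auto
  moreover assume "m \<le> n"
  then have "cblinfun_apply S ^^ n = (cblinfun_apply S ^^ (n - m)) \<circ> (cblinfun_apply S ^^ m)"
    by (simp flip: funpow_add)
  ultimately show ?thesis by (auto simp: null_pow_def)
qed

lemma range_pow_stable:
  assumes "range_pow S (Suc k) = range_pow S k" "k \<le> n"
  shows "range_pow S n = range_pow S k"
  using assms(2) by (induction n rule: dec_induct) (use assms(1) in \<open>simp_all add: range_pow_Suc\<close>)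

lemma null_pow_stable:
  assumes "null_pow S (Suc k) = null_pow S k" "k \<le> n"
  shows "null_pow S n = null_pow S k"
  using assms(2)
proof (induction n rule: dec_induct)
  case (step n)
  have "cblinfun_apply S x \<in> null_pow S n \<longleftrightarrow> cblinfun_apply S x \<in> null_pow S k" for x
    using step by simp
  then have "x \<in> null_pow S (Suc n) \<longleftrightarrow> x \<in> null_pow S (Suc k)" for x
    by (simp add: null_pow_def funpow_swap1)
  then show ?case using assms(1) by auto
qed simp

text \<open>
  A finite common value of ascent and descent means that the operator is bijective on the range of
  some power (that it is Drazin invertible); this is the form in which poles are used throughout.
\<close>

definition drazin_invertible :: "'a::complex_normed_vector \<Rightarrow>\<^sub>C\<^sub>L 'a \<Rightarrow> bool" where
  "drazin_invertible S \<longleftrightarrow> (\<exists>k. bij_betw (cblinfun_apply S) (range_pow S k) (range_pow S k))"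

lemma bij_betw_range_pow_iff:
  "bij_betw (cblinfun_apply S) (range_pow S k) (range_pow S k) \<longleftrightarrow>
    null_pow S k = null_pow S (Suc k) \<and> range_pow S k = range_pow S (Suc k)"
proof -
  let ?f = "cblinfun_apply S"
  have "inj_on ?f (range_pow S k) \<longleftrightarrow> (\<forall>x. (?f ^^ Suc k) x = 0 \<longrightarrow> (?f ^^ k) x = 0)"
    unfolding inj_on_iff_trivial_kernel[OF csubspace_range_pow] by (simp add: range_pow_def)
  also have "\<dots> \<longleftrightarrow> null_pow S k = null_pow S (Suc k)"
    using null_pow_mono[of k "Suc k" S] by (auto simp: null_pow_def)
  finally show ?thesis by (auto simp: bij_betw_def range_pow_Suc)
qed

lemma INF_enat_nat:
  "(INF n\<in>N. enat n) = (if N = {} then \<infinity> else enat (LEAST n. n \<in> N))"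
proof (cases "N = {}")
  case True
  then show ?thesis by (simp add: top_enat_def)
next
  case False
  then have "(LEAST n. n \<in> N) \<in> N" by (metis LeastI ex_in_conv)
  then have "(INF n\<in>N. enat n) = enat (LEAST n. n \<in> N)"
    by (intro antisym INF_lower INF_greatest) (auto intro: Least_le)
  then show ?thesis using False by simp
qed

lemma INF_enat_nat_mem: "(INF n\<in>N. enat n) = enat p \<Longrightarrow> p \<in> N"
  unfolding INF_enat_nat by (metis LeastI enat.inject enat.distinct(1) ex_in_conv)

text \<open>
  If \<open>S\<close> is bijective on \<open>R(S\<^sup>k)\<close>, let \<open>p\<close> and \<open>q\<close> be ascent and descent. Then \<open>R(S\<^sup>q) = R(S\<^sup>k)\<close>, and
  injectivity of \<open>S\<close> there gives \<open>p \<le> q\<close>. Conversely \<open>S\<^sup>k x = S\<^sup>k\<^sup>+\<^sup>1 z\<close> puts \<open>x - S z\<close> into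
  \<open>N(S\<^sup>k) = N(S\<^sup>p)\<close>, so that \<open>S\<^sup>p x = S\<^sup>p\<^sup>+\<^sup>1 z\<close> and \<open>q \<le> p\<close>.
\<close>

lemma drazin_invertible_iff_asc_dsc:
  "drazin_invertible S \<longleftrightarrow> asc S = dsc S \<and> dsc S < \<infinity>"
proof
  assume "asc S = dsc S \<and> dsc S < \<infinity>"
  then obtain p where p: "asc S = enat p" "dsc S = enat p" by (cases "dsc S") auto
  then have "null_pow S p = null_pow S (Suc p)" "range_pow S p = range_pow S (Suc p)"
    using INF_enat_nat_mem unfolding asc_def dsc_def by blast+
  then show "drazin_invertible S" by (auto simp: drazin_invertible_def bij_betw_range_pow_iff)
next
  let ?f = "cblinfun_apply S"
  let ?P = "\<lambda>n. null_pow S n = null_pow S (Suc n)" and ?Q = "\<lambda>n. range_pow S n = range_pow S (Suc n)"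
  assume "drazin_invertible S"
  then obtain k where k: "?P k" "?Q k"
    by (auto simp: drazin_invertible_def bij_betw_range_pow_iff)
  define p q where "p = (LEAST n. ?P n)" and "q = (LEAST n. ?Q n)"
  have p: "?P p" "p \<le> k" unfolding p_def by (rule LeastI[of ?P, OF k(1)], rule Least_le[of ?P, OF k(1)])
  have q: "?Q q" "q \<le> k" unfolding q_def by (rule LeastI[of ?Q, OF k(2)], rule Least_le[of ?Q, OF k(2)])
  have Rq: "range_pow S k = range_pow S q" by (rule range_pow_stable[OF q(1)[symmetric] q(2)])
  have Nk: "null_pow S k = null_pow S p" by (rule null_pow_stable[OF p(1)[symmetric] p(2)])
  have "bij_betw ?f (range_pow S q) (range_pow S q)"
    using bij_betw_range_pow_iff[of S k] k Rq by simp
  then have "?P q" by (simp add: bij_betw_range_pow_iff)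
  then have "p \<le> q" unfolding p_def by (rule Least_le)
  have "range_pow S p \<subseteq> range_pow S (Suc p)"
  proof
    fix y assume "y \<in> range_pow S p"
    then obtain x where x: "y = (?f ^^ p) x" by (auto simp: range_pow_def)
    have "(?f ^^ k) x \<in> range_pow S (Suc k)" using k(2) by (auto simp: range_pow_def)
    then obtain z where "(?f ^^ k) x = (?f ^^ k) (?f z)" by (auto simp: range_pow_def funpow_swap1)
    then have "x - ?f z \<in> null_pow S k"
      by (simp add: null_pow_def cblinfun_funpow_diff)
    then have "x - ?f z \<in> null_pow S p" using Nk by simp
    then have "y = (?f ^^ Suc p) z"
      by (simp add: null_pow_def cblinfun_funpow_diff x funpow_swap1)
    then show "y \<in> range_pow S (Suc p)" by (simp add: range_pow_def)
  qed
  then have "?Q p" using range_pow_antimono[of p "Suc p" S] by auto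
  then have "q \<le> p" unfolding q_def by (rule Least_le)
  have "asc S = enat p" "dsc S = enat q"
    unfolding asc_def dsc_def INF_enat_nat p_def q_def using k by auto
  then show "asc S = dsc S \<and> dsc S < \<infinity>" using \<open>p \<le> q\<close> \<open>q \<le> p\<close> by simp
qed

lemma poles_iff_drazin_invertible: "\<mu> \<in> poles T \<longleftrightarrow> drazin_invertible (shift T \<mu>)"
  by (simp add: poles_def drazin_invertible_iff_asc_dsc)

section \<open>Index zero and Drazin invertibility\<close>

definition index_zero_on :: "'a::complex_normed_vector set \<Rightarrow> 'a \<Rightarrow>\<^sub>C\<^sub>L 'a \<Rightarrow> bool" where
  "index_zero_on V T \<longleftrightarrow> alpha_on V T < \<infinity> \<and> beta_on V T = alpha_on V T"

lemma index_zero_on_iff: "index_zero_on V T \<longleftrightarrow> fredholm_on V T \<and> index_on V T = 0"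
  unfolding index_zero_on_def fredholm_on_def index_on_def
  by (cases "alpha_on V T"; cases "beta_on V T") auto

lemma weyl_iff_index_zero: "weyl T \<longleftrightarrow> index_zero_on UNIV T"
  by (simp add: weyl_def index_zero_on_iff)

lemma b_weylD:
  assumes "b_weyl S"
  shows "\<exists>n. closed (range_pow S n) \<and> index_zero_on (range_pow S n) S"
proof -
  have "b_fredholm_at S (LEAST n. b_fredholm_at S n)"
    using assms LeastI_ex[of "b_fredholm_at S"] by (simp add: b_weyl_def b_fredholm_def)
  moreover have "index_on (range_pow S (LEAST n. b_fredholm_at S n)) S = 0"
    using assms by (simp add: b_weyl_def b_index_def)
  ultimately show ?thesis by (auto simp: b_fredholm_at_def index_zero_on_iff)
qed

text \<open>
  The index of a B-Fredholm operator is read off at the least possible exponent, which may well be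
  smaller than \<open>k\<close>; this is what the last assumption takes care of.
\<close>

lemma b_weylI:
  assumes "closed (range_pow S k)" "index_zero_on (range_pow S k) S"
    and "\<And>n. alpha_on (range_pow S n) S < \<infinity> \<Longrightarrow> index_zero_on (range_pow S n) S"
  shows "b_weyl S"
proof -
  have "b_fredholm_at S k" using assms(1,2) by (simp add: b_fredholm_at_def index_zero_on_iff)
  then have "b_fredholm_at S (LEAST n. b_fredholm_at S n)" by (rule LeastI)
  then have "index_zero_on (range_pow S (LEAST n. b_fredholm_at S n)) S"
    by (intro assms(3)) (simp add: b_fredholm_at_def fredholm_on_def)
  then show ?thesis
    using \<open>b_fredholm_at S k\<close> unfolding b_weyl_def b_fredholm_def b_index_def index_zero_on_iff by blast
qed

lemma weyl_imp_b_weyl: "weyl S \<Longrightarrow> b_weyl S"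
proof -
  assume "weyl S"
  then have at0: "b_fredholm_at S 0" "index_zero_on (range_pow S 0) S"
    by (simp_all add: weyl_iff_index_zero b_fredholm_at_def index_zero_on_iff range_pow_0)
  then have "(LEAST n. b_fredholm_at S n) = 0" by (intro Least_eq_0)
  then show ?thesis
    using at0 unfolding b_weyl_def b_fredholm_def b_index_def index_zero_on_iff by auto
qed

lemma index_zero_on_bijective:
  assumes "csubspace V" "bij_betw (cblinfun_apply T) V V"
  shows "index_zero_on V T" "alpha_on V T = 0"
proof -
  have "{x \<in> V. cblinfun_apply T x = 0} = {0}"
    using assms inj_on_iff_trivial_kernel[OF assms(1), of T] complex_vector.subspace_0[OF assms(1)]
    by (auto simp: bij_betw_def)
  then show 0: "alpha_on V T = 0" by (simp add: alpha_on_eq_0_iff assms(1))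
  have "beta_on V T = 0" using assms by (simp add: beta_on_eq_0_iff bij_betw_def)
  then show "index_zero_on V T" using 0 by (simp add: index_zero_on_def)
qed

lemma bij_betw_if_index_zero_alpha_0:
  assumes V: "csubspace V" "cblinfun_apply T ` V \<subseteq> V" and "index_zero_on V T" "alpha_on V T = 0"
  shows "bij_betw (cblinfun_apply T) V V"
proof -
  have "{x \<in> V. cblinfun_apply T x = 0} = {0}"
    using assms(4) by (simp only: alpha_on_eq_0_iff[OF V(1)])
  then have "inj_on (cblinfun_apply T) V" unfolding inj_on_iff_trivial_kernel[OF V(1)] by blast
  moreover have "cblinfun_apply T ` V = V"
    using assms(3,4) by (simp add: index_zero_on_def beta_on_eq_0_iff[OF V])
  ultimately show ?thesis by (simp add: bij_betw_def)
qed

lemma bij_betw_range_pow_mono: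
  assumes "bij_betw (cblinfun_apply S) (range_pow S k) (range_pow S k)" "k \<le> n"
  shows "bij_betw (cblinfun_apply S) (range_pow S n) (range_pow S n)"
proof -
  have "range_pow S (Suc k) = range_pow S k" using assms(1) by (simp add: bij_betw_range_pow_iff)
  from range_pow_stable[OF this assms(2)] show ?thesis using assms(1) by simp
qed

text \<open>
  The index is the same on all ranges of powers and vanishes on the last one; since the nullities
  decrease along the way, the first one being finite makes all index equations finite.
\<close>

lemma drazin_invertible_index_zero:
  assumes bij: "bij_betw (cblinfun_apply S) (range_pow S k) (range_pow S k)"
    and fin: "alpha_on (range_pow S n) S < \<infinity>"
  shows "index_zero_on (range_pow S n) S"
proof (cases "k \<le> n")
  case True
  then show ?thesis
    using index_zero_on_bijective(1)[OF csubspace_range_pow bij_betw_range_pow_mono[OF bij]] by blast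
next
  case False
  then have "n \<le> k" by simp
  then show ?thesis using fin
  proof (induction n rule: inc_induct)
    case base
    then show ?case using index_zero_on_bijective(1)[OF csubspace_range_pow bij] by blast
  next
    case (step n)
    have "alpha_on (range_pow S (Suc n)) S \<le> alpha_on (range_pow S n) S"
      by (intro alpha_on_mono csubspace_range_pow range_pow_antimono) simp
    then have fin: "alpha_on (range_pow S (Suc n)) S < \<infinity>"
      using step.prems by (rule order_le_less_trans)
    then have "beta_on (range_pow S (Suc n)) S = alpha_on (range_pow S (Suc n)) S"
      using step.IH by (simp add: index_zero_on_def)
    then have "beta_on (range_pow S n) S + alpha_on (range_pow S (Suc n)) S
        = alpha_on (range_pow S n) S + alpha_on (range_pow S (Suc n)) S"
      using beta_on_range_step[OF csubspace_range_pow range_pow_invariant, of S n]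
      by (simp add: range_pow_Suc add.commute)
    then have "beta_on (range_pow S n) S = alpha_on (range_pow S n) S"
      using fin by (cases "beta_on (range_pow S n) S"; cases "alpha_on (range_pow S n) S";
          cases "alpha_on (range_pow S (Suc n)) S") auto
    then show ?case using step.prems by (simp add: index_zero_on_def)
  qed
qed

lemma drazin_invertible_weyl:
  assumes "drazin_invertible S" "alpha S < \<infinity>"
  shows "weyl S"
  using assms drazin_invertible_index_zero[where n = 0 and S = S]
  unfolding drazin_invertible_def weyl_iff_index_zero range_pow_0 by blast

lemma closed_null_pow: "closed (null_pow S n)"
proof -
  have "null_pow S n = (cblinfun_apply (cblinfun_power S n)) -` {0}"
    by (auto simp: null_pow_eq_kernel)
  then show ?thesis
    using continuous_closed_vimage[of "{0}" "cblinfun_apply (cblinfun_power S n)"]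
      linear_continuous_at[OF cblinfun_apply_bounded_linear] by auto
qed

text \<open>
  Here \<open>X\<close> is the algebraic direct sum of \<open>N(S\<^sup>k)\<close>, which is closed, and \<open>R(S\<^sup>k)\<close>. The open mapping
  theorem for \<open>(a, x) \<mapsto> a + S\<^sup>k x\<close> on \<open>N(S\<^sup>k) \<times> X\<close> bounds the projection onto the first summand, and
  \<open>R(S\<^sup>k)\<close> is the kernel of that projection.
\<close>

lemma drazin_invertible_closed_range:
  fixes S :: "'a::complex_banach \<Rightarrow>\<^sub>C\<^sub>L 'a"
  assumes bij: "bij_betw (cblinfun_apply S) (range_pow S k) (range_pow S k)"
  shows "closed (range_pow S k)"
proof -
  let ?R = "range_pow S k" and ?N = "null_pow S k"
  let ?q = "cblinfun_apply (cblinfun_power S k)"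
  define g :: "'a \<times> 'a \<Rightarrow> 'a" where "g p = fst p + ?q (snd p)" for p
  have bij_k: "bij_betw ?q ?R ?R"
    unfolding cblinfun_apply_power by (rule bij_betw_funpow[OF bij])
  have qR: "?q x \<in> ?R" for x by (simp add: range_pow_eq_image)
  have NR: "x = 0" if "x \<in> ?N" "x \<in> ?R" for x
    using that bij_k inj_on_iff_trivial_kernel[OF csubspace_range_pow, of "cblinfun_power S k" S k]
    by (auto simp: bij_betw_def null_pow_eq_kernel)
  have g_bl: "bounded_linear g"
    unfolding g_def
    by (intro bounded_linear_add bounded_linear_fst
        bounded_linear_compose[OF cblinfun_apply_bounded_linear bounded_linear_snd])
  have surj: "g ` (?N \<times> UNIV) = UNIV"
  proof -
    have "\<exists>a\<in>?N. \<exists>x. z = a + ?q x" for z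
    proof -
      have "?q z \<in> ?q ` ?R" using bij_k qR by (simp add: bij_betw_def)
      then obtain x where "?q z = ?q (?q x)" by (auto simp: range_pow_eq_image)
      then have "z - ?q x \<in> ?N" by (simp add: null_pow_eq_kernel cblinfun_diff)
      moreover have "z = (z - ?q x) + ?q x" by simp
      ultimately show ?thesis by blast
    qed
    then show ?thesis by (force simp: g_def image_iff)
  qed
  have "subspace (?N \<times> (UNIV :: 'a set))"
    by (intro subspace_Times csubspace_imp_subspace csubspace_null_pow subspace_UNIV)
  then obtain C where C: "C > 0" "\<And>z. \<exists>p\<in>?N \<times> UNIV. g p = z \<and> norm p \<le> C * norm z"
    using open_mapping_closed_subspaces[OF g_bl, of "?N \<times> UNIV"] closed_null_pow[of S k]
    unfolding surj by (auto simp: closed_Times)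
  show ?thesis
    unfolding closed_sequential_limits
  proof (intro allI impI, elim conjE)
    fix y l assume yR: "\<forall>i. y i \<in> ?R" and lim: "y \<longlonglongrightarrow> l"
    obtain p where p: "p \<in> ?N \<times> UNIV" "g p = l" using C(2) by blast
    define a where "a = fst p"
    have aN: "a \<in> ?N" and lR: "l - a \<in> ?R"
      using p qR by (auto simp: a_def g_def)
    have bound: "norm a \<le> C * norm (l - y i)" for i
    proof -
      obtain p' where p': "p' \<in> ?N \<times> UNIV" "g p' = l - y i" "norm p' \<le> C * norm (l - y i)"
        using C(2) by blast
      have "fst p' - a \<in> ?N"
        using p' aN complex_vector.subspace_diff[OF csubspace_null_pow] by auto
      moreover have "fst p' - a = (l - a) - y i - ?q (snd p')"
        using p'(2) by (simp add: g_def algebra_simps)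
      moreover have "(l - a) - y i - ?q (snd p') \<in> ?R"
        by (intro complex_vector.subspace_diff csubspace_range_pow lR yR[rule_format] qR)
      ultimately have "fst p' - a = 0" by (intro NR) (simp only:)+
      then have "fst p' = a" by simp
      moreover have "norm (fst p') \<le> norm p'" by (cases p') (simp add: norm_fst_le)
      ultimately have "norm a \<le> norm p'" by simp
      then show ?thesis using p'(3) by (rule order_trans)
    qed
    have "(\<lambda>i. C * norm (l - y i)) \<longlonglongrightarrow> C * norm (l - l)"
      by (intro tendsto_intros lim)
    then have "norm a \<le> 0"
      using bound by (intro LIMSEQ_le_const[where X = "\<lambda>i. C * norm (l - y i)"]) auto
    then show "l \<in> ?R" using lR by simp
  qed
qed

lemma drazin_invertible_b_weyl:
  fixes S :: "'a::complex_banach \<Rightarrow>\<^sub>C\<^sub>L 'a"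
  assumes "drazin_invertible S"
  shows "b_weyl S"
proof -
  obtain k where k: "bij_betw (cblinfun_apply S) (range_pow S k) (range_pow S k)"
    using assms by (auto simp: drazin_invertible_def)
  show ?thesis
    by (rule b_weylI[OF drazin_invertible_closed_range[OF k] index_zero_on_bijective(1)[OF csubspace_range_pow k]
          drazin_invertible_index_zero[OF k]])
qed

section \<open>Left multiplication operators\<close>

lemma left_mult_apply: "cblinfun_apply (cblinfun_apply (left_mult S) T) x = cblinfun_apply S (cblinfun_apply T x)"
  by (simp add: left_mult.rep_eq cblinfun_compose.rep_eq)

lemma left_mult_funpow_apply:
  "cblinfun_apply ((cblinfun_apply (left_mult S) ^^ n) T) x = (cblinfun_apply S ^^ n) (cblinfun_apply T x)"
  by (induction n) (simp_all add: left_mult_apply)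

lemma shift_apply: "cblinfun_apply (shift T \<mu>) x = cblinfun_apply T x - \<mu> *\<^sub>C x"
  by (simp add: shift_def minus_cblinfun.rep_eq scaleC_cblinfun.rep_eq id_cblinfun.rep_eq)

lemma shift_left_mult: "shift (left_mult A) \<mu> = left_mult (shift A \<mu>)"
  by (intro cblinfun_eqI) (simp add: shift_apply left_mult_apply minus_cblinfun.rep_eq scaleC_cblinfun.rep_eq)

lemma range_left_mult_subset:
  "T \<in> range_pow (left_mult S) n \<Longrightarrow> cblinfun_apply T x \<in> range_pow S n"
  by (auto simp: range_pow_def left_mult_funpow_apply)

lemma drazin_invertible_left_mult:
  fixes S :: "'a::complex_banach \<Rightarrow>\<^sub>C\<^sub>L 'a"
  assumes "drazin_invertible S"
  shows "drazin_invertible (left_mult S)"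
proof -
  let ?f = "cblinfun_apply S" and ?L = "cblinfun_apply (left_mult S)"
  obtain k where k: "bij_betw ?f (range_pow S k) (range_pow S k)"
    using assms by (auto simp: drazin_invertible_def)
  then have N: "null_pow S k = null_pow S (Suc k)" by (simp add: bij_betw_range_pow_iff)
  have bij': "bij_betw (?f ^^ Suc k) (range_pow S k) (range_pow S k)" by (rule bij_betw_funpow[OF k])
  have "\<exists>D. \<forall>x. cblinfun_apply D x \<in> range_pow S k \<and>
      cblinfun_apply (cblinfun_power S (Suc k)) (cblinfun_apply D x) = cblinfun_apply (cblinfun_power S k) x"
    using bij' csubspace_range_pow drazin_invertible_closed_range[OF k]
    by (intro factor_through_injective) (auto simp: bij_betw_def cblinfun_apply_power range_pow_def simp del: funpow.simps cblinfun_power.simps)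
  \<comment> \<open>\<open>S\<^sup>k = S\<^sup>k\<^sup>+\<^sup>1 D\<close>, so that \<open>S\<^sup>k T = S\<^sup>k\<^sup>+\<^sup>1 (D T)\<close> for every operator \<open>T\<close>\<close>
  then obtain D where D: "\<And>x. (?f ^^ Suc k) (cblinfun_apply D x) = (?f ^^ k) x"
    unfolding cblinfun_apply_power by blast
  have "null_pow (left_mult S) (Suc k) \<subseteq> null_pow (left_mult S) k"
  proof
    fix T assume "T \<in> null_pow (left_mult S) (Suc k)"
    then have T: "(?L ^^ Suc k) T = 0" unfolding null_pow_def by blast
    have "cblinfun_apply T x \<in> null_pow S (Suc k)" for x
      unfolding null_pow_def using left_mult_funpow_apply[of "Suc k" S T x] by (simp only: T zero_cblinfun.rep_eq) simp
    then have "(?f ^^ k) (cblinfun_apply T x) = 0" for x using N by (auto simp: null_pow_def)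
    then have "(?L ^^ k) T = 0"
      by (intro cblinfun_eqI) (simp add: left_mult_funpow_apply zero_cblinfun.rep_eq)
    then show "T \<in> null_pow (left_mult S) k" by (simp add: null_pow_def)
  qed
  moreover have "range_pow (left_mult S) k \<subseteq> range_pow (left_mult S) (Suc k)"
  proof
    fix T assume "T \<in> range_pow (left_mult S) k"
    then obtain T' where "T = (?L ^^ k) T'" by (auto simp: range_pow_def)
    then have "T = (?L ^^ Suc k) (D o\<^sub>C\<^sub>L T')"
      by (intro cblinfun_eqI) (simp only: left_mult_funpow_apply cblinfun_compose.rep_eq D)
    then show "T \<in> range_pow (left_mult S) (Suc k)" unfolding range_pow_def by blast
  qed
  ultimately have "bij_betw ?L (range_pow (left_mult S) k) (range_pow (left_mult S) k)"
    using null_pow_mono[of k "Suc k" "left_mult S"] range_pow_antimono[of k "Suc k" "left_mult S"]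
    unfolding bij_betw_range_pow_iff by auto
  then show ?thesis by (auto simp: drazin_invertible_def)
qed

lift_definition rank_one ::
  "('a::complex_normed_vector \<Rightarrow>\<^sub>C\<^sub>L complex) \<Rightarrow> 'b::complex_normed_vector \<Rightarrow> ('a \<Rightarrow>\<^sub>C\<^sub>L 'b)"
  is "\<lambda>\<phi> y x. \<phi> x *\<^sub>C y"
proof -
  fix \<phi> :: "'a \<Rightarrow> complex" and y :: 'b
  assume \<phi>: "bounded_clinear \<phi>"
  have "bounded_linear (\<lambda>c. c *\<^sub>C y)"
    by (rule bounded_linear_intro[where K = "norm y"])
      (simp_all add: scaleC_add_left norm_scaleC scaleR_scaleC scaleC_scaleC scaleC_complex_def mult.commute)
  then show "bounded_clinear (\<lambda>x. \<phi> x *\<^sub>C y)"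
    using \<phi> by (auto simp: bounded_clinear_def scaleC_scaleC scaleC_complex_def intro: bounded_linear_compose)
qed

text \<open>
  In infinite dimension there are arbitrarily many independent functionals, hence arbitrarily many
  independent operators \<open>\<phi> \<otimes> y\<close> in \<open>V\<close>. If \<open>V / W\<close> is finite-dimensional, some nonzero combination of
  them lies in \<open>W\<close>, and its range, which is spanned by \<open>y\<close>, is contained in \<open>U\<close>.
\<close>

lemma rank_one_finite_quotient:
  fixes V W :: "('a::complex_normed_vector \<Rightarrow>\<^sub>C\<^sub>L 'b::complex_normed_vector) set"
  assumes inf: "\<not> finite_cdim (UNIV :: 'a set)"
    and W: "csubspace W" and U: "csubspace U" and WU: "\<And>T x. T \<in> W \<Longrightarrow> cblinfun_apply T x \<in> U"
    and fin: "quotient_dim V W < \<infinity>" and y: "\<And>\<phi>. rank_one \<phi> y \<in> V"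
  shows "y \<in> U"
proof (rule ccontr)
  assume yU: "y \<notin> U"
  obtain n where n: "quotient_dim V W = enat n" using fin by (cases "quotient_dim V W") auto
  have "enat (Suc n) \<le> quotient_dim (UNIV :: 'a set) {0}"
    using inf by (simp add: finite_cdim_UNIV_iff)
  then obtain E :: "'a set" where E: "indep_mod {0} E" "card E = Suc n"
    using enat_le_quotient_dim_iff[OF csubspace_0] by blast
  then have fE: "finite E" by (simp add: indep_mod_def)
  obtain \<phi> :: "'a \<Rightarrow> 'a \<Rightarrow>\<^sub>C\<^sub>L complex"
    where \<phi>: "\<And>e e'. e \<in> E \<Longrightarrow> e' \<in> E \<Longrightarrow> cblinfun_apply (\<phi> e) e' = (if e = e' then 1 else 0)"
    using biorthogonal_functionals[OF E(1)] by blast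
  have apply_sum: "cblinfun_apply (\<Sum>e\<in>E. u e *\<^sub>C rank_one (\<phi> e) y) x
      = (\<Sum>e\<in>E. u e * cblinfun_apply (\<phi> e) x) *\<^sub>C y" for u x
    using fE by (induction E) (simp_all add: zero_cblinfun.rep_eq plus_cblinfun.rep_eq
        scaleC_cblinfun.rep_eq rank_one.rep_eq scaleC_add_left scaleC_scaleC complex_vector.scale_zero_left)
  have refl: "(\<Sum>e\<in>E. u e *\<^sub>C e) \<in> {0}" if "(\<Sum>e\<in>E. u e *\<^sub>C rank_one (\<phi> e) y) \<in> W" for u
  proof -
    have "u e' = 0" if e': "e' \<in> E" for e'
    proof (rule ccontr)
      assume "u e' \<noteq> 0"
      have "(\<Sum>e\<in>E. u e * cblinfun_apply (\<phi> e) e') = (\<Sum>e\<in>E. if e = e' then u e else 0)"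
        using \<phi> e' by (intro sum.cong) auto
      then have "cblinfun_apply (\<Sum>e\<in>E. u e *\<^sub>C rank_one (\<phi> e) y) e' = u e' *\<^sub>C y"
        using e' fE unfolding apply_sum by simp
      then have "u e' *\<^sub>C y \<in> U" using WU[OF \<open>_ \<in> W\<close>, of e'] by simp
      from complex_vector.subspace_scale[OF U this, of "inverse (u e')"] show False
        using \<open>u e' \<noteq> 0\<close> yU by (simp add: scaleC_scaleC scaleC_one)
    qed
    then show ?thesis by (simp add: complex_vector.scale_zero_left)
  qed
  have "indep_mod W ((\<lambda>e. rank_one (\<phi> e) y) ` E)" "card ((\<lambda>e. rank_one (\<phi> e) y) ` E) = Suc n"
    using indep_mod_image[OF E(1) complex_vector.subspace_0[OF W] refl] E(2) by auto
  moreover have "(\<lambda>e. rank_one (\<phi> e) y) ` E \<subseteq> V" using y by blast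
  ultimately have "enat (Suc n) \<le> quotient_dim V W"
    using enat_le_quotient_dim_iff[OF W] by blast
  then show False using n by simp
qed

lemma rank_one_left_mult_funpow:
  "(cblinfun_apply (left_mult S) ^^ n) (rank_one \<phi> x) = rank_one \<phi> ((cblinfun_apply S ^^ n) x)"
proof (rule cblinfun_eqI)
  fix z
  show "cblinfun_apply ((cblinfun_apply (left_mult S) ^^ n) (rank_one \<phi> x)) z
      = cblinfun_apply (rank_one \<phi> ((cblinfun_apply S ^^ n) x)) z"
    using cblinfun_apply_scaleC[of "cblinfun_power S n" "cblinfun_apply \<phi> z" x]
    by (simp add: left_mult_funpow_apply rank_one.rep_eq cblinfun_apply_power)
qed

lemma rank_one_in_range_pow: "y \<in> range_pow S n \<Longrightarrow> rank_one \<phi> y \<in> range_pow (left_mult S) n"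
  unfolding range_pow_def by (auto simp flip: rank_one_left_mult_funpow)

text \<open>
  The preceding criterion is applied twice at the exponent \<open>n\<close> of the B-Fredholm property: the kernel
  of \<open>L\<^sub>S\<close> on \<open>R(L\<^sub>S\<^sup>n)\<close> being finite-dimensional yields \<open>N(S) \<inter> R(S\<^sup>n) = 0\<close>, and its range having finite
  codimension yields \<open>R(S\<^sup>n) \<subseteq> R(S\<^sup>n\<^sup>+\<^sup>1)\<close>.
\<close>

lemma b_fredholm_left_mult_drazin_invertible:
  fixes S :: "'a::complex_banach \<Rightarrow>\<^sub>C\<^sub>L 'a"
  assumes inf: "\<not> finite_cdim (UNIV :: 'a set)" and "b_fredholm (left_mult S)"
  shows "drazin_invertible S"
proof -
  let ?L = "left_mult S"
  obtain n where "fredholm_on (range_pow ?L n) ?L"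
    using assms(2) by (auto simp: b_fredholm_def b_fredholm_at_def)
  then have fin: "quotient_dim {T \<in> range_pow ?L n. cblinfun_apply ?L T = 0} {0} < \<infinity>"
    "quotient_dim (range_pow ?L n) (range_pow ?L (Suc n)) < \<infinity>"
    by (simp_all add: fredholm_on_def alpha_on_eq csubspace_range_pow beta_on_def range_pow_Suc)
  have "y = 0" if y: "y \<in> range_pow S n" "cblinfun_apply S y = 0" for y
  proof -
    have "y \<in> {0}"
    proof (rule rank_one_finite_quotient[OF inf csubspace_0 csubspace_0 _ fin(1)])
      fix \<phi> :: "'a \<Rightarrow>\<^sub>C\<^sub>L complex"
      have "cblinfun_apply ?L (rank_one \<phi> y) = rank_one \<phi> 0"
        using rank_one_left_mult_funpow[of 1 S \<phi> y] y(2) by simp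
      also have "\<dots> = 0"
        by (intro cblinfun_eqI) (simp add: rank_one.rep_eq zero_cblinfun.rep_eq complex_vector.scale_zero_right)
      finally show "rank_one \<phi> y \<in> {T \<in> range_pow ?L n. cblinfun_apply ?L T = 0}"
        using rank_one_in_range_pow[OF y(1)] by simp
    qed (simp add: zero_cblinfun.rep_eq)
    then show ?thesis by simp
  qed
  then have inj: "inj_on (cblinfun_apply S) (range_pow S n)"
    by (simp add: inj_on_iff_trivial_kernel csubspace_range_pow)
  have "range_pow S n \<subseteq> range_pow S (Suc n)"
  proof
    fix y assume y: "y \<in> range_pow S n"
    show "y \<in> range_pow S (Suc n)"
    proof (rule rank_one_finite_quotient[OF inf csubspace_range_pow csubspace_range_pow _ fin(2)])
      show "cblinfun_apply T x \<in> range_pow S (Suc n)" if "T \<in> range_pow ?L (Suc n)" for T x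
        using that by (rule range_left_mult_subset)
      show "rank_one \<phi> y \<in> range_pow ?L n" for \<phi>
        using y by (rule rank_one_in_range_pow)
    qed
  qed
  then have "cblinfun_apply S ` range_pow S n = range_pow S n"
    using range_pow_invariant[of S n] by (auto simp: range_pow_Suc)
  then show ?thesis using inj by (auto simp: drazin_invertible_def bij_betw_def)
qed

lemma b_weyl_left_mult_iff:
  fixes S :: "'a::complex_banach \<Rightarrow>\<^sub>C\<^sub>L 'a"
  assumes "\<not> finite_cdim (UNIV :: 'a set)"
  shows "b_weyl (left_mult S) \<longleftrightarrow> drazin_invertible S"
  using b_fredholm_left_mult_drazin_invertible[OF assms]
    drazin_invertible_b_weyl[OF drazin_invertible_left_mult] by (auto simp: b_weyl_def)

lemma inj_left_mult_iff: "inj (cblinfun_apply (left_mult S)) \<longleftrightarrow> inj (cblinfun_apply S)"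
proof
  assume inj: "inj (cblinfun_apply (left_mult S))"
  have "x = 0" if x: "cblinfun_apply S x = 0" for x
  proof (rule ccontr)
    assume "x \<noteq> 0"
    then obtain \<phi> :: "'a \<Rightarrow>\<^sub>C\<^sub>L complex" where \<phi>: "cblinfun_apply \<phi> x = 1"
      using functionals_separate_points by blast
    have "cblinfun_apply (left_mult S) (rank_one \<phi> x) = 0"
      by (intro cblinfun_eqI)
        (simp add: left_mult_apply rank_one.rep_eq cblinfun_apply_scaleC x zero_cblinfun.rep_eq complex_vector.scale_zero_right)
    then have "rank_one \<phi> x = 0" using inj by (metis cblinfun_zero injD)
    then have "cblinfun_apply (rank_one \<phi> x) x = 0" by (simp add: zero_cblinfun.rep_eq)
    then show False using \<phi> \<open>x \<noteq> 0\<close> by (simp add: rank_one.rep_eq scaleC_one)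
  qed
  then show "inj (cblinfun_apply S)"
    by (simp add: inj_on_iff_trivial_kernel[OF complex_vector.subspace_UNIV])
next
  assume inj: "inj (cblinfun_apply S)"
  show "inj (cblinfun_apply (left_mult S))"
  proof (rule injI, rule cblinfun_eqI)
    fix T U x assume "cblinfun_apply (left_mult S) T = cblinfun_apply (left_mult S) U"
    then show "cblinfun_apply T x = cblinfun_apply U x" using inj by (metis left_mult_apply injD)
  qed
qed

lemma bij_left_mult_iff:
  fixes S :: "'a::complex_banach \<Rightarrow>\<^sub>C\<^sub>L 'a"
  shows "bij (cblinfun_apply (left_mult S)) \<longleftrightarrow> bij (cblinfun_apply S)"
proof
  assume bij: "bij (cblinfun_apply (left_mult S))"
  then obtain T where "cblinfun_apply (left_mult S) T = id_cblinfun" by (metis bij_pointE)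
  then have "cblinfun_apply S (cblinfun_apply T x) = x" for x
    by (metis left_mult_apply id_cblinfun.rep_eq)
  then show "bij (cblinfun_apply S)"
    using bij inj_left_mult_iff[of S] by (metis bij_def surjI)
next
  assume bij: "bij (cblinfun_apply S)"
  then have "\<exists>D. \<forall>x. cblinfun_apply D x \<in> UNIV \<and>
      cblinfun_apply S (cblinfun_apply D x) = cblinfun_apply id_cblinfun x"
    by (intro factor_through_injective) (auto simp: bij_def)
  then obtain D where "\<And>x. cblinfun_apply S (cblinfun_apply D x) = x"
    by (auto simp: id_cblinfun.rep_eq)
  then have "cblinfun_apply (left_mult S) (cblinfun_apply (left_mult D) T) = T" for T
    by (intro cblinfun_eqI) (simp add: left_mult_apply)
  then show "bij (cblinfun_apply (left_mult S))"
    using bij inj_left_mult_iff[of S] by (metis bij_def surjI)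
qed

lemma op_spectrum_left_mult:
  fixes A :: "'a::complex_banach \<Rightarrow>\<^sub>C\<^sub>L 'a"
  shows "op_spectrum (left_mult A) = op_spectrum A"
proof (rule set_eqI)
  fix \<mu>
  have "\<mu> \<notin> op_spectrum (left_mult A) \<longleftrightarrow> \<mu> \<notin> op_spectrum A"
    by (simp only: not_in_op_spectrum_iff_bij shift_left_mult bij_left_mult_iff)
  then show "\<mu> \<in> op_spectrum (left_mult A) \<longleftrightarrow> \<mu> \<in> op_spectrum A" by simp
qed

lemma alpha_eq_0_iff_inj: "alpha T = 0 \<longleftrightarrow> inj (cblinfun_apply T)"
  unfolding alpha_on_eq_0_iff[OF complex_vector.subspace_UNIV]
    inj_on_iff_trivial_kernel[OF complex_vector.subspace_UNIV]
  by (auto simp del: cblinfun_zero intro: cblinfun_zero)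

lemma isolated_eigenvalues_left_mult:
  fixes A :: "'a::complex_banach \<Rightarrow>\<^sub>C\<^sub>L 'a"
  shows "isolated_eigenvalues (left_mult A) = isolated_eigenvalues A"
proof -
  have "alpha (shift (left_mult A) \<mu>) = 0 \<longleftrightarrow> alpha (shift A \<mu>) = 0" for \<mu>
    by (simp only: alpha_eq_0_iff_inj shift_left_mult inj_left_mult_iff)
  then show ?thesis
    by (simp only: isolated_eigenvalues_def op_spectrum_left_mult zero_less_iff_neq_zero)
qed

section \<open>Finite-rank perturbations\<close>

text \<open>
  Let \<open>M\<close> be the preimage of \<open>M0\<close> under the bijection \<open>G\<close>, so \<open>M\<close> and \<open>M0\<close> have the same finite
  dimension. Since \<open>G\<close> and \<open>T\<close> agree modulo \<open>M0\<close>, \<open>T\<close> maps \<open>M\<close> into \<open>M0\<close> and has on \<open>V\<close> the same kernel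
  and the same cokernel as the map from \<open>M\<close> to \<open>M0\<close>; rank-nullity for the latter gives index zero.
\<close>

lemma finite_rank_perturbation_index_zero:
  fixes G T :: "'a::complex_normed_vector \<Rightarrow>\<^sub>C\<^sub>L 'a"
  assumes V: "csubspace V" and G: "bij_betw (cblinfun_apply G) V V"
    and TV: "cblinfun_apply T ` V \<subseteq> V"
    and M0: "csubspace M0" "M0 \<subseteq> V" "quotient_dim M0 {0} < \<infinity>"
    and diff: "\<And>x. x \<in> V \<Longrightarrow> cblinfun_apply G x - cblinfun_apply T x \<in> M0"
  shows "index_zero_on V T"
proof -
  let ?G = "cblinfun_apply G" and ?T = "cblinfun_apply T"
  let ?N = "{x \<in> V. ?T x = 0}"
  define M where "M = {x \<in> V. ?G x \<in> M0}"
  have M: "csubspace M"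
    using complex_vector.subspace_inter[OF V csubspace_vimage[OF M0(1), of G]]
    by (simp add: M_def Collect_conj_eq)
  have MV: "M \<subseteq> V" by (auto simp: M_def)
  have N: "csubspace ?N" by (rule csubspace_kernel_on[OF V])
  have mem_M: "x \<in> M \<longleftrightarrow> ?T x \<in> M0" if "x \<in> V" for x
  proof -
    have "?G x = (?G x - ?T x) + ?T x" "?T x = ?G x - (?G x - ?T x)" by simp_all
    then show ?thesis
      using that diff[OF that] complex_vector.subspace_add[OF M0(1)] complex_vector.subspace_diff[OF M0(1)]
      unfolding M_def by (metis (mono_tags, lifting) mem_Collect_eq)
  qed
  have NM: "?N \<subseteq> M" using mem_M complex_vector.subspace_0[OF M0(1)] by auto
  have TM: "?T ` V \<inter> M0 = ?T ` M" using mem_M MV by auto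
  have sTV: "csubspace (?T ` V)" and sTM: "csubspace (?T ` M)" using V M csubspace_image by blast+
  have GM: "?G ` M = M0"
  proof
    show "M0 \<subseteq> ?G ` M"
    proof
      fix m assume m: "m \<in> M0"
      then obtain x where "x \<in> V" "m = ?G x" using G M0(2) by (auto simp: bij_betw_def)
      then show "m \<in> ?G ` M" using m by (auto simp: M_def)
    qed
  qed (auto simp: M_def)
  have ker_G: "x \<in> {0}" if "x \<in> M" "?G x = 0" for x
    using that G inj_on_iff_trivial_kernel[OF V, of G] MV by (auto simp: bij_betw_def)
  have "quotient_dim (?G ` M) (?G ` {0}) = quotient_dim M {0}"
    using complex_vector.subspace_0[OF M] by (intro quotient_dim_image[OF M csubspace_0 _ ker_G]) simp_all
  then have 1: "quotient_dim M0 {0} = quotient_dim M {0}" unfolding GM by simp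
  have 2: "quotient_dim M {0} = quotient_dim M ?N + quotient_dim ?N {0}"
    using complex_vector.subspace_0[OF N] by (intro quotient_dim_chain M N csubspace_0 NM) blast
  have TN: "?T ` ?N = {0}" using complex_vector.subspace_0[OF N] by force
  have "quotient_dim (?T ` M) (?T ` ?N) = quotient_dim M ?N"
  proof (rule quotient_dim_image[OF M N NM])
    show "x \<in> ?N" if "x \<in> M" "?T x = 0" for x
      using that MV by blast
  qed
  then have 3: "quotient_dim (?T ` M) {0} = quotient_dim M ?N" unfolding TN .
  have TM0: "?T ` M \<subseteq> M0" using TM by blast
  have 4: "quotient_dim M0 {0} = quotient_dim M0 (?T ` M) + quotient_dim (?T ` M) {0}"
    using complex_vector.subspace_0[OF sTM] by (intro quotient_dim_chain M0 sTM csubspace_0 TM0) blast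
  have V_sum: "V = {a + b |a b. a \<in> M0 \<and> b \<in> ?T ` V}"
  proof (rule set_eqI, rule iffI)
    fix v assume "v \<in> V"
    then obtain x where x: "x \<in> V" "v = ?G x" using G by (auto simp: bij_betw_def)
    then have "v = (?G x - ?T x) + ?T x" by simp
    then show "v \<in> {a + b |a b. a \<in> M0 \<and> b \<in> ?T ` V}" using diff[OF x(1)] x(1) by blast
  next
    fix v assume "v \<in> {a + b |a b. a \<in> M0 \<and> b \<in> ?T ` V}"
    then show "v \<in> V" using M0(2) TV complex_vector.subspace_add[OF V] by blast
  qed
  have "quotient_dim V (?T ` V) = quotient_dim M0 (M0 \<inter> ?T ` V)"
    by (rule quotient_dim_second_iso[OF M0(1) sTV V_sum])
  then have 5: "beta_on V T = quotient_dim M0 (?T ` M)"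
    using TM by (simp add: beta_on_def Int_commute)
  have 6: "alpha_on V T = quotient_dim ?N {0}" by (rule alpha_on_eq[OF V])
  have fin: "quotient_dim M ?N < \<infinity>" "quotient_dim ?N {0} < \<infinity>"
    using M0(3) unfolding 1 2 by (cases "quotient_dim M ?N"; cases "quotient_dim ?N {0}"; simp)+
  have "quotient_dim M0 (?T ` M) + quotient_dim M ?N = quotient_dim ?N {0} + quotient_dim M ?N"
    using 1 2 3 4 by (simp add: add.commute)
  then have "quotient_dim M0 (?T ` M) = quotient_dim ?N {0}"
    using fin by (cases "quotient_dim M ?N"; cases "quotient_dim ?N {0}"; cases "quotient_dim M0 (?T ` M)") auto
  then show ?thesis using 5 6 fin(2) by (simp add: index_zero_on_def)
qed

text \<open>
  Conversely, an operator of index zero becomes bijective after adding a finite-rank operator \<open>K\<close>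
  that carries its kernel onto a complement of its range. By the last clause, \<open>(S + K)\<^sup>-\<^sup>1 y\<close> solves
  \<open>S x = y\<close> for \<open>y\<close> in the range of \<open>S\<close>, so that \<open>(S + K)\<^sup>-\<^sup>1\<close> serves as a right inverse of \<open>S\<close> there.
\<close>

lemma index_zero_bijective_perturbation:
  fixes S :: "'a::complex_normed_vector \<Rightarrow>\<^sub>C\<^sub>L 'a"
  assumes Y: "csubspace Y" and inv: "cblinfun_apply S ` Y \<subseteq> Y" and ind: "index_zero_on Y S"
  shows "\<exists>K M0. csubspace M0 \<and> M0 \<subseteq> Y \<and> quotient_dim M0 {0} < \<infinity> \<and> range (cblinfun_apply K) \<subseteq> M0 \<and>
    bij_betw (cblinfun_apply (S + K)) Y Y \<and>
    (\<forall>y\<in>cblinfun_apply S ` Y. \<exists>x\<in>Y. cblinfun_apply S x = y \<and> cblinfun_apply K x = 0)"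
proof -
  let ?S = "cblinfun_apply S"
  let ?N = "{x \<in> Y. ?S x = 0}"
  have N: "csubspace ?N" and SY: "csubspace (?S ` Y)"
    using Y csubspace_kernel_on csubspace_image by blast+
  have dims: "quotient_dim ?N {0} < \<infinity>" "quotient_dim Y (?S ` Y) = quotient_dim ?N {0}"
    using ind by (simp_all add: index_zero_on_def alpha_on_eq[OF Y] beta_on_def)
  then have "quotient_dim Y (?S ` Y) < \<infinity>" by simp
  then obtain E B where E: "quotient_basis ?N {0} E" and B: "quotient_basis Y (?S ` Y) B"
    using dims(1) unfolding quotient_dim_finite_iff by blast
  have fE: "finite E" and fB: "finite B" and EN: "E \<subseteq> ?N" and BY: "B \<subseteq> Y"
    using E B by (simp_all add: quotient_basis_def)
  have "card E = card B"
    using dims(2) quotient_dim_eq_card[OF csubspace_0 E] quotient_dim_eq_card[OF SY B] by simp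
  then obtain b where b: "bij_betw b E B" using finite_same_card_bij[OF fE fB] by blast
  then have bB: "b e \<in> B" if "e \<in> E" for e using that by (auto simp: bij_betw_def)
  have indE: "indep_mod {0} E" and indB: "indep_mod (?S ` Y) B"
    using E B quotient_basis_indep_mod by blast+
  obtain \<phi> :: "'a \<Rightarrow> 'a \<Rightarrow>\<^sub>C\<^sub>L complex"
    where \<phi>: "\<And>e e'. e \<in> E \<Longrightarrow> e' \<in> E \<Longrightarrow> cblinfun_apply (\<phi> e) e' = (if e = e' then 1 else 0)"
    using biorthogonal_functionals[OF indE] by blast
  define K where "K = (\<Sum>e\<in>E. rank_one (\<phi> e) (b e))"
  have K: "cblinfun_apply K x = (\<Sum>e\<in>E. cblinfun_apply (\<phi> e) x *\<^sub>C b e)" for x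
  proof -
    have "cblinfun_apply (\<Sum>e\<in>D. rank_one (\<phi> e) (b e)) x = (\<Sum>e\<in>D. cblinfun_apply (\<phi> e) x *\<^sub>C b e)"
      if "finite D" for D
      using that by (induction D) (simp_all add: zero_cblinfun.rep_eq plus_cblinfun.rep_eq rank_one.rep_eq)
    then show ?thesis using fE by (simp add: K_def)
  qed
  have reindex: "(\<Sum>e\<in>E. u e *\<^sub>C b e) = (\<Sum>y\<in>B. u (inv_into E b y) *\<^sub>C y)" for u
  proof -
    have "(\<Sum>y\<in>B. u (inv_into E b y) *\<^sub>C y) = (\<Sum>e\<in>E. u (inv_into E b (b e)) *\<^sub>C b e)"
      by (rule sum.reindex_bij_betw[OF b, symmetric])
    also have "\<dots> = (\<Sum>e\<in>E. u e *\<^sub>C b e)"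
      using b by (intro sum.cong) (auto simp: bij_betw_def)
    finally show ?thesis by simp
  qed
  have b_indep: "\<forall>e\<in>E. u e = 0" if "(\<Sum>e\<in>E. u e *\<^sub>C b e) \<in> ?S ` Y" for u
  proof
    fix e assume e: "e \<in> E"
    have "u (inv_into E b (b e)) = 0"
      using indep_modD[OF indB, of "\<lambda>y. u (inv_into E b y)" "b e"] that bB[OF e] reindex by simp
    then show "u e = 0" using b e by (simp add: bij_betw_def)
  qed
  have \<phi>_sum: "cblinfun_apply (\<phi> e) (\<Sum>e'\<in>E. u e' *\<^sub>C e') = u e" if e: "e \<in> E" for u e
  proof -
    have "cblinfun_apply (\<phi> e) (\<Sum>e'\<in>E. u e' *\<^sub>C e') = (\<Sum>e'\<in>E. if e = e' then u e' else 0)"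
      unfolding cblinfun_sum cblinfun_apply_scaleC scaleC_complex_def
      using \<phi> e by (intro sum.cong) auto
    then show ?thesis using e fE by simp
  qed
  have E_mem: "(\<Sum>e\<in>E. u e *\<^sub>C e) \<in> ?N" for u
    using EN by (intro complex_vector.subspace_sum[OF N] complex_vector.subspace_scale[OF N]) blast
  have K_sum: "cblinfun_apply K (\<Sum>e\<in>E. u e *\<^sub>C e) = (\<Sum>e\<in>E. u e *\<^sub>C b e)" for u
    unfolding K using \<phi>_sum by (intro sum.cong) auto
  \<comment> \<open>subtracting the components along \<open>E\<close>, which lie in the kernel of \<open>S\<close>, kills the values of \<open>\<phi>\<close>\<close>
  have adjust: "\<exists>x'\<in>Y. ?S x' = ?S x \<and> cblinfun_apply K x' = 0" if x: "x \<in> Y" for x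
  proof -
    define z where "z = (\<Sum>e\<in>E. cblinfun_apply (\<phi> e) x *\<^sub>C e)"
    have z: "z \<in> ?N" unfolding z_def by (rule E_mem)
    have "cblinfun_apply K (x - z) = 0" unfolding cblinfun_diff z_def K_sum by (simp add: K)
    moreover have "x - z \<in> Y" "?S (x - z) = ?S x"
      using z x complex_vector.subspace_diff[OF Y] by (simp_all add: cblinfun_diff)
    ultimately show ?thesis by blast
  qed
  define M0 where "M0 = cspan B"
  have M0: "csubspace M0" unfolding M0_def by (rule complex_vector.subspace_span)
  have M0Y: "M0 \<subseteq> Y" unfolding M0_def by (rule complex_vector.span_minimal[OF BY Y])
  have "finite_cdim M0" unfolding finite_cdim_def M0_def using fB by blast
  then have M0_fin: "quotient_dim M0 {0} < \<infinity>"
    unfolding ecdim_eq_quotient_dim[OF M0, symmetric] by (simp add: ecdim_def)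
  have KM0: "cblinfun_apply K x \<in> M0" for x
    unfolding K M0_def
    by (intro complex_vector.span_sum complex_vector.span_scale complex_vector.span_base bB)
  have F: "cblinfun_apply (S + K) x = ?S x + cblinfun_apply K x" for x
    by (simp add: plus_cblinfun.rep_eq)
  have "inj_on (cblinfun_apply (S + K)) Y"
    unfolding inj_on_iff_trivial_kernel[OF Y]
  proof (intro ballI impI)
    fix x assume x: "x \<in> Y" and "cblinfun_apply (S + K) x = 0"
    then have "?S x + cblinfun_apply K x = 0" unfolding F by blast
    then have "cblinfun_apply K x = - ?S x" by (rule minus_unique[symmetric])
    also have "- ?S x = ?S (- x)" using cblinfun_diff[of S 0 x] by simp
    finally have eq: "cblinfun_apply K x = ?S (- x)" .
    moreover have "- x \<in> Y" using x by (rule complex_vector.subspace_neg[OF Y])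
    ultimately have "cblinfun_apply K x \<in> ?S ` Y" by blast
    then have \<phi>0: "\<forall>e\<in>E. cblinfun_apply (\<phi> e) x = 0" unfolding K by (rule b_indep)
    then have "cblinfun_apply K x = 0" unfolding K by (simp add: complex_vector.scale_zero_left)
    then have "x \<in> ?N" using eq x cblinfun_diff[of S 0 x] by simp
    then obtain u where u: "x - (\<Sum>e\<in>E. u e *\<^sub>C e) \<in> {0}"
      using E unfolding quotient_basis_def by blast
    then have x_eq: "x = (\<Sum>e\<in>E. u e *\<^sub>C e)" by simp
    then have "\<forall>e\<in>E. u e = 0" using \<phi>0 \<phi>_sum by simp
    then show "x = 0" unfolding x_eq by (simp add: complex_vector.scale_zero_left)
  qed
  moreover have "cblinfun_apply (S + K) ` Y = Y"
  proof
    show "cblinfun_apply (S + K) ` Y \<subseteq> Y"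
    proof
      fix y assume "y \<in> cblinfun_apply (S + K) ` Y"
      then obtain x where "x \<in> Y" "y = ?S x + cblinfun_apply K x" using F by auto
      then show "y \<in> Y" using inv KM0 M0Y by (auto intro!: complex_vector.subspace_add[OF Y])
    qed
    show "Y \<subseteq> cblinfun_apply (S + K) ` Y"
    proof
      fix y assume "y \<in> Y"
      then obtain u where "y - (\<Sum>b\<in>B. u b *\<^sub>C b) \<in> ?S ` Y"
        using B unfolding quotient_basis_def by blast
      then obtain x0 where x0: "x0 \<in> Y" "y - (\<Sum>b\<in>B. u b *\<^sub>C b) = ?S x0" by blast
      obtain x where x: "x \<in> Y" "?S x = ?S x0" "cblinfun_apply K x = 0" using adjust[OF x0(1)] by blast
      define z where "z = (\<Sum>e\<in>E. u (b e) *\<^sub>C e)"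
      have z: "z \<in> ?N" unfolding z_def by (rule E_mem)
      have "cblinfun_apply K z = (\<Sum>e\<in>E. u (b e) *\<^sub>C b e)" unfolding z_def by (rule K_sum)
      also have "\<dots> = (\<Sum>b\<in>B. u b *\<^sub>C b)"
        using sum.reindex_bij_betw[OF b, of "\<lambda>y. u y *\<^sub>C y"] by simp
      finally have "cblinfun_apply (S + K) (x + z) = y"
        using x z x0(2) unfolding F cblinfun_add by (simp add: algebra_simps)
      moreover have "x + z \<in> Y" using x(1) z complex_vector.subspace_add[OF Y] by blast
      ultimately show "y \<in> cblinfun_apply (S + K) ` Y" by blast
    qed
  qed
  ultimately have "bij_betw (cblinfun_apply (S + K)) Y Y" by (simp add: bij_betw_def)
  moreover have "\<forall>y\<in>?S ` Y. \<exists>x\<in>Y. ?S x = y \<and> cblinfun_apply K x = 0" using adjust by blast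
  moreover have "range (cblinfun_apply K) \<subseteq> M0" using KM0 by blast
  ultimately show ?thesis using M0 M0Y M0_fin by blast
qed

text \<open>
  For \<open>F\<close> bounded below by \<open>c\<close> and \<open>|\<mu>| < c\<close>, the map \<open>z \<mapsto> F\<^sup>-\<^sup>1 (w + \<mu> z)\<close> is a contraction.
\<close>

lemma contraction_solve:
  fixes F :: "'a::complex_banach \<Rightarrow>\<^sub>C\<^sub>L 'a"
  assumes Y: "csubspace Y" and Z: "closed Z" "Z \<noteq> {}" "Z \<subseteq> Y"
    and c: "c > 0" "\<And>y. y \<in> Y \<Longrightarrow> c * norm y \<le> norm (cblinfun_apply F y)" and \<mu>: "cmod \<mu> < c"
    and solve: "\<And>z. z \<in> Z \<Longrightarrow> \<exists>z'\<in>Z. cblinfun_apply F z' = w + \<mu> *\<^sub>C z"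
  shows "\<exists>z\<in>Z. cblinfun_apply F z = w + \<mu> *\<^sub>C z"
proof -
  obtain h where h: "\<And>z. z \<in> Z \<Longrightarrow> h z \<in> Z \<and> cblinfun_apply F (h z) = w + \<mu> *\<^sub>C z"
    using solve by metis
  have "\<exists>!z\<in>Z. h z = z"
  proof (rule Banach_fix)
    show "complete Z" using Z(1) by (simp add: complete_eq_closed)
    show "0 \<le> cmod \<mu> / c" "cmod \<mu> / c < 1" using c(1) \<mu> by simp_all
    show "h ` Z \<subseteq> Z" using h by blast
    fix x y assume xy: "x \<in> Z" "y \<in> Z"
    then have "h x \<in> Y" "h y \<in> Y" using h Z(3) by auto
    then have "h x - h y \<in> Y" by (rule complex_vector.subspace_diff[OF Y])
    then have "c * norm (h x - h y) \<le> norm (cblinfun_apply F (h x - h y))" by (rule c(2))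
    also have "cblinfun_apply F (h x - h y) = \<mu> *\<^sub>C (x - y)"
      using h[OF xy(1)] h[OF xy(2)] by (simp add: cblinfun_diff complex_vector.scale_right_diff_distrib)
    also have "norm (\<mu> *\<^sub>C (x - y)) = cmod \<mu> * norm (x - y)" by (rule norm_scaleC)
    finally show "dist (h x) (h y) \<le> cmod \<mu> / c * dist x y"
      using c(1) by (simp add: dist_norm pos_le_divide_eq mult.commute)
  qed (rule Z(2))
  then obtain z where "z \<in> Z" "h z = z" by blast
  then show ?thesis using h by metis
qed

lemma bij_betw_shift:
  fixes F :: "'a::complex_banach \<Rightarrow>\<^sub>C\<^sub>L 'a"
  assumes Y: "csubspace Y" "closed Y" and F: "bij_betw (cblinfun_apply F) Y Y"
    and c: "c > 0" "\<And>y. y \<in> Y \<Longrightarrow> c * norm y \<le> norm (cblinfun_apply F y)" and \<mu>: "cmod \<mu> < c"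
  shows "bij_betw (cblinfun_apply (shift F \<mu>)) Y Y"
  unfolding bij_betw_def
proof (intro conjI equalityI subsetI)
  show "inj_on (cblinfun_apply (shift F \<mu>)) Y"
    unfolding inj_on_iff_trivial_kernel[OF Y(1)]
  proof (intro ballI impI, rule ccontr)
    fix x assume x: "x \<in> Y" "cblinfun_apply (shift F \<mu>) x = 0" "x \<noteq> 0"
    then have "norm (cblinfun_apply F x) = cmod \<mu> * norm x" by (simp add: shift_apply norm_scaleC)
    then have "c * norm x \<le> cmod \<mu> * norm x" using c(2)[OF x(1)] by simp
    then show False using \<mu> x(3) by simp
  qed
next
  fix y assume "y \<in> cblinfun_apply (shift F \<mu>) ` Y"
  then obtain x where "x \<in> Y" "y = cblinfun_apply F x - \<mu> *\<^sub>C x" by (auto simp: shift_apply)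
  then show "y \<in> Y"
    using F by (auto simp: bij_betw_def intro!: complex_vector.subspace_diff[OF Y(1)] complex_vector.subspace_scale[OF Y(1)])
next
  fix y assume y: "y \<in> Y"
  have "\<exists>z\<in>Y. cblinfun_apply F z = y + \<mu> *\<^sub>C z"
  proof (rule contraction_solve[OF Y(1,2) _ order_refl c \<mu>])
    show "Y \<noteq> {}" using y by blast
    fix z assume "z \<in> Y"
    then have "y + \<mu> *\<^sub>C z \<in> Y"
      using y by (intro complex_vector.subspace_add[OF Y(1)] complex_vector.subspace_scale[OF Y(1)])
    then show "\<exists>z'\<in>Y. cblinfun_apply F z' = y + \<mu> *\<^sub>C z" using F unfolding bij_betw_def by force
  qed
  then obtain z where "z \<in> Y" "cblinfun_apply (shift F \<mu>) z = y" by (auto simp: shift_apply)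
  then show "y \<in> cblinfun_apply (shift F \<mu>) ` Y" by blast
qed

text \<open>
  With \<open>F = S + K\<close> as above, \<open>S Y\<close> is the image of the closed subspace \<open>{x \<in> Y. K x = 0}\<close> under \<open>F\<close>,
  which is bounded below; hence it is closed. The index on \<open>S Y\<close> is the one on \<open>Y\<close>.
\<close>

lemma index_zero_on_range:
  fixes S :: "'a::complex_banach \<Rightarrow>\<^sub>C\<^sub>L 'a"
  assumes Y: "csubspace Y" "closed Y" and inv: "cblinfun_apply S ` Y \<subseteq> Y" and ind: "index_zero_on Y S"
  shows "closed (cblinfun_apply S ` Y)" "index_zero_on (cblinfun_apply S ` Y) S"
proof -
  let ?S = "cblinfun_apply S"
  obtain K M0 where bij: "bij_betw (cblinfun_apply (S + K)) Y Y"
    and K: "\<And>y. y \<in> ?S ` Y \<Longrightarrow> \<exists>x\<in>Y. ?S x = y \<and> cblinfun_apply K x = 0"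
    using index_zero_bijective_perturbation[OF Y(1) inv ind] by blast
  let ?F = "cblinfun_apply (S + K)"
  obtain c where c: "c > 0" "\<And>y. y \<in> Y \<Longrightarrow> c * norm y \<le> norm (?F y)"
    using bounded_below_on[OF Y, of "S + K"] bij Y(2) by (auto simp: bij_betw_def)
  define Z where "Z = {x \<in> Y. cblinfun_apply K x = 0}"
  have "Z = Y \<inter> cblinfun_apply K -` {0}" by (auto simp: Z_def)
  moreover have "closed (cblinfun_apply K -` {0})"
    using continuous_closed_vimage[of "{0}" "cblinfun_apply K"]
      linear_continuous_at[OF cblinfun_apply_bounded_linear] by auto
  ultimately have "closed Z" using Y(2) by auto
  then have "complete Z" by (simp add: complete_eq_closed)
  moreover have "subspace Z"
    unfolding Z_def by (rule csubspace_imp_subspace[OF csubspace_kernel_on[OF Y(1)]])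
  moreover have "\<forall>x\<in>Z. c * norm x \<le> norm (?F x)" using c(2) by (simp add: Z_def)
  ultimately have "complete (?F ` Z)"
    using complete_isometric_image[OF c(1) _ cblinfun_apply_bounded_linear] by blast
  moreover have "?F ` Z = ?S ` Y"
  proof
    show "?F ` Z \<subseteq> ?S ` Y" by (auto simp: Z_def plus_cblinfun.rep_eq)
    show "?S ` Y \<subseteq> ?F ` Z"
    proof
      fix y assume "y \<in> ?S ` Y"
      then obtain x where "x \<in> Y" "?S x = y" "cblinfun_apply K x = 0" using K by blast
      then have "x \<in> Z" "y = ?F x" by (simp_all add: Z_def plus_cblinfun.rep_eq)
      then show "y \<in> ?F ` Z" by blast
    qed
  qed
  ultimately show "closed (?S ` Y)" by (simp add: complete_eq_closed)
  have SY: "csubspace (?S ` Y)" by (rule csubspace_image[OF Y(1)])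
  have fin: "alpha_on Y S < \<infinity>" and eq: "beta_on Y S = alpha_on Y S"
    using ind by (simp_all add: index_zero_on_def)
  have "alpha_on (?S ` Y) S \<le> alpha_on Y S" by (rule alpha_on_mono[OF SY Y(1) inv])
  moreover have "beta_on (?S ` Y) S = alpha_on (?S ` Y) S"
    using beta_on_range_step[OF Y(1) inv] fin unfolding eq
    by (cases "alpha_on Y S"; cases "alpha_on (?S ` Y) S"; cases "beta_on (?S ` Y) S") auto
  ultimately show "index_zero_on (?S ` Y) S"
    using fin unfolding index_zero_on_def by (metis order_le_less_trans)
qed

lemma index_zero_range_pow_mono:
  fixes S :: "'a::complex_banach \<Rightarrow>\<^sub>C\<^sub>L 'a"
  assumes "closed (range_pow S n)" "index_zero_on (range_pow S n) S" "n \<le> m"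
  shows "closed (range_pow S m) \<and> index_zero_on (range_pow S m) S"
  using assms(3)
proof (induction m rule: dec_induct)
  case base
  then show ?case using assms by simp
next
  case (step m)
  then show ?case
    using index_zero_on_range[OF csubspace_range_pow _ range_pow_invariant, of S m]
    unfolding range_pow_Suc by blast
qed

text \<open>
  For \<open>\<mu> \<noteq> 0\<close> the operator \<open>S - \<mu>\<close> acts bijectively on \<open>X / R(S\<^sup>n)\<close>, on which \<open>S\<close> is nilpotent; so
  its nullity and defect on \<open>X\<close> are those of its restriction to \<open>R(S\<^sup>n)\<close>.
\<close>

lemma index_zero_shift_range_pow:
  assumes ind: "index_zero_on (range_pow S n) (shift S \<mu>)" and "\<mu> \<noteq> 0"
  shows "weyl (shift S \<mu>)"
proof -
  let ?S = "cblinfun_apply S" and ?T = "cblinfun_apply (shift S \<mu>)"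
  let ?Y = "range_pow S n"
  have TX: "csubspace (range ?T)" by (rule csubspace_image[OF complex_vector.subspace_UNIV])
  have mem: "x \<in> ?Y" if x: "?T x \<in> ?Y" for x
  proof -
    have "x \<in> range_pow S m" if "m \<le> n" for m
      using that
    proof (induction m)
      case 0
      then show ?case by (simp add: range_pow_0)
    next
      case (Suc m)
      then have "?S x \<in> range_pow S (Suc m)" by (simp add: range_pow_Suc)
      moreover have "?T x \<in> range_pow S (Suc m)" using x range_pow_antimono[OF Suc.prems, of S] by blast
      ultimately have "?S x - ?T x \<in> range_pow S (Suc m)"
        by (rule complex_vector.subspace_diff[OF csubspace_range_pow])
      then have "\<mu> *\<^sub>C x \<in> range_pow S (Suc m)" by (simp add: shift_apply)
      from complex_vector.subspace_scale[OF csubspace_range_pow this, of "inverse \<mu>"]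
      show ?case using \<open>\<mu> \<noteq> 0\<close> by (simp add: scaleC_scaleC scaleC_one)
    qed
    then show ?thesis by blast
  qed
  have decomp: "\<exists>y\<in>range_pow S m. x - y \<in> range ?T" for m x
  proof (induction m)
    case 0
    have "x - x \<in> range ?T" using complex_vector.subspace_0[OF TX] by simp
    then show ?case by (intro bexI[of _ x]) (simp_all add: range_pow_0)
  next
    case (Suc m)
    then obtain y where y: "y \<in> range_pow S m" "x - y \<in> range ?T" by blast
    define y' where "y' = ?S (inverse \<mu> *\<^sub>C y)"
    have "y' \<in> range_pow S (Suc m)"
      unfolding y'_def range_pow_Suc by (intro imageI complex_vector.subspace_scale[OF csubspace_range_pow] y(1))
    moreover have "y' - y = ?T (inverse \<mu> *\<^sub>C y)"
      using \<open>\<mu> \<noteq> 0\<close> by (simp add: y'_def shift_apply scaleC_scaleC scaleC_one)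
    then have "y' - y \<in> range ?T" by (simp only: rangeI)
    with y(2) have "(x - y) - (y' - y) \<in> range ?T" by (rule complex_vector.subspace_diff[OF TX])
    then have "x - y' \<in> range ?T" by simp
    ultimately show ?case by blast
  qed
  have "{x \<in> UNIV. ?T x = 0} = {x \<in> ?Y. ?T x = 0}"
    using mem complex_vector.subspace_0[OF csubspace_range_pow, of S n] by auto
  then have alpha: "alpha (shift S \<mu>) = alpha_on ?Y (shift S \<mu>)"
    by (simp add: alpha_on_def)
  have "UNIV = {a + b |a b. a \<in> ?Y \<and> b \<in> range ?T}"
  proof -
    have "\<exists>a b. x = a + b \<and> a \<in> ?Y \<and> b \<in> range ?T" for x
    proof -
      obtain y where y: "y \<in> ?Y" "x - y \<in> range ?T" using decomp by blast
      have "x = y + (x - y)" by simp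
      then show ?thesis using y by blast
    qed
    then show ?thesis by blast
  qed
  then have "quotient_dim UNIV (range ?T) = quotient_dim ?Y (?Y \<inter> range ?T)"
    by (rule quotient_dim_second_iso[OF csubspace_range_pow TX])
  moreover have "?Y \<inter> range ?T = ?T ` ?Y"
  proof -
    have "?T x \<in> ?Y" if "x \<in> ?Y" for x
    proof -
      have "?S x \<in> ?Y" using range_pow_invariant that by blast
      then have "?S x - \<mu> *\<^sub>C x \<in> ?Y"
        using that by (intro complex_vector.subspace_diff complex_vector.subspace_scale csubspace_range_pow)
      then show ?thesis by (simp add: shift_apply)
    qed
    then show ?thesis using mem by blast
  qed
  ultimately have "beta_on UNIV (shift S \<mu>) = beta_on ?Y (shift S \<mu>)"
    by (simp add: beta_on_def)
  then show ?thesis using ind alpha by (simp add: weyl_iff_index_zero index_zero_on_def)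
qed

text \<open>
  On \<open>R(S\<^sup>n)\<close> the operator \<open>S + K - \<mu>\<close> remains bijective for small \<open>\<mu>\<close>, and \<open>S - \<mu>\<close> differs from it by
  the finite-rank operator \<open>K\<close>.
\<close>

lemma b_weyl_imp_weyl_nearby:
  fixes S :: "'a::complex_banach \<Rightarrow>\<^sub>C\<^sub>L 'a"
  assumes "b_weyl S"
  shows "\<exists>\<epsilon>>0. \<forall>\<mu>. \<mu> \<noteq> 0 \<longrightarrow> cmod \<mu> < \<epsilon> \<longrightarrow> weyl (shift S \<mu>)"
proof -
  let ?S = "cblinfun_apply S"
  obtain n where n: "closed (range_pow S n)" "index_zero_on (range_pow S n) S"
    using b_weylD[OF assms] by blast
  let ?Y = "range_pow S n"
  note Y = csubspace_range_pow[of S n]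
  obtain K M0 where M0: "csubspace M0" "M0 \<subseteq> ?Y" "quotient_dim M0 {0} < \<infinity>"
    and K: "range (cblinfun_apply K) \<subseteq> M0" and bij: "bij_betw (cblinfun_apply (S + K)) ?Y ?Y"
    using index_zero_bijective_perturbation[OF Y range_pow_invariant n(2)] by blast
  obtain c where c: "c > 0" "\<And>y. y \<in> ?Y \<Longrightarrow> c * norm y \<le> norm (cblinfun_apply (S + K) y)"
    using bounded_below_on[OF Y n(1), of "S + K"] bij n(1) by (auto simp: bij_betw_def)
  have "weyl (shift S \<mu>)" if \<mu>: "\<mu> \<noteq> 0" "cmod \<mu> < c" for \<mu>
  proof (rule index_zero_shift_range_pow[OF _ \<mu>(1)])
    show "index_zero_on ?Y (shift S \<mu>)"
    proof (rule finite_rank_perturbation_index_zero[OF Y bij_betw_shift[OF Y n(1) bij c \<mu>(2)] _ M0])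
      show "cblinfun_apply (shift S \<mu>) ` ?Y \<subseteq> ?Y"
      proof
        fix y assume "y \<in> cblinfun_apply (shift S \<mu>) ` ?Y"
        then obtain x where x: "x \<in> ?Y" "y = ?S x - \<mu> *\<^sub>C x" by (auto simp: shift_apply)
        then have "?S x \<in> ?Y" using range_pow_invariant by blast
        then show "y \<in> ?Y"
          unfolding x(2) using x(1) by (intro complex_vector.subspace_diff complex_vector.subspace_scale Y)
      qed
      show "cblinfun_apply (shift (S + K) \<mu>) x - cblinfun_apply (shift S \<mu>) x \<in> M0" for x
        using K by (auto simp: shift_apply plus_cblinfun.rep_eq)
    qed
  qed
  then show ?thesis using c(1) by blast
qed

section \<open>Behaviour of the spectrum near a B-Weyl point\<close>

text \<open>
  Choose \<open>j\<close> such that \<open>N(S) \<inter> R(S\<^sup>m)\<close> is the same space for all \<open>m \<ge> j\<close>. If this space is zero, \<open>S\<close> is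
  injective on \<open>R(S\<^sup>j)\<close>, and also surjective as its index there is zero. Otherwise take \<open>e \<noteq> 0\<close> in it
  and let \<open>V\<close> be the intersection of all \<open>R(S\<^sup>m)\<close>, which contains \<open>e\<close>. An element of \<open>R(S\<^sup>j)\<close> that \<open>S\<close>
  maps into \<open>V\<close> already belongs to \<open>V\<close>, so the right inverse of \<open>S\<close> provided by \<open>K\<close> maps \<open>V\<close> into
  \<open>Z = {z \<in> V. K z = 0}\<close>. Solving \<open>S z = \<mu> (e + z)\<close> in \<open>Z\<close> by the contraction principle makes \<open>e + z\<close>
  an eigenvector for \<open>\<mu>\<close>; it is nonzero because \<open>K e \<noteq> 0\<close> and \<open>K z = 0\<close>.
\<close>

lemma b_weyl_dichotomy:
  fixes S :: "'a::complex_banach \<Rightarrow>\<^sub>C\<^sub>L 'a"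
  assumes "b_weyl S"
  shows "drazin_invertible S \<or>
    (\<exists>\<epsilon>>0. \<forall>\<mu>. cmod \<mu> < \<epsilon> \<longrightarrow> (\<exists>x. x \<noteq> 0 \<and> cblinfun_apply (shift S \<mu>) x = 0))"
proof -
  let ?S = "cblinfun_apply S"
  obtain n where "closed (range_pow S n)" "index_zero_on (range_pow S n) S"
    using b_weylD[OF assms] by blast
  then have closed: "\<And>m. n \<le> m \<Longrightarrow> closed (range_pow S m)"
    and ind: "\<And>m. n \<le> m \<Longrightarrow> index_zero_on (range_pow S m) S"
    using index_zero_range_pow_mono by blast+
  let ?N = "\<lambda>m. {x \<in> range_pow S m. ?S x = 0}"
  have N: "csubspace (?N m)" for m by (rule csubspace_kernel_on[OF csubspace_range_pow])
  let ?P = "\<lambda>a. \<exists>m\<ge>n. a = alpha_on (range_pow S m) S"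
  have "?P (LEAST a. ?P a)" by (rule LeastI[of ?P "alpha_on (range_pow S n) S"]) blast
  then obtain j where j: "n \<le> j" "(LEAST a. ?P a) = alpha_on (range_pow S j) S" by blast
  have minimal: "alpha_on (range_pow S j) S \<le> alpha_on (range_pow S m) S" if "n \<le> m" for m
    unfolding j(2)[symmetric] by (rule Least_le) (use that in blast)
  have stable: "?N m = ?N j" if m: "j \<le> m" for m
  proof -
    have sub: "?N m \<subseteq> ?N j" using range_pow_antimono[OF m, of S] by blast
    have "quotient_dim (?N j) {0} = quotient_dim (?N j) (?N m) + quotient_dim (?N m) {0}"
      using complex_vector.subspace_0[OF N] by (intro quotient_dim_chain N csubspace_0 sub) simp
    moreover have "quotient_dim (?N j) {0} \<le> quotient_dim (?N m) {0}"
      using minimal[of m] j(1) m by (simp add: alpha_on_eq csubspace_range_pow)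
    moreover have "quotient_dim (?N j) {0} < \<infinity>"
      using ind[OF j(1)] by (simp add: index_zero_on_def alpha_on_eq csubspace_range_pow)
    ultimately have "quotient_dim (?N j) (?N m) = 0"
      by (cases "quotient_dim (?N j) {0}"; cases "quotient_dim (?N j) (?N m)";
          cases "quotient_dim (?N m) {0}") (auto simp: zero_enat_def)
    then show ?thesis using quotient_dim_eq_0_iff[OF N N sub] by simp
  qed
  let ?Y = "range_pow S j"
  note Y = csubspace_range_pow[of S j] and cY = closed[OF j(1)]
  show ?thesis
  proof (cases "?N j = {0}")
    case True
    then have "alpha_on ?Y S = 0" by (simp add: alpha_on_eq_0_iff[OF Y])
    then have "bij_betw ?S ?Y ?Y"
      by (rule bij_betw_if_index_zero_alpha_0[OF Y range_pow_invariant ind[OF j(1)]])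
    then show ?thesis by (auto simp: drazin_invertible_def)
  next
    case False
    then obtain e where e: "e \<in> ?N j" "e \<noteq> 0" using complex_vector.subspace_0[OF N[of j]] by blast
    obtain K M0 where bij: "bij_betw (cblinfun_apply (S + K)) ?Y ?Y"
      and K: "\<And>y. y \<in> ?S ` ?Y \<Longrightarrow> \<exists>x\<in>?Y. ?S x = y \<and> cblinfun_apply K x = 0"
      using index_zero_bijective_perturbation[OF Y range_pow_invariant ind[OF j(1)]] by blast
    let ?F = "cblinfun_apply (S + K)"
    have F: "?F x = ?S x + cblinfun_apply K x" for x by (simp add: plus_cblinfun.rep_eq)
    obtain c where c: "c > 0" "\<And>y. y \<in> ?Y \<Longrightarrow> c * norm y \<le> norm (?F y)"
      using bounded_below_on[OF Y cY, of "S + K"] bij cY by (auto simp: bij_betw_def)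
    define V where "V = (\<Inter>m\<in>{j..}. range_pow S m)"
    have V: "csubspace V" unfolding V_def by (intro complex_vector.subspace_Inter) (auto simp: csubspace_range_pow)
    have "closed V" unfolding V_def using closed j(1) by (intro closed_INT ballI) auto
    have VY: "V \<subseteq> ?Y" by (auto simp: V_def)
    have eV: "e \<in> V" unfolding V_def using e(1) stable by blast
    have lift: "x \<in> V" if x: "x \<in> ?Y" "?S x \<in> V" for x
    proof -
      have "x \<in> range_pow S m" if m: "j \<le> m" for m
      proof -
        have "?S x \<in> range_pow S (Suc m)" using x(2) m by (simp add: V_def)
        then obtain x' where x': "x' \<in> range_pow S m" "?S x = ?S x'" by (auto simp: range_pow_Suc)
        then have "x - x' \<in> ?N j"
          using x(1) range_pow_antimono[OF m, of S] complex_vector.subspace_diff[OF Y]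
          by (auto simp: cblinfun_diff)
        then have "x - x' \<in> range_pow S m" using stable[OF m] by blast
        from complex_vector.subspace_add[OF csubspace_range_pow this x'(1)] show ?thesis by simp
      qed
      then show ?thesis by (simp add: V_def)
    qed
    define Z where "Z = {z \<in> V. cblinfun_apply K z = 0}"
    have Z: "csubspace Z" unfolding Z_def by (rule csubspace_kernel_on[OF V])
    have "Z = V \<inter> cblinfun_apply K -` {0}" by (auto simp: Z_def)
    moreover have "closed (cblinfun_apply K -` {0})"
      using continuous_closed_vimage[of "{0}" "cblinfun_apply K"]
        linear_continuous_at[OF cblinfun_apply_bounded_linear] by auto
    ultimately have "closed Z" using \<open>closed V\<close> by auto
    have "\<exists>x. x \<noteq> 0 \<and> cblinfun_apply (shift S \<mu>) x = 0" if \<mu>: "cmod \<mu> < c" for \<mu>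
    proof -
      have "\<exists>z\<in>Z. ?F z = \<mu> *\<^sub>C e + \<mu> *\<^sub>C z"
      proof (rule contraction_solve[OF Y \<open>closed Z\<close> _ _ c \<mu>])
        show "Z \<noteq> {}" using complex_vector.subspace_0[OF Z] by blast
        show "Z \<subseteq> ?Y" using VY by (auto simp: Z_def)
        fix z assume "z \<in> Z"
        then have y: "\<mu> *\<^sub>C e + \<mu> *\<^sub>C z \<in> V"
          using eV by (auto simp: Z_def intro!: complex_vector.subspace_add[OF V] complex_vector.subspace_scale[OF V])
        then have "\<mu> *\<^sub>C e + \<mu> *\<^sub>C z \<in> range_pow S (Suc j)" by (simp add: V_def)
        then obtain x where x: "x \<in> ?Y" "?S x = \<mu> *\<^sub>C e + \<mu> *\<^sub>C z" "cblinfun_apply K x = 0"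
          using K unfolding range_pow_Suc by blast
        then have "x \<in> Z" using lift[OF x(1)] y by (simp add: Z_def)
        moreover have "?F x = \<mu> *\<^sub>C e + \<mu> *\<^sub>C z" unfolding F x(2,3) by simp
        ultimately show "\<exists>z'\<in>Z. ?F z' = \<mu> *\<^sub>C e + \<mu> *\<^sub>C z" by blast
      qed
      then obtain z where z: "z \<in> Z" "?F z = \<mu> *\<^sub>C e + \<mu> *\<^sub>C z" by blast
      then have "?S (e + z) = \<mu> *\<^sub>C (e + z)"
        using e(1) F[of z] by (simp add: Z_def cblinfun_add scaleC_add_right)
      then have "cblinfun_apply (shift S \<mu>) (e + z) = 0" by (simp add: shift_apply)
      moreover have "e + z \<noteq> 0"
      proof
        assume "e + z = 0"
        then have "cblinfun_apply K e + cblinfun_apply K z = 0" by (simp flip: cblinfun_add)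
        then have "?F e = 0" using e(1) z(1) F by (simp add: Z_def)
        then have "e = 0"
          using bij e(1) inj_on_iff_trivial_kernel[OF Y, of "S + K"] by (auto simp: bij_betw_def)
        then show False using e(2) by simp
      qed
      ultimately show ?thesis by blast
    qed
    then show ?thesis using c(1) by blast
  qed
qed

lemma shift_shift: "shift (shift A \<nu>) \<mu> = shift A (\<nu> + \<mu>)"
  by (intro cblinfun_eqI) (simp add: shift_apply scaleC_add_left diff_diff_eq)

lemma eigenvalue_in_op_spectrum:
  fixes A :: "'a::complex_banach \<Rightarrow>\<^sub>C\<^sub>L 'a"
  assumes "x \<noteq> 0" "cblinfun_apply (shift A \<mu>) x = 0"
  shows "\<mu> \<in> op_spectrum A"
proof (rule ccontr)
  assume "\<mu> \<notin> op_spectrum A"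
  then have "inj (cblinfun_apply (shift A \<mu>))" by (simp add: not_in_op_spectrum_iff_bij bij_def)
  then show False using assms by (metis cblinfun_zero injD)
qed

lemma b_weyl_pole_or_disc_in_spectrum:
  fixes A :: "'a::complex_banach \<Rightarrow>\<^sub>C\<^sub>L 'a"
  assumes "b_weyl (shift A \<nu>)"
  shows "\<nu> \<in> poles A \<or> (\<exists>\<epsilon>>0. ball \<nu> \<epsilon> \<subseteq> op_spectrum A)"
proof (cases "drazin_invertible (shift A \<nu>)")
  case True
  then show ?thesis by (simp add: poles_iff_drazin_invertible)
next
  case False
  then obtain \<epsilon> where "\<epsilon> > 0"
    and eig: "\<And>\<mu>. cmod \<mu> < \<epsilon> \<Longrightarrow> \<exists>x. x \<noteq> 0 \<and> cblinfun_apply (shift A (\<nu> + \<mu>)) x = 0"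
    using b_weyl_dichotomy[OF assms] unfolding shift_shift by blast
  have "\<mu> \<in> op_spectrum A" if "\<mu> \<in> ball \<nu> \<epsilon>" for \<mu>
    using eig[of "\<mu> - \<nu>"] that eigenvalue_in_op_spectrum[of _ A \<mu>]
    by (auto simp: dist_norm norm_minus_commute)
  then show ?thesis using \<open>\<epsilon> > 0\<close> by blast
qed

lemma not_isolated_if_ball_subset:
  assumes "\<mu> \<in> ball \<nu> \<epsilon>" "ball \<nu> \<epsilon> \<subseteq> K"
  shows "\<mu> \<notin> iso K"
proof
  assume "\<mu> \<in> iso K"
  then obtain T where T: "open T" "T \<inter> K = {\<mu>}" by (auto simp: iso_def isolated_in_def)
  then have "T \<inter> ball \<nu> \<epsilon> = {\<mu>}" using assms by blast
  then have "open {\<mu>}" using T(1) by (metis open_Int open_ball)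
  then show False using not_open_singleton by blast
qed

lemma not_in_op_spectrum_imp_pole:
  fixes A :: "'a::complex_banach \<Rightarrow>\<^sub>C\<^sub>L 'a"
  assumes "\<mu> \<notin> op_spectrum A"
  shows "\<mu> \<in> poles A" "alpha (shift A \<mu>) = 0"
proof -
  have bij: "bij (cblinfun_apply (shift A \<mu>))" using assms by (simp add: not_in_op_spectrum_iff_bij)
  then have "bij_betw (cblinfun_apply (shift A \<mu>)) (range_pow (shift A \<mu>) 0) (range_pow (shift A \<mu>) 0)"
    by (simp add: range_pow_0)
  then show "\<mu> \<in> poles A" unfolding poles_iff_drazin_invertible drazin_invertible_def by blast
  show "alpha (shift A \<mu>) = 0"
    by (rule index_zero_on_bijective(2)[OF complex_vector.subspace_UNIV bij])
qed

lemma isolated_eigenvalues_subset_op_spectrum: "isolated_eigenvalues A \<subseteq> op_spectrum A"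
  by (auto simp: isolated_eigenvalues_def iso_def isolated_in_def)

section \<open>Generalized Weyl's theorem\<close>

lemma generalized_weyl_left_mult_iff:
  fixes A :: "'a::complex_banach \<Rightarrow>\<^sub>C\<^sub>L 'a"
  assumes "\<not> finite_cdim (UNIV :: 'a set)"
  shows "generalized_weyl_theorem (left_mult A) \<longleftrightarrow> poles A \<inter> op_spectrum A = isolated_eigenvalues A"
proof -
  have "b_weyl_spectrum (left_mult A) = - poles A"
    by (auto simp: b_weyl_spectrum_def shift_left_mult b_weyl_left_mult_iff[OF assms] poles_iff_drazin_invertible)
  also have "\<dots> = op_spectrum A - poles A"
    using not_in_op_spectrum_imp_pole(1)[of _ A] by blast
  finally show ?thesis
    unfolding generalized_weyl_theorem_def op_spectrum_left_mult isolated_eigenvalues_left_mult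
    using isolated_eigenvalues_subset_op_spectrum[of A] by blast
qed

theorem theorem3p5:
  fixes A :: "'a::complex_banach \<Rightarrow>\<^sub>C\<^sub>L 'a"
  assumes "\<not> finite_cdim (UNIV :: 'a set)"
  shows "generalized_weyl_theorem A \<longleftrightarrow>
    generalized_weyl_theorem (left_mult A) \<and> browder_theorem A"
proof
  assume gw: "generalized_weyl_theorem A"
  then have b_weyl_iff: "b_weyl (shift A \<mu>) \<longleftrightarrow> \<mu> \<notin> op_spectrum A \<or> \<mu> \<in> isolated_eigenvalues A" for \<mu>
    unfolding generalized_weyl_theorem_def b_weyl_spectrum_def by blast
  have "isolated_eigenvalues A \<subseteq> poles A"
  proof
    fix \<mu> assume \<mu>: "\<mu> \<in> isolated_eigenvalues A"
    then have "\<mu> \<in> iso (op_spectrum A)" by (simp add: isolated_eigenvalues_def)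
    then show "\<mu> \<in> poles A"
      using b_weyl_pole_or_disc_in_spectrum[of A \<mu>] \<mu> b_weyl_iff not_isolated_if_ball_subset centre_in_ball
      by metis
  qed
  moreover have "\<mu> \<in> isolated_eigenvalues A" if "\<mu> \<in> poles A" "\<mu> \<in> op_spectrum A" for \<mu>
  proof -
    have "b_weyl (shift A \<mu>)"
      using that(1) by (intro drazin_invertible_b_weyl) (simp add: poles_iff_drazin_invertible)
    then show ?thesis using b_weyl_iff that(2) by blast
  qed
  ultimately have poles: "poles A \<inter> op_spectrum A = isolated_eigenvalues A"
    using isolated_eigenvalues_subset_op_spectrum[of A] by blast
  have weyl_iff: "weyl (shift A \<mu>) \<longleftrightarrow> \<mu> \<notin> op_spectrum A \<or> \<mu> \<in> poles_finite_rank A" for \<mu>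
  proof
    assume w: "weyl (shift A \<mu>)"
    then have "alpha (shift A \<mu>) < \<infinity>" by (simp add: weyl_iff_index_zero index_zero_on_def)
    moreover have "\<mu> \<notin> op_spectrum A \<or> \<mu> \<in> poles A"
      using weyl_imp_b_weyl[OF w] b_weyl_iff poles by blast
    ultimately show "\<mu> \<notin> op_spectrum A \<or> \<mu> \<in> poles_finite_rank A" by (simp add: poles_finite_rank_def)
  next
    assume "\<mu> \<notin> op_spectrum A \<or> \<mu> \<in> poles_finite_rank A"
    then have "\<mu> \<in> poles A" "alpha (shift A \<mu>) < \<infinity>"
      using not_in_op_spectrum_imp_pole[of \<mu> A] by (auto simp: poles_finite_rank_def zero_enat_def)
    then show "weyl (shift A \<mu>)" by (simp add: poles_iff_drazin_invertible drazin_invertible_weyl)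
  qed
  have "browder_theorem A"
    unfolding browder_theorem_def weyl_spectrum_def weyl_iff by blast
  then show "generalized_weyl_theorem (left_mult A) \<and> browder_theorem A"
    using poles generalized_weyl_left_mult_iff[OF assms] by blast
next
  assume "generalized_weyl_theorem (left_mult A) \<and> browder_theorem A"
  then have poles: "poles A \<inter> op_spectrum A = isolated_eigenvalues A"
    and browder: "weyl_spectrum A = op_spectrum A - poles_finite_rank A"
    using generalized_weyl_left_mult_iff[OF assms] by (auto simp: browder_theorem_def)
  have "\<nu> \<in> poles A" if bw: "b_weyl (shift A \<nu>)" for \<nu>
  proof (rule ccontr)
    assume "\<nu> \<notin> poles A"
    then obtain \<epsilon> where \<epsilon>: "\<epsilon> > 0" "ball \<nu> \<epsilon> \<subseteq> op_spectrum A"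
      using b_weyl_pole_or_disc_in_spectrum[OF bw] by blast
    obtain \<delta> where \<delta>: "\<delta> > 0" "\<And>\<mu>. \<mu> \<noteq> 0 \<Longrightarrow> cmod \<mu> < \<delta> \<Longrightarrow> weyl (shift A (\<nu> + \<mu>))"
      using b_weyl_imp_weyl_nearby[OF bw] unfolding shift_shift by blast
    define \<mu> where "\<mu> = complex_of_real (min \<epsilon> \<delta> / 2)"
    have "cmod \<mu> = min \<epsilon> \<delta> / 2" using \<epsilon>(1) \<delta>(1) by (simp add: \<mu>_def)
    then have \<mu>: "\<mu> \<noteq> 0" "cmod \<mu> < \<epsilon>" "cmod \<mu> < \<delta>" using \<epsilon>(1) \<delta>(1) by auto
    have ball: "\<nu> + \<mu> \<in> ball \<nu> \<epsilon>" using \<mu>(2) by (simp add: dist_norm)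
    have "\<nu> + \<mu> \<notin> weyl_spectrum A" using \<delta>(2)[OF \<mu>(1,3)] by (simp add: weyl_spectrum_def)
    then have "\<nu> + \<mu> \<in> poles A \<inter> op_spectrum A"
      using browder ball \<epsilon>(2) by (auto simp: poles_finite_rank_def)
    then have "\<nu> + \<mu> \<in> iso (op_spectrum A)" unfolding poles by (simp add: isolated_eigenvalues_def)
    then show False using not_isolated_if_ball_subset[OF ball \<epsilon>(2)] by blast
  qed
  then have "b_weyl (shift A \<nu>) \<longleftrightarrow> \<nu> \<in> poles A" for \<nu>
    using drazin_invertible_b_weyl[of "shift A \<nu>"] unfolding poles_iff_drazin_invertible by blast
  then have "b_weyl_spectrum A = op_spectrum A - poles A"
    using not_in_op_spectrum_imp_pole(1)[of _ A] unfolding b_weyl_spectrum_def by blast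
  then show "generalized_weyl_theorem A"
    unfolding generalized_weyl_theorem_def poles[symmetric] by blast
qed

end
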